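(* Let $S$ be a string of length $n$ over an alphabet $\Sigma$. (1) For every character $\sigma\in\Sigma$, the $3$-cadences of $S$ with $\sigma$ can be counted in $\mathcal{O}(n(\log n)^2)$ time. Also, if all $n_\sigma$ occurrences of $\sigma$ are known, the $3$-cadences with $\sigma$ can be counted in $\mathcal{O}(n_\sigma^2)$ time. (2) The number of all $3$-cadences of $S$ can be computed in $\mathcal{O}\left(\min\left(|\Sigma|\,n(\log n)^2,\; n^{3/2}\log n\right)\right)$ time. (3) For every integer $o\ge 1$, after counting at least $o$ $3$-cadences, it is possible to output $o$ $3$-cadences in $\mathcal{O}(on)$ time.
   Context: A string $S=S[1]S[2]\cdots S[n]$ is a sequence of characters from $\Sigma$. A $3$-cadence of $S$ is a pair $(i,d)$ of positive integers with $i-d\le 0$, $i+2d\le n<i+3d$ and $S[i]=S[i+d]=S[i+2d]$; it is a $3$-cadence with $\sigma$ if this common character is $\sigma$. "After counting" means that the output of the counting algorithm is available, namely, for every position $z\in\{1,\dots,n\}$, the number of $3$-cadences $(i,d)$ with $i+2d=z$. Computational model: arithmetic operations on integers with $\mathcal{O}(\log n)$ bits take constant time; each character $S[j]$ can be read in constant time; characters are sufficiently small integers, so that they can be sorted. The standard fact that the acyclic convolution of two sequences of length $m$ can be computed in $\mathcal{O}(m\log m)$ operations is assumed. Constants in $\mathcal{O}$ are absolute. *)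

theory Defs
  imports Complex_Main "HOL-Library.Landau_Symbols"
begin

section \<open>Cadences\<close>

definition char_at :: "int list \<Rightarrow> nat \<Rightarrow> int" where
  "char_at S j = S ! (j - 1)"  \<comment> \<open>positions are counted from 1\<close>

definition cadences3 :: "int list \<Rightarrow> (nat \<times> nat) set" where
  "cadences3 S = {(i, d). 0 < i \<and> 0 < d \<and> int i - int d \<le> 0 \<and>
     i + 2 * d \<le> length S \<and> length S < i + 3 * d \<and>
     char_at S i = char_at S (i + d) \<and> char_at S (i + d) = char_at S (i + 2 * d)}"

definition cadences3_with :: "int \<Rightarrow> int list \<Rightarrow> (nat \<times> nat) set" where
  "cadences3_with \<sigma> S = {(i, d) \<in> cadences3 S. char_at S i = \<sigma>}"

definition ending_at :: "nat \<Rightarrow> (nat \<times> nat) set \<Rightarrow> (nat \<times> nat) set" where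
  "ending_at z K = {(i, d) \<in> K. i + 2 * d = z}"

definition occurrences :: "int \<Rightarrow> int list \<Rightarrow> nat set" where
  "occurrences \<sigma> S = {j \<in> {1..length S}. char_at S j = \<sigma>}"

text \<open>Characters are integers of \<open>O(log n)\<close> bits: their absolute values are bounded by a
  polynomial in the length of the string. The base \<open>n + 2\<close> instead of \<open>n\<close> only avoids
  degenerate bounds for \<open>n < 2\<close>.\<close>

definition string_over :: "nat \<Rightarrow> int set \<Rightarrow> int list \<Rightarrow> bool" where
  "string_over a \<Sigma> S \<longleftrightarrow> finite \<Sigma> \<and> set S \<subseteq> \<Sigma> \<and> (\<forall>c\<in>\<Sigma>. \<bar>c\<bar> \<le> (int (length S) + 2) ^ a)"

lemma finite_cadences3: "finite (cadences3 S)"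
  by (rule finite_subset[of _ "{..length S} \<times> {..length S}"]) (auto simp: cadences3_def)


section \<open>Word RAM programs\<close>

text \<open>
  A program is a fixed finite piece of syntax. It works on finitely many integer variables and
  finitely many random-access arrays. Every node of an expression costs one time unit when it is
  evaluated, and so does every executed command. An execution gets stuck (there is no derivation)
  as soon as an integer outside \<open>{-W..W}\<close> would be computed, stored or used as an address;
  \<open>W\<close> is the word bound.
\<close>

type_synonym name = string

record state =
  vars :: "name \<Rightarrow> int"
  arrs :: "name \<Rightarrow> int \<Rightarrow> int"

datatype binop = Add | Sub | Mul | Div | Mod | Less | Eq

datatype expr = Const int | Var name | Read name expr | Op binop expr expr

datatype com =
    Skip
  | Assign name expr
  | Store name expr expr           \<comment> \<open>array, index, value\<close>
  | Convolve name name name expr   \<comment> \<open>target, the two arguments, their length\<close>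
  | Seq com com
  | Cond expr com com
  | While expr com

fun apply_op :: "binop \<Rightarrow> int \<Rightarrow> int \<Rightarrow> int" where
  "apply_op Add x y = x + y"
| "apply_op Sub x y = x - y"
| "apply_op Mul x y = x * y"
| "apply_op Div x y = x div y"
| "apply_op Mod x y = x mod y"
| "apply_op Less x y = of_bool (x < y)"
| "apply_op Eq x y = of_bool (x = y)"

fun val :: "state \<Rightarrow> expr \<Rightarrow> int" where
  "val s (Const c) = c"
| "val s (Var x) = vars s x"
| "val s (Read a e) = arrs s a (val s e)"
| "val s (Op f e1 e2) = apply_op f (val s e1) (val s e2)"

fun safe :: "int \<Rightarrow> state \<Rightarrow> expr \<Rightarrow> bool" where
  "safe W s (Const c) \<longleftrightarrow> \<bar>c\<bar> \<le> W"
| "safe W s (Var x) \<longleftrightarrow> \<bar>vars s x\<bar> \<le> W"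
| "safe W s (Read a e) \<longleftrightarrow> safe W s e \<and> \<bar>val s (Read a e)\<bar> \<le> W"
| "safe W s (Op f e1 e2) \<longleftrightarrow> safe W s e1 \<and> safe W s e2 \<and>
     (f \<in> {Div, Mod} \<longrightarrow> val s e2 \<noteq> 0) \<and> \<bar>val s (Op f e1 e2)\<bar> \<le> W"

fun cost :: "expr \<Rightarrow> nat" where
  "cost (Const c) = 1"
| "cost (Var x) = 1"
| "cost (Read a e) = cost e + 1"
| "cost (Op f e1 e2) = cost e1 + cost e2 + 1"

definition set_var :: "name \<Rightarrow> int \<Rightarrow> state \<Rightarrow> state" where
  "set_var x v s = s\<lparr>vars := (vars s)(x := v)\<rparr>"

definition set_arr :: "name \<Rightarrow> (int \<Rightarrow> int) \<Rightarrow> state \<Rightarrow> state" where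
  "set_arr a f s = s\<lparr>arrs := (arrs s)(a := f)\<rparr>"

definition acyclic_conv :: "int \<Rightarrow> (int \<Rightarrow> int) \<Rightarrow> (int \<Rightarrow> int) \<Rightarrow> int \<Rightarrow> int" where
  "acyclic_conv m f g k = (\<Sum>i\<in>{i \<in> {0..<m}. k - i \<in> {0..<m}}. f i * g (k - i))"

text \<open>\<open>exec T W c s t s'\<close>: with word bound \<open>W\<close>, program \<open>c\<close> started in \<open>s\<close> terminates in \<open>s'\<close>
  after time \<open>t\<close>. \<open>T m\<close> is the time charged for convolving two sequences of length \<open>m\<close>; it is
  the only parameter through which the assumed convolution algorithm enters.\<close>

inductive exec :: "(nat \<Rightarrow> nat) \<Rightarrow> int \<Rightarrow> com \<Rightarrow> state \<Rightarrow> nat \<Rightarrow> state \<Rightarrow> bool"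
  for T :: "nat \<Rightarrow> nat" and W :: int where
  Skip: "exec T W Skip s 1 s"
| Assign: "safe W s e \<Longrightarrow> exec T W (Assign x e) s (1 + cost e) (set_var x (val s e) s)"
| Store: "\<lbrakk>safe W s i; safe W s e\<rbrakk> \<Longrightarrow>
    exec T W (Store a i e) s (1 + cost i + cost e)
      (set_arr a ((arrs s a)(val s i := val s e)) s)"
| Convolve: "\<lbrakk>safe W s e; m = val s e; 0 \<le> m; 2 * m \<le> W;
     \<forall>k\<in>{0..<m}. \<bar>arrs s a k\<bar> \<le> W \<and> \<bar>arrs s b k\<bar> \<le> W;
     \<forall>k\<in>{0..<2 * m - 1}. \<bar>acyclic_conv m (arrs s a) (arrs s b) k\<bar> \<le> W\<rbrakk> \<Longrightarrow>
    exec T W (Convolve r a b e) s (1 + cost e + T (nat m))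
      (set_arr r (\<lambda>k. if k \<in> {0..<2 * m - 1}
         then acyclic_conv m (arrs s a) (arrs s b) k else arrs s r k) s)"
| Seq: "\<lbrakk>exec T W c1 s t1 s1; exec T W c2 s1 t2 s2\<rbrakk> \<Longrightarrow> exec T W (Seq c1 c2) s (t1 + t2) s2"
| CondTrue: "\<lbrakk>safe W s b; val s b \<noteq> 0; exec T W c1 s t s'\<rbrakk> \<Longrightarrow>
    exec T W (Cond b c1 c2) s (1 + cost b + t) s'"
| CondFalse: "\<lbrakk>safe W s b; val s b = 0; exec T W c2 s t s'\<rbrakk> \<Longrightarrow>
    exec T W (Cond b c1 c2) s (1 + cost b + t) s'"
| WhileFalse: "\<lbrakk>safe W s b; val s b = 0\<rbrakk> \<Longrightarrow> exec T W (While b c) s (1 + cost b) s"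
| WhileTrue: "\<lbrakk>safe W s b; val s b \<noteq> 0; exec T W c s t1 s1; exec T W (While b c) s1 t2 s2\<rbrakk> \<Longrightarrow>
    exec T W (While b c) s (1 + cost b + t1 + t2) s2"

inductive_cases SkipE: "exec T W Skip s t s'"
inductive_cases AssignE: "exec T W (Assign x e) s t s'"
inductive_cases StoreE: "exec T W (Store a i e) s t s'"
inductive_cases ConvolveE: "exec T W (Convolve r a b e) s t s'"
inductive_cases SeqE: "exec T W (Seq c1 c2) s t s'"
inductive_cases CondE: "exec T W (Cond b c1 c2) s t s'"
inductive_cases WhileE: "exec T W (While b c) s t s'"

lemma exec_deterministic:
  "exec T W c s t s' \<Longrightarrow> exec T W c s u r \<Longrightarrow> u = t \<and> r = s'"
proof (induction arbitrary: u r rule: exec.induct)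
  case (Skip s)
  then show ?case by (auto elim: SkipE)
next
  case (Assign s e x)
  from Assign.prems show ?case by (auto elim: AssignE)
next
  case (Store s i e a)
  from Store.prems show ?case by (auto elim: StoreE)
next
  case (Convolve s e m a b r')
  from Convolve.prems show ?case
    unfolding Convolve.hyps(2) by (rule ConvolveE) simp
next
  case (Seq c1 s t1 s1 c2 t2 s2)
  from Seq.prems show ?case by (rule SeqE) (auto dest!: Seq.IH)
next
  case (CondTrue s b c1 t s' c2)
  from CondTrue.prems show ?case
    by (rule CondE) (auto simp: CondTrue.hyps dest!: CondTrue.IH)
next
  case (CondFalse s b c2 t s' c1)
  from CondFalse.prems show ?case
    by (rule CondE) (auto simp: CondFalse.hyps dest!: CondFalse.IH)
next
  case (WhileFalse s b c)
  from WhileFalse.prems show ?case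
    by (rule WhileE) (auto simp: WhileFalse.hyps)
next
  case (WhileTrue s b c t1 s1 t2 s2)
  from WhileTrue.prems show ?case
    by (rule WhileE) (auto simp: WhileTrue.hyps dest!: WhileTrue.IH)
qed


section \<open>Input and output conventions\<close>

text \<open>The memory initially contains the named inputs, and 0 everywhere else. An input list
  occupies the indices \<open>1, \<dots>, length xs\<close> of its array.\<close>

definition lookup0 :: "(name \<times> int) list \<Rightarrow> name \<Rightarrow> int" where
  "lookup0 vs x = (case map_of vs x of None \<Rightarrow> 0 | Some v \<Rightarrow> v)"

definition array_of :: "int list \<Rightarrow> int \<Rightarrow> int" where
  "array_of xs j = (if 1 \<le> j \<and> j \<le> int (length xs) then xs ! nat (j - 1) else 0)"

definition input :: "(name \<times> int) list \<Rightarrow> (name \<times> int list) list \<Rightarrow> state" where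
  "input vs as = \<lparr>vars = lookup0 vs,
     arrs = (\<lambda>a. case map_of as a of None \<Rightarrow> (\<lambda>_. 0) | Some xs \<Rightarrow> array_of xs)\<rparr>"

text \<open>\<open>computes T k C P S I b R\<close>: the run of \<open>P\<close> on \<open>I\<close> uses words of \<open>O(log n)\<close> bits only, namely
  bounded by \<open>(n + 2) ^ k\<close>, where \<open>n\<close> is the length of \<open>S\<close>; it takes time at most \<open>C * b\<close> and ends
  in a state satisfying \<open>R\<close>. A run takes at least one step, so a bound that vanishes
  (\<open>n \<le> 1\<close>, or a character without occurrences) is read as 1.\<close>

definition computes ::
    "(nat \<Rightarrow> nat) \<Rightarrow> nat \<Rightarrow> real \<Rightarrow> com \<Rightarrow> int list \<Rightarrow> state \<Rightarrow> real \<Rightarrow> (state \<Rightarrow> bool) \<Rightarrow> bool" where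
  "computes T k C P S I b R \<longleftrightarrow>
     (\<exists>t s'. exec T ((int (length S) + 2) ^ k) P I t s' \<and> R s' \<and> real t \<le> C * max 1 b)"

text \<open>The output of a counting algorithm for a set \<open>K\<close> of cadences of a string of length \<open>n\<close>.\<close>

definition counted :: "nat \<Rightarrow> (nat \<times> nat) set \<Rightarrow> state \<Rightarrow> bool" where
  "counted n K s \<longleftrightarrow> vars s ''total'' = int (card K) \<and>
     (\<forall>z\<in>{1..n}. arrs s ''cnt'' (int z) = int (card (ending_at z K)))"

definition end_counts :: "int list \<Rightarrow> int list" where
  "end_counts S = map (\<lambda>z. int (card (ending_at z (cadences3 S)))) [1..<length S + 1]"

definition lists_cadences :: "nat \<Rightarrow> (nat \<times> nat) set \<Rightarrow> state \<Rightarrow> bool" where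
  "lists_cadences l K s \<longleftrightarrow> (\<exists>f. inj_on f {1..l} \<and> f ` {1..l} \<subseteq> K \<and>
     (\<forall>j\<in>{1..l}. arrs s ''outI'' (int j) = int (fst (f j)) \<and>
                 arrs s ''outD'' (int j) = int (snd (f j))))"

end

theory Submission
  imports Defs
begin

text \<open>
  A cadence \<open>(i, d)\<close> is determined by its first and last positions \<open>x = i\<close> and \<open>z = i + 2 * d\<close>, and
  the window conditions say that \<open>x < u z\<close> for the increasing function
  \<open>u z = min (z div 3) (3 * z - 2 * n - 1) + 1\<close>. A pair \<open>x < u z\<close> is separated at exactly one dyadic
  scale: there is exactly one power \<open>L\<close> of two with an odd multiple \<open>A\<close> of \<open>L\<close> such that
  \<open>A - L \<le> x < A \<le> u z < A + L\<close>. For fixed \<open>L\<close> and \<open>A\<close> the middle positions are counted, for all \<open>z\<close>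
  simultaneously, by one convolution of length \<open>4 * L\<close>; the convolutions of one scale cost
  \<open>O(n log n)\<close>, and there are \<open>O(log n)\<close> scales. Trying all pairs of occurrences costs
  \<open>O(n\<^sub>\<sigma>\<^sup>2)\<close> instead, and choosing the cheaper method for every character gives the bound for all
  characters, as \<open>min (n\<^sub>\<sigma>\<^sup>2) (n log\<^sup>2 n) \<le> n\<^sub>\<sigma> * sqrt n * log n\<close>.
\<close>

text \<open>With d = (z - x) / 2 the conditions i \<le> d and n < i + 3d read 3x \<le> z and 2n < 3z
  - x. They bound x from above by a function of z, so the admissible pairs fill a staircase and not
  a product of intervals. A single convolution would also count pairs beyond the staircase; the
  dyadic separation cuts it into rectangles on which x < u z holds automatically. The length 4L
  comes from L starts and at most 3L end positions per block, as u grows by at least L over 3L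
  positions. At scale L there are about n / (2L) blocks, so the factor L cancels in the cost of a
  scale. Listing uses the counts: only end positions with a nonzero count are scanned, each in O(n)
  time, and every scan begun before the o-th output yields a new cadence, so there are at most o
  scans. All intermediate numbers must stay within a fixed power of n + 2, hence the many explicit
  bounds.\<close>

section \<open>Weakest preconditions with running times\<close>

text \<open>Total correctness with the running time passed to the postcondition. As
  \<open>exec\<close> is deterministic, the run asserted here is the only one; a stuck run, for
  instance one that leaves the word range, satisfies no postcondition.\<close>

definition wp :: "(nat \<Rightarrow> nat) \<Rightarrow> int \<Rightarrow> com \<Rightarrow> state \<Rightarrow> (nat \<Rightarrow> state \<Rightarrow> bool) \<Rightarrow> bool" where
  "wp T W c s Q \<longleftrightarrow> (\<exists>t s'. exec T W c s t s' \<and> Q t s')"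

fun written_vars :: "com \<Rightarrow> name set" where
  "written_vars Skip = {}"
| "written_vars (Assign x e) = {x}"
| "written_vars (Store a i e) = {}"
| "written_vars (Convolve r a b e) = {}"
| "written_vars (Seq c1 c2) = written_vars c1 \<union> written_vars c2"
| "written_vars (Cond b c1 c2) = written_vars c1 \<union> written_vars c2"
| "written_vars (While b c) = written_vars c"

fun written_arrs :: "com \<Rightarrow> name set" where
  "written_arrs Skip = {}"
| "written_arrs (Assign x e) = {}"
| "written_arrs (Store a i e) = {a}"
| "written_arrs (Convolve r a b e) = {r}"
| "written_arrs (Seq c1 c2) = written_arrs c1 \<union> written_arrs c2"
| "written_arrs (Cond b c1 c2) = written_arrs c1 \<union> written_arrs c2"
| "written_arrs (While b c) = written_arrs c"

text \<open>Invariants can then speak only of what a loop changes; everything else is recovered from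
  the names that the program writes syntactically.\<close>

definition frame :: "com \<Rightarrow> state \<Rightarrow> state \<Rightarrow> bool" where
  "frame c s s' \<longleftrightarrow> (\<forall>x. x \<notin> written_vars c \<longrightarrow> vars s' x = vars s x) \<and>
     (\<forall>a. a \<notin> written_arrs c \<longrightarrow> arrs s' a = arrs s a)"

lemma frame_refl [simp]: "frame c s s"
  by (simp add: frame_def)

lemma frame_trans: "frame c s s' \<Longrightarrow> frame c s' s'' \<Longrightarrow> frame c s s''"
  by (simp add: frame_def)

lemma vars_set_var [simp]: "vars (set_var x v s) = (vars s)(x := v)"
  and arrs_set_var [simp]: "arrs (set_var x v s) = arrs s"
  and vars_set_arr [simp]: "vars (set_arr a f s) = vars s"
  and arrs_set_arr [simp]: "arrs (set_arr a f s) = (arrs s)(a := f)"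
  by (simp_all add: set_var_def set_arr_def)

lemma exec_frame: "exec T W c s t s' \<Longrightarrow> frame c s s'"
  by (induction rule: exec.induct) (auto simp: frame_def)

lemma wp_frame: "wp T W c s (\<lambda>t s'. frame c s s' \<longrightarrow> Q t s') \<Longrightarrow> wp T W c s Q"
  by (auto simp: wp_def dest: exec_frame)

lemma wp_mono: "wp T W c s Q \<Longrightarrow> (\<And>t s'. Q t s' \<Longrightarrow> frame c s s' \<Longrightarrow> R t s') \<Longrightarrow> wp T W c s R"
  unfolding wp_def using exec_frame by blast

lemma wp_Skip: "wp T W Skip s Q \<longleftrightarrow> Q 1 s"
  unfolding wp_def by (metis SkipE exec.Skip One_nat_def)

lemma wp_Assign: "wp T W (Assign x e) s Q \<longleftrightarrow>
    safe W s e \<and> Q (1 + cost e) (set_var x (val s e) s)"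
  by (auto simp: wp_def elim!: AssignE intro!: exec.Assign exI)

lemma wp_Store: "wp T W (Store a i e) s Q \<longleftrightarrow> safe W s i \<and> safe W s e \<and>
    Q (1 + cost i + cost e) (set_arr a ((arrs s a)(val s i := val s e)) s)"
  unfolding wp_def by (metis StoreE exec.Store)

lemma wp_Seq: "wp T W (Seq c1 c2) s Q \<longleftrightarrow>
    wp T W c1 s (\<lambda>t1 s1. wp T W c2 s1 (\<lambda>t2. Q (t1 + t2)))"
  unfolding wp_def by (metis SeqE exec.Seq)

lemma wp_Cond: "wp T W (Cond b c1 c2) s Q \<longleftrightarrow> safe W s b \<and>
    (val s b \<noteq> 0 \<longrightarrow> wp T W c1 s (\<lambda>t. Q (1 + cost b + t))) \<and>
    (val s b = 0 \<longrightarrow> wp T W c2 s (\<lambda>t. Q (1 + cost b + t)))"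
proof
  assume "wp T W (Cond b c1 c2) s Q"
  then obtain t s' where "exec T W (Cond b c1 c2) s t s'" "Q t s'" by (auto simp: wp_def)
  then show "safe W s b \<and>
    (val s b \<noteq> 0 \<longrightarrow> wp T W c1 s (\<lambda>t. Q (1 + cost b + t))) \<and>
    (val s b = 0 \<longrightarrow> wp T W c2 s (\<lambda>t. Q (1 + cost b + t)))"
    by (elim CondE) (auto simp: wp_def)
next
  assume *: "safe W s b \<and>
    (val s b \<noteq> 0 \<longrightarrow> wp T W c1 s (\<lambda>t. Q (1 + cost b + t))) \<and>
    (val s b = 0 \<longrightarrow> wp T W c2 s (\<lambda>t. Q (1 + cost b + t)))"
  show "wp T W (Cond b c1 c2) s Q"
    using * exec.CondTrue exec.CondFalse unfolding wp_def by (cases "val s b = 0") blast+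
qed

lemmas wp_simps = wp_Skip wp_Assign wp_Store wp_Seq wp_Cond

lemma wp_Convolve:
  assumes "safe W s e" "val s e = int m" "2 * int m \<le> W"
    and "\<And>k. 0 \<le> k \<Longrightarrow> k < int m \<Longrightarrow> \<bar>arrs s a k\<bar> \<le> W \<and> \<bar>arrs s b k\<bar> \<le> W"
    and "\<And>k. 0 \<le> k \<Longrightarrow> k < 2 * int m - 1 \<Longrightarrow> \<bar>acyclic_conv (int m) (arrs s a) (arrs s b) k\<bar> \<le> W"
    and "Q (1 + cost e + T m) (set_arr r (\<lambda>k. if k \<in> {0..<2 * int m - 1}
         then acyclic_conv (int m) (arrs s a) (arrs s b) k else arrs s r k) s)"
  shows "wp T W (Convolve r a b e) s Q"
proof -
  have "exec T W (Convolve r a b e) s (1 + cost e + T (nat (int m)))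
      (set_arr r (\<lambda>k. if k \<in> {0..<2 * int m - 1}
         then acyclic_conv (int m) (arrs s a) (arrs s b) k else arrs s r k) s)"
    using assms by (intro exec.Convolve) auto
  then show ?thesis using assms(6) unfolding wp_def nat_int by blast
qed

text \<open>The number \<open>N\<close> of iterations is known beforehand, so no termination measure
  is needed: the invariant is indexed by the number of completed iterations, and the time is the sum
  of the budgets \<open>B i\<close> and of \<open>N + 1\<close> evaluations of the guard.\<close>

lemma wp_While:
  assumes init: "I 0 s"
    and step: "\<And>i s'. i < N \<Longrightarrow> I i s' \<Longrightarrow> frame c s s' \<Longrightarrow>
      safe W s' b \<and> val s' b \<noteq> 0 \<and> wp T W c s' (\<lambda>t s''. t \<le> B i \<and> I (Suc i) s'')"
    and stop: "\<And>s'. I N s' \<Longrightarrow> frame c s s' \<Longrightarrow> safe W s' b \<and> val s' b = 0"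
    and post: "\<And>t s'. I N s' \<Longrightarrow> frame c s s' \<Longrightarrow>
      t \<le> (\<Sum>i<N. B i + cost b + 1) + cost b + 1 \<Longrightarrow> Q t s'"
  shows "wp T W (While b c) s Q"
proof -
  \<comment> \<open>The claim is generalised to a loop entered after \<open>k\<close> iterations and
    is proved downwards from \<open>k = N\<close>, where the guard fails.\<close>
  have "\<exists>t s''. exec T W (While b c) s' t s'' \<and> I N s'' \<and> frame c s s'' \<and>
      t \<le> (\<Sum>i=k..<N. B i + cost b + 1) + cost b + 1"
    if "k \<le> N" "I k s'" "frame c s s'" for k s'
    using that
  proof (induction k arbitrary: s' rule: inc_induct)
    case base
    then show ?case using stop[of s'] by (fastforce intro: exec.WhileFalse)
  next
    case (step k)
    then obtain t s'' where *: "safe W s' b" "val s' b \<noteq> 0" "exec T W c s' t s''" "t \<le> B k" "I (Suc k) s''"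
      using assms(2)[of k s'] by (auto simp: wp_def)
    then have "frame c s s''" using step.prems exec_frame frame_trans by blast
    with step.IH *(5) obtain t' r where **: "exec T W (While b c) s'' t' r" "I N r" "frame c s r"
      "t' \<le> (\<Sum>i=Suc k..<N. B i + cost b + 1) + cost b + 1" by blast
    have "exec T W (While b c) s' (1 + cost b + t + t') r"
      using exec.WhileTrue * ** by blast
    moreover have "(\<Sum>i=k..<N. B i + cost b + 1) = B k + cost b + 1 + (\<Sum>i=Suc k..<N. B i + cost b + 1)"
      using step.hyps by (simp add: sum.atLeast_Suc_lessThan)
    ultimately show ?case using **(2-4) *(4) by (intro exI[of _ "1 + cost b + t + t'"] exI[of _ r]) simp
  qed
  from this[of 0 s] init show ?thesis
    unfolding wp_def by (metis atLeast0LessThan frame_refl le0 post)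
qed

definition for_loop :: "name \<Rightarrow> expr \<Rightarrow> expr \<Rightarrow> com \<Rightarrow> com" where
  "for_loop x lo hi c = Seq (Assign x lo)
     (While (Op Less (Var x) hi) (Seq c (Assign x (Op Add (Var x) (Const 1)))))"

lemma written_for_loop [simp]: "written_vars (for_loop x lo hi c) = insert x (written_vars c)"
  "written_arrs (for_loop x lo hi c) = written_arrs c"
  by (auto simp: for_loop_def)

text \<open>The bound \<open>hi\<close> is evaluated anew in each round, so its value is required in
  every state that the loop reaches. The 7 per round are 3 for the test around \<open>hi\<close> and
  4 for the increment; the counter ends at \<open>h\<close>, which must therefore be a word.\<close>

lemma wp_for_loop:
  assumes lo: "safe W s lo" "val s lo = int l" and le: "l \<le> h" and W: "int h \<le> W" "1 \<le> W"
    and x: "x \<notin> written_vars c"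
    and init: "I l (set_var x (int l) s)"
    and hi: "\<And>i s'. l \<le> i \<Longrightarrow> i \<le> h \<Longrightarrow> I i s' \<Longrightarrow> frame (for_loop x lo hi c) s s' \<Longrightarrow>
      vars s' x = int i \<Longrightarrow> safe W s' hi \<and> val s' hi = int h"
    and body: "\<And>i s'. l \<le> i \<Longrightarrow> i < h \<Longrightarrow> I i s' \<Longrightarrow> frame (for_loop x lo hi c) s s' \<Longrightarrow>
      vars s' x = int i \<Longrightarrow>
      wp T W c s' (\<lambda>t s''. t \<le> B i \<and> I (Suc i) (set_var x (int (Suc i)) s''))"
    and post: "\<And>t s'. I h s' \<Longrightarrow> frame (for_loop x lo hi c) s s' \<Longrightarrow> vars s' x = int h \<Longrightarrow>
      t \<le> (\<Sum>i=l..<h. B i + cost hi + 7) + cost lo + cost hi + 4 \<Longrightarrow> Q t s'"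
  shows "wp T W (for_loop x lo hi c) s Q"
proof -
  let ?F = "for_loop x lo hi c"
  let ?b = "Op Less (Var x) hi"
  have fr: "frame ?F s s'" if "frame (Seq c (Assign x (Op Add (Var x) (Const 1)))) (set_var x v s) s'" for v s'
    using that by (auto simp: frame_def)
  have "wp T W (While ?b (Seq c (Assign x (Op Add (Var x) (Const 1))))) (set_var x (int l) s)
      (\<lambda>t. Q (1 + cost lo + t))"
  proof (rule wp_While[where N = "h - l" and B = "\<lambda>i. B (l + i) + 4"
        and I = "\<lambda>i s'. I (l + i) s' \<and> vars s' x = int (l + i)"], goal_cases)
    case 1 then show ?case using init by simp
  next
    case (2 i s')
    then have i: "l + i < h" by simp
    note h = hi[of "l + i" s'] and b = body[of "l + i" s']
    have "wp T W c s' (\<lambda>t s''. frame c s' s'' \<longrightarrow> safe W s'' (Op Add (Var x) (Const 1)) \<and>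
        t + 4 \<le> B (l + i) + 4 \<and> I (l + Suc i) (set_var x (int (l + i) + 1) s'') \<and> vars s'' x = int (l + i))"
      by (rule wp_mono[OF b]) (use 2 i fr x W in \<open>auto simp: frame_def algebra_simps\<close>)
    then have "wp T W c s' (\<lambda>t s''. safe W s'' (Op Add (Var x) (Const 1)) \<and>
        t + 4 \<le> B (l + i) + 4 \<and> I (l + Suc i) (set_var x (int (l + i) + 1) s'') \<and> vars s'' x = int (l + i))"
      by (rule wp_frame)
    then have "wp T W (Seq c (Assign x (Op Add (Var x) (Const 1)))) s'
        (\<lambda>t s''. t \<le> B (l + i) + 4 \<and> I (l + Suc i) s'' \<and> vars s'' x = int (l + Suc i))"
      unfolding wp_Seq wp_Assign by (rule wp_mono) auto
    then show ?case using 2 i h[OF _ _ _ fr] W by auto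
  next
    case (3 s')
    then show ?case using hi[OF _ _ _ fr, of h] le W by auto
  next
    case (4 t s')
    have "(\<Sum>i<h - l. B (l + i) + 4 + cost ?b + 1) = (\<Sum>i=l..<h. B i + cost hi + 7)"
      by (rule sum.reindex_bij_witness[of _ "\<lambda>i. i - l" "\<lambda>i. l + i"]) auto
    then show ?case using 4 le by (intro post fr) auto
  qed
  then show ?thesis using lo by (simp add: for_loop_def wp_Seq wp_Assign)
qed

section \<open>Symbolic execution of straight-line code\<close>

abbreviation add_expr (infixl "\<oplus>" 65) where "e1 \<oplus> e2 \<equiv> Op Add e1 e2"
abbreviation sub_expr (infixl "\<ominus>" 65) where "e1 \<ominus> e2 \<equiv> Op Sub e1 e2"
abbreviation mul_expr (infixl "\<otimes>" 70) where "e1 \<otimes> e2 \<equiv> Op Mul e1 e2"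
abbreviation div_expr (infixl "\<oslash>" 70) where "e1 \<oslash> e2 \<equiv> Op Div e1 e2"
abbreviation less_expr (infix "\<prec>" 50) where "e1 \<prec> e2 \<equiv> Op Less e1 e2"
abbreviation eq_expr (infix "\<doteq>" 50) where "e1 \<doteq> e2 \<equiv> Op Eq e1 e2"
abbreviation even_expr where "even_expr e \<equiv> Op Mod e (Const 2) \<doteq> Const 0"
abbreviation assign (infix "::=" 62) where "x ::= e \<equiv> Assign x e"
abbreviation seq (infixr ";;" 60) where "c1 ;; c2 \<equiv> Seq c1 c2"

lemma safe_ops:
  "safe W s (e1 \<oplus> e2) \<longleftrightarrow> safe W s e1 \<and> safe W s e2 \<and> \<bar>val s e1 + val s e2\<bar> \<le> W"
  "safe W s (e1 \<ominus> e2) \<longleftrightarrow> safe W s e1 \<and> safe W s e2 \<and> \<bar>val s e1 - val s e2\<bar> \<le> W"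
  "safe W s (e1 \<otimes> e2) \<longleftrightarrow> safe W s e1 \<and> safe W s e2 \<and> \<bar>val s e1 * val s e2\<bar> \<le> W"
  "safe W s (e1 \<oslash> e2) \<longleftrightarrow> safe W s e1 \<and> safe W s e2 \<and> val s e2 \<noteq> 0 \<and> \<bar>val s e1 div val s e2\<bar> \<le> W"
  "safe W s (Op Mod e1 e2) \<longleftrightarrow> safe W s e1 \<and> safe W s e2 \<and> val s e2 \<noteq> 0 \<and> \<bar>val s e1 mod val s e2\<bar> \<le> W"
  "safe W s (e1 \<prec> e2) \<longleftrightarrow> safe W s e1 \<and> safe W s e2 \<and> \<bar>of_bool (val s e1 < val s e2) :: int\<bar> \<le> W"
  "safe W s (e1 \<doteq> e2) \<longleftrightarrow> safe W s e1 \<and> safe W s e2 \<and> \<bar>of_bool (val s e1 = val s e2) :: int\<bar> \<le> W"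
  by auto

lemma abs_of_bool_le [simp]: "1 \<le> W \<Longrightarrow> \<bar>of_bool b :: int\<bar> \<le> W"
  by (cases b) auto

text \<open>A closed simplification set: symbolic execution leaves bounds on intermediate values,
  which each proof supplies as explicit facts. Products of tests play the part of conjunction in the
  programs, and \<open>of_bool_conj[symmetric]\<close> fuses them into one test.\<close>

lemmas run_simps = wp_simps safe.simps(1-3) safe_ops val.simps apply_op.simps cost.simps
  vars_set_var arrs_set_var vars_set_arr arrs_set_arr fun_upd_apply if_True if_False
  list.inject list.distinct char.inject simp_thms abs_numeral abs_zero abs_one
  zero_neq_numeral numeral_neq_zero
  of_bool_conj[symmetric] abs_of_bool_le

section \<open>Cadences given by their end points\<close>

text \<open>Parity makes the middle position integral, and d > 0 is implied, since 3x \<le> z and x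
  \<ge> 1 give x < z. The inequalities are strict because the only order test of the programs is
  \<open>Less\<close>.\<close>

definition cadence_pair :: "(int \<Rightarrow> int) \<Rightarrow> nat \<Rightarrow> int \<Rightarrow> int \<Rightarrow> int \<Rightarrow> bool" where
  "cadence_pair f n \<sigma> x z \<longleftrightarrow> 3 * x < z + 1 \<and> 2 * int n < 3 * z - x \<and> (x + z) mod 2 = 0 \<and>
     f ((x + z) div 2) = \<sigma>"

text \<open>The character at \<open>z\<close> is not tested here; the counting results combine this
  set with \<open>z \<in> occs f n \<sigma>\<close>.\<close>

definition starts :: "(int \<Rightarrow> int) \<Rightarrow> nat \<Rightarrow> int \<Rightarrow> int \<Rightarrow> int set" where
  "starts f n \<sigma> z = {x. 1 \<le> x \<and> x \<le> int n \<and> f x = \<sigma> \<and> cadence_pair f n \<sigma> x z}"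

definition occs :: "(int \<Rightarrow> int) \<Rightarrow> nat \<Rightarrow> int \<Rightarrow> int set" where
  "occs f n \<sigma> = {x. 1 \<le> x \<and> x \<le> int n \<and> f x = \<sigma>}"

lemma finite_starts [simp]: "finite (starts f n \<sigma> z)"
  by (rule finite_subset[of _ "{1..int n}"]) (auto simp: starts_def)

lemma card_starts: "card (starts f n \<sigma> z) \<le> n"
proof -
  have "card (starts f n \<sigma> z) \<le> card {1..int n}" by (rule card_mono) (auto simp: starts_def)
  then show ?thesis by simp
qed

section \<open>Counting by trying all pairs of occurrences\<close>

text \<open>\<open>base\<close> is the offset of the list of occurrences: 0 for a list given as
  input, the beginning of a bucket when all characters share the array \<open>occ\<close>.\<close>

definition quad_prog :: com where
  "quad_prog = for_loop ''q'' (Const 1) (Var ''nsigma'' \<oplus> Const 1)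
    (''z'' ::= Read ''occ'' (Var ''base'' \<oplus> Var ''q'');;
     for_loop ''p'' (Const 1) (Var ''nsigma'' \<oplus> Const 1)
      (''x'' ::= Read ''occ'' (Var ''base'' \<oplus> Var ''p'');;
       Store ''cnt'' (Var ''z'') (Read ''cnt'' (Var ''z'') \<oplus>
         (Const 3 \<otimes> Var ''x'' \<prec> Var ''z'' \<oplus> Const 1) \<otimes>
         (Const 2 \<otimes> Var ''n'' \<prec> Const 3 \<otimes> Var ''z'' \<ominus> Var ''x'') \<otimes>
         even_expr (Var ''x'' \<oplus> Var ''z'') \<otimes>
         (Read ''S'' ((Var ''x'' \<oplus> Var ''z'') \<oslash> Const 2) \<doteq> Var ''sigma''))))"

lemma wp_quad_prog:
  assumes s: "vars s ''n'' = int n" "vars s ''sigma'' = \<sigma>" "vars s ''nsigma'' = int m"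
    "vars s ''base'' = B" "arrs s ''S'' = f"
    and occ: "bij_betw (\<lambda>p. arrs s ''occ'' (B + int p)) {1..m} (occs f n \<sigma>)"
    and W: "\<bar>\<sigma>\<bar> \<le> W" "\<And>j. \<bar>f j\<bar> \<le> W" "\<bar>B\<bar> + int n + 2 \<le> W" "8 * (int n + 2) \<le> W"
      "\<And>z. \<bar>arrs s ''cnt'' z\<bar> + int n \<le> W"
  shows "wp T W quad_prog s (\<lambda>t s'. t \<le> 200 * (m * m + 1) \<and>
    (\<forall>z. arrs s' ''cnt'' z = arrs s ''cnt'' z + (if z \<in> occs f n \<sigma> then int (card (starts f n \<sigma> z)) else 0)))"
proof -
  define w where "w p = arrs s ''occ'' (B + int p)" for p
  have occ': "bij_betw w {1..m} (occs f n \<sigma>)"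
    using occ unfolding w_def .
  have w: "1 \<le> w p" "w p \<le> int n" "f (w p) = \<sigma>" if "1 \<le> p" "p \<le> m" for p
    using occ that unfolding bij_betw_def w_def occs_def by auto
  have mn: "m \<le> n"
  proof -
    have "m = card (occs f n \<sigma>)" using bij_betw_same_card[OF occ] by simp
    also have "\<dots> \<le> card {1..int n}" by (rule card_mono) (auto simp: occs_def)
    finally show ?thesis by simp
  qed
  \<comment> \<open>This is what the inner loop has added to cell \<open>w q\<close> when its
    counter equals \<open>i\<close>; it stays below \<open>i\<close>, which keeps the cell within
    the word bound.\<close>
  define cp where "cp q i = (\<Sum>p=1..<i. of_bool (cadence_pair f n \<sigma> (w p) (w q)) :: int)" for q i
  have cp_le: "0 \<le> cp q i" "cp q i \<le> int i - 1" if "1 \<le> i" for q i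
  proof -
    show "0 \<le> cp q i" by (simp add: cp_def sum_nonneg)
    have "cp q i \<le> (\<Sum>p=1..<i. 1)" unfolding cp_def by (rule sum_mono) simp
    then show "cp q i \<le> int i - 1" using that by simp
  qed
  have cp_card: "cp q (Suc m) = int (card (starts f n \<sigma> (w q)))" if "1 \<le> q" "q \<le> m" for q
  proof -
    have "cp q (Suc m) = int (card {p\<in>{1..m}. cadence_pair f n \<sigma> (w p) (w q)})"
    proof -
      have "{1..<Suc m} \<inter> {p. cadence_pair f n \<sigma> (w p) (w q)} =
          {p\<in>{1..m}. cadence_pair f n \<sigma> (w p) (w q)}" by auto
      then show ?thesis unfolding cp_def by (subst sum_of_bool_eq) simp_all
    qed
    also have "bij_betw w {p\<in>{1..m}. cadence_pair f n \<sigma> (w p) (w q)} (starts f n \<sigma> (w q))"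
    proof -
      have inj: "inj_on w {1..m}" and *: "w ` {1..m} = occs f n \<sigma>"
        using occ' by (simp_all only: bij_betw_def)
      have "starts f n \<sigma> (w q) = {x \<in> w ` {1..m}. cadence_pair f n \<sigma> x (w q)}"
        unfolding * by (auto simp: starts_def occs_def)
      also have "\<dots> = w ` {p\<in>{1..m}. cadence_pair f n \<sigma> (w p) (w q)}"
        by (rule Compr_image_eq)
      finally have "starts f n \<sigma> (w q) = w ` {p\<in>{1..m}. cadence_pair f n \<sigma> (w p) (w q)}" .
      with inj show ?thesis unfolding bij_betw_def by (auto intro: inj_on_subset)
    qed
    then have "card {p\<in>{1..m}. cadence_pair f n \<sigma> (w p) (w q)} = card (starts f n \<sigma> (w q))"
      by (rule bij_betw_same_card)
    finally show ?thesis .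
  qed
  define c0 where "c0 = arrs s ''cnt''"
  have c0: "\<bar>c0 z\<bar> + int n \<le> W" for z using W by (simp add: c0_def)
  define I where "I q s' \<longleftrightarrow> (\<forall>z. arrs s' ''cnt'' z =
     c0 z + (if z \<in> w ` {1..<q} then int (card (starts f n \<sigma> z)) else 0))" for q and s' :: state
  have inner: "wp T W (for_loop ''p'' (Const 1) (Var ''nsigma'' \<oplus> Const 1)
      (''x'' ::= Read ''occ'' (Var ''base'' \<oplus> Var ''p'');;
       Store ''cnt'' (Var ''z'') (Read ''cnt'' (Var ''z'') \<oplus>
         (Const 3 \<otimes> Var ''x'' \<prec> Var ''z'' \<oplus> Const 1) \<otimes>
         (Const 2 \<otimes> Var ''n'' \<prec> Const 3 \<otimes> Var ''z'' \<ominus> Var ''x'') \<otimes>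
         even_expr (Var ''x'' \<oplus> Var ''z'') \<otimes>
         (Read ''S'' ((Var ''x'' \<oplus> Var ''z'') \<oslash> Const 2) \<doteq> Var ''sigma'')))) s1
      (\<lambda>t s'. t \<le> 80 * m + 20 \<and> (arrs s' ''cnt'' = (arrs s1 ''cnt'')(w q := c0 (w q) + cp q (Suc m))))"
    (is "wp T W ?inner _ _")
    if s1: "vars s1 ''n'' = int n" "vars s1 ''sigma'' = \<sigma>" "vars s1 ''nsigma'' = int m"
    "vars s1 ''base'' = B" "arrs s1 ''S'' = f" "arrs s1 ''occ'' = arrs s ''occ''" "vars s1 ''z'' = w q"
    "arrs s1 ''cnt'' (w q) = c0 (w q)" and q: "1 \<le> q" "q \<le> m" for s1 q
  proof (rule wp_for_loop[where l = 1 and h = "Suc m" and B = "\<lambda>_. 60" and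
        I = "\<lambda>i s'. arrs s' ''cnt'' = (arrs s1 ''cnt'')(w q := c0 (w q) + cp q i)"], goal_cases)
    case (9 i s')
    then have i: "1 \<le> i" "i \<le> m" by auto
    have *: "vars s' ''n'' = int n" "vars s' ''sigma'' = \<sigma>" "vars s' ''nsigma'' = int m"
      "vars s' ''base'' = B" "arrs s' ''S'' = f" "arrs s' ''occ'' = arrs s ''occ''" "vars s' ''z'' = w q"
      using 9 s1 by (simp_all add: frame_def)
    have wi: "arrs s ''occ'' (B + int i) = w i" by (simp add: w_def)
    have cp_Suc: "cp q (Suc i) = cp q i + of_bool (cadence_pair f n \<sigma> (w i) (w q))"
      using i by (simp add: cp_def)
    have b1: "\<bar>c0 (w q) + (cp q i + of_bool b)\<bar> \<le> W" "\<bar>c0 (w q) + cp q i\<bar> \<le> W" for b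
      using c0[of "w q"] cp_le[OF i(1), of q] mn i by (auto simp: of_bool_def)
    have b2: "\<bar>w i\<bar> \<le> W" "\<bar>w q\<bar> \<le> W" "\<bar>3 * w i\<bar> \<le> W" "\<bar>3 * w q\<bar> \<le> W" "\<bar>w q + 1\<bar> \<le> W"
      "\<bar>2 * int n\<bar> \<le> W" "\<bar>int n\<bar> \<le> W" "\<bar>3 * w q - w i\<bar> \<le> W" "\<bar>w i + w q\<bar> \<le> W"
      "\<bar>(w i + w q) div 2\<bar> \<le> W" "\<bar>(w i + w q) mod 2\<bar> \<le> W" "\<bar>B + int i\<bar> \<le> W" "\<bar>B\<bar> \<le> W" "\<bar>int i\<bar> \<le> W"
      "1 \<le> W" "2 \<le> W" "3 \<le> W" "0 \<le> W"
      using w[OF i] w[OF q] W mn i by auto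
    show ?case
      by (simp only: run_simps * 9(3) 9(5) wi b1 b2 W(1,2) cp_Suc cadence_pair_def conj_assoc
          add.assoc fun_upd_upd)
  qed (use s1 W mn in \<open>auto simp: frame_def cp_def\<close>)
  show ?thesis
    unfolding quad_prog_def
  proof (rule wp_for_loop[where l = 1 and h = "Suc m" and B = "\<lambda>_. 80 * m + 25" and I = I], goal_cases)
    case (9 i s')
    then have i: "1 \<le> i" "i \<le> m" by auto
    have *: "vars s' ''n'' = int n" "vars s' ''sigma'' = \<sigma>" "vars s' ''nsigma'' = int m"
      "vars s' ''base'' = B" "arrs s' ''S'' = f" "arrs s' ''occ'' = arrs s ''occ''"
      using 9 s by (simp_all add: frame_def)
    have wi: "arrs s ''occ'' (B + int i) = w i" by (simp add: w_def)
    \<comment> \<open>The occurrences are pairwise distinct, so cell \<open>w i\<close> still has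
      its initial value when the outer loop reaches it.\<close>
    have new: "w i \<notin> w ` {1..<i}"
    proof
      assume "w i \<in> w ` {1..<i}"
      then obtain k where "1 \<le> k" "k < i" "w i = w k" by auto
      then show False using inj_onD[OF bij_betw_imp_inj_on[OF occ'], of i k] i by auto
    qed
    have "arrs s' ''cnt'' (w i) = c0 (w i)" using 9(3) new by (simp add: I_def)
    then have in': "wp T W ?inner (set_var ''z'' (w i) s') (\<lambda>t s''. t \<le> 80 * m + 20 \<and>
        arrs s'' ''cnt'' = (arrs s' ''cnt'')(w i := c0 (w i) + cp i (Suc m)))"
      using inner[of "set_var ''z'' (w i) s'" i] * i by simp
    have "wp T W ?inner (set_var ''z'' (w i) s') (\<lambda>t s''. 5 + t \<le> 80 * m + 25 \<and>
        I (Suc i) (set_var ''q'' (int (Suc i)) s''))"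
    proof (rule wp_mono[OF in'], goal_cases)
      case (1 t s'')
      have "w ` {1..<Suc i} = insert (w i) (w ` {1..<i})"
        using i(1) by (simp add: atLeastLessThanSuc)
      then show ?case using 1 9(3) new cp_card[OF i] by (auto simp: I_def)
    qed
    moreover have b: "\<bar>B\<bar> \<le> W" "\<bar>int i\<bar> \<le> W" "\<bar>B + int i\<bar> \<le> W" "\<bar>w i\<bar> \<le> W"
      using w[OF i] W mn i by auto
    ultimately show ?case
      by (simp only: run_simps * 9(5) wi b) simp
  next
    case (10 t s')
    have "w ` {1..<Suc m} = occs f n \<sigma>"
      using bij_betw_imp_surj_on[OF occ'] by (simp only: atLeastLessThanSuc_atLeastAtMost)
    moreover have "t \<le> 200 * (m * m + 1)"
    proof -
      have "t \<le> m * (80 * m + 35) + 8" using 10(4) by (simp add: algebra_simps)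
      also have "\<dots> = 80 * (m * m) + 35 * m + 8" by (simp add: algebra_simps)
      also have "\<dots> \<le> 200 * (m * m + 1)" using mult_le_mono[OF _ le_square[of m], of 35 120] by (cases m) simp_all
      finally show ?thesis .
    qed
    ultimately show ?case using 10(1) by (auto simp: I_def c0_def)
  qed (use s W mn in \<open>auto simp: frame_def I_def c0_def\<close>)
qed

section \<open>Dyadic separation\<close>

text \<open>
  The starts \<open>x\<close> of the cadences ending at \<open>z\<close> satisfy \<open>x < bound_of n z\<close>; \<open>block_count\<close> counts those
  that \<open>A\<close> separates from \<open>bound_of n z\<close> at scale \<open>L\<close>.
\<close>

definition bound_of :: "nat \<Rightarrow> int \<Rightarrow> int" where
  "bound_of n z = min (z div 3) (3 * z - 2 * int n - 1) + 1"

definition block_count :: "(int \<Rightarrow> int) \<Rightarrow> nat \<Rightarrow> int \<Rightarrow> int \<Rightarrow> int \<Rightarrow> int \<Rightarrow> nat" where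
  "block_count f n \<sigma> L A z =
    (if z \<in> occs f n \<sigma> \<and> A \<le> bound_of n z \<and> bound_of n z < A + L
     then card {x \<in> starts f n \<sigma> z. A - L \<le> x \<and> x < A} else 0)"

text \<open>Both window conditions are upper bounds on x, namely z div 3 and 3z - 2n - 1. Adding 1
  to their minimum makes the bound strict, as the separation of two different numbers
  requires.\<close>

lemma cadence_pair_bound:
  "cadence_pair f n \<sigma> x z \<longleftrightarrow> x < bound_of n z \<and> (x + z) mod 2 = 0 \<and> f ((x + z) div 2) = \<sigma>"
proof -
  have "3 * x < z + 1 \<longleftrightarrow> x \<le> z div 3" by linarith
  then show ?thesis by (auto simp: cadence_pair_def bound_of_def)
qed

lemma block_count_le: "block_count f n \<sigma> L A z \<le> n"
proof -
  have "card {x \<in> starts f n \<sigma> z. A - L \<le> x \<and> x < A} \<le> card (starts f n \<sigma> z)"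
    by (rule card_mono) auto
  then show ?thesis using card_starts[of f n \<sigma> z] by (simp add: block_count_def)
qed

lemma acyclic_conv_of_bool:
  assumes "\<And>k. 0 \<le> k \<Longrightarrow> k < m \<Longrightarrow> a k = of_bool (P k)" "\<And>k. 0 \<le> k \<Longrightarrow> k < m \<Longrightarrow> b k = of_bool (Q k)"
  shows "acyclic_conv m a b k =
    int (card {i. 0 \<le> i \<and> i < m \<and> 0 \<le> k - i \<and> k - i < m \<and> P i \<and> Q (k - i)})"
proof -
  have "acyclic_conv m a b k = (\<Sum>i\<in>{i \<in> {0..<m}. k - i \<in> {0..<m}}. of_bool (P i \<and> Q (k - i)))"
    unfolding acyclic_conv_def by (rule sum.cong) (auto simp: assms)
  also have "\<dots> = int (card ({i \<in> {0..<m}. k - i \<in> {0..<m}} \<inter> {i. P i \<and> Q (k - i)}))"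
    by (rule sum_of_bool_eq) (auto intro: finite_subset[of _ "{0..<m}"])
  also have "{i \<in> {0..<m}. k - i \<in> {0..<m}} \<inter> {i. P i \<and> Q (k - i)} =
      {i. 0 \<le> i \<and> i < m \<and> 0 \<le> k - i \<and> k - i < m \<and> P i \<and> Q (k - i)}" by auto
  finally show ?thesis .
qed

text \<open>Entry \<open>k\<close> of \<open>a\<close> stands for the start A - 1 - k, entry
  \<open>k\<close> of \<open>b\<close> for the sum A - L + z0 + k of both ends. Reversing the starts
  makes the index of a product depend on the end alone: start x and sum x + z meet at z - z0 + L -
  1. As x ranges over L values and z over 3L, x + z takes fewer than 4L values, so no pair is cut
  off.\<close>

lemma acyclic_conv_block:
  fixes L A z0 z :: int
  assumes a: "\<And>k. 0 \<le> k \<Longrightarrow> k < 4 * L \<Longrightarrow> a k = of_bool ((k < L \<and> k + 1 < A) \<and> f (A - 1 - k) = \<sigma>)"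
    and b: "\<And>k. 0 \<le> k \<Longrightarrow> k < 4 * L \<Longrightarrow> b k = of_bool ((A - L + z0 + k) mod 2 = 0 \<and> f ((A - L + z0 + k) div 2) = \<sigma>)"
    and z: "z0 \<le> z" "z < z0 + 3 * L" and A: "A \<le> bound_of n z" "bound_of n z < A + L" and zs: "z \<in> occs f n \<sigma>"
  shows "acyclic_conv (4 * L) a b (z - z0 + L - 1) = int (block_count f n \<sigma> L A z)"
proof -
  have un: "bound_of n z \<le> int n" using zs by (auto simp: occs_def bound_of_def)
  have "acyclic_conv (4 * L) a b (z - z0 + L - 1) = int (card {i. 0 \<le> i \<and> i < 4 * L \<and> 0 \<le> z - z0 + L - 1 - i \<and>
      z - z0 + L - 1 - i < 4 * L \<and> ((i < L \<and> i + 1 < A) \<and> f (A - 1 - i) = \<sigma>) \<and>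
      ((A - L + z0 + (z - z0 + L - 1 - i)) mod 2 = 0 \<and> f ((A - L + z0 + (z - z0 + L - 1 - i)) div 2) = \<sigma>)})"
    by (rule acyclic_conv_of_bool) (use a b in auto)
  also have "\<dots> = int (card {x \<in> starts f n \<sigma> z. A - L \<le> x \<and> x < A})"
  proof (intro arg_cong[where f = int] bij_betw_same_card[of "\<lambda>i. A - 1 - i"] bij_betw_byWitness[where f' = "\<lambda>x. A - 1 - x"] ballI subsetI, goal_cases)
    case (3 y)
    then obtain i where y: "y = A - 1 - i" and i: "0 \<le> i" "i < L" "i + 1 < A" "f (A - 1 - i) = \<sigma>"
      and yz: "(A - L + z0 + (z - z0 + L - 1 - i)) mod 2 = 0" "f ((A - L + z0 + (z - z0 + L - 1 - i)) div 2) = \<sigma>" by auto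
    have eq: "A - L + z0 + (z - z0 + L - 1 - i) = y + z" using y by simp
    have "f y = \<sigma>" "1 \<le> y" "y < A" "A - L \<le> y" using i unfolding y by auto
    \<comment> \<open>The window condition needs no test: the block gives y < A \<le>
      \<open>bound_of n z\<close>.\<close>
    moreover have "y < bound_of n z" "y \<le> int n" using \<open>y < A\<close> A un by auto
    ultimately show ?case using yz unfolding eq by (simp add: starts_def cadence_pair_bound)
  next
    case (4 i)
    then obtain x where i: "i = A - 1 - x" and x: "1 \<le> x" "f x = \<sigma>" "cadence_pair f n \<sigma> x z" "A - L \<le> x" "x < A"
      by (auto simp: starts_def)
    have eq: "A - L + z0 + (z - z0 + L - 1 - i) = x + z" "A - 1 - i = x" using i by simp_all
    show ?case unfolding mem_Collect_eq eq using i x z by (simp add: cadence_pair_bound)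
  qed auto
  finally show ?thesis using A zs by (simp add: block_count_def)
qed

text \<open>The level is the highest binary digit in which x and u differ: there x has 0, u has 1,
  and all higher digits agree. The induction drops the last digit: if the halves differ, they have
  the same level one lower; if they agree, the level is 0.\<close>

lemma unique_level:
  fixes x u :: nat
  assumes "x < u" "u < 2 ^ m"
  shows "(\<Sum>l<m. of_bool (even (x div 2 ^ l) \<and> u div 2 ^ l = x div 2 ^ l + 1) :: nat) = 1"
  using assms
proof (induction m arbitrary: x u)
  case (Suc m)
  have "(\<Sum>l<Suc m. of_bool (even (x div 2 ^ l) \<and> u div 2 ^ l = x div 2 ^ l + 1) :: nat) =
      of_bool (even x \<and> u = x + 1) +
      (\<Sum>l<m. of_bool (even (x div 2 div 2 ^ l) \<and> u div 2 div 2 ^ l = x div 2 div 2 ^ l + 1))"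
    by (simp add: sum.lessThan_Suc_shift div_mult2_eq del: sum.lessThan_Suc)
  also have "\<dots> = 1"
  proof (cases "x div 2 < u div 2")
    case True
    then have "\<not> (even x \<and> u = x + 1)" by auto
    moreover have "u div 2 < 2 ^ m" using Suc.prems by auto
    ultimately show ?thesis using Suc.IH[OF True] by simp
  next
    case False
    then have "x div 2 = u div 2" using Suc.prems(1) by (simp add: div_le_mono le_antisym)
    then have "even x \<and> u = x + 1" "x div 2 = u div 2" using Suc.prems(1) by presburger+
    then show ?thesis by simp
  qed
  finally show ?case .
qed simp

text \<open>\<open>(n + 2 ^ l) div (2 * 2 ^ l)\<close> is the number of odd multiples of
  \<open>2 ^ l\<close> up to \<open>n\<close>. Exchanging the sums leaves, for each start, the
  number of its levels, which is 1.\<close>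

lemma sum_block_count:
  assumes m: "n < 2 ^ m"
  shows "(\<Sum>l<m. \<Sum>i<(n + 2 ^ l) div (2 * 2 ^ l). block_count f n \<sigma> (2 ^ l) ((2 * int i + 1) * 2 ^ l) z) =
    (if z \<in> occs f n \<sigma> then card (starts f n \<sigma> z) else 0)"
proof (cases "z \<in> occs f n \<sigma>")
  case True
  define u where "u = nat (bound_of n z)"
  have un: "u \<le> n" using True by (auto simp: occs_def bound_of_def u_def)
  have xu: "1 \<le> x \<and> nat x < u" if "x \<in> starts f n \<sigma> z" for x
    using that by (auto simp: starts_def cadence_pair_bound u_def)
  have bc: "block_count f n \<sigma> (2 ^ l) ((2 * int i + 1) * 2 ^ l) z =
      (\<Sum>x\<in>starts f n \<sigma> z. of_bool (nat x div 2 ^ l = 2 * i \<and> u div 2 ^ l = 2 * i + 1))" for l i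
  proof -
    \<comment> \<open>A quotient by a power of two is an interval condition; this translates the two
      intervals next to \<open>A\<close> into binary digits.\<close>
    have div: "k div 2 ^ l = j \<longleftrightarrow> int j * 2 ^ l \<le> int k \<and> int k < (int j + 1) * 2 ^ l" for k j :: nat
    proof -
      have "k div 2 ^ l = j \<longleftrightarrow> j \<le> k div 2 ^ l \<and> k div 2 ^ l < Suc j" by auto
      also have "\<dots> \<longleftrightarrow> j * 2 ^ l \<le> k \<and> k < Suc j * 2 ^ l"
        by (simp only: less_eq_div_iff_mult_less_eq div_less_iff_less_mult zero_less_power zero_less_numeral)
      also have "\<dots> \<longleftrightarrow> int (j * 2 ^ l) \<le> int k \<and> int k < int (Suc j * 2 ^ l)"
        by (simp only: of_nat_le_iff of_nat_less_iff)
      finally show ?thesis by (simp add: algebra_simps)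
    qed
    have eq: "x \<in> starts f n \<sigma> z \<and> (2 * int i + 1) * 2 ^ l - 2 ^ l \<le> x \<and> x < (2 * int i + 1) * 2 ^ l \<and>
        (2 * int i + 1) * 2 ^ l \<le> bound_of n z \<and> bound_of n z < (2 * int i + 1) * 2 ^ l + 2 ^ l \<longleftrightarrow>
        x \<in> starts f n \<sigma> z \<and> nat x div 2 ^ l = 2 * i \<and> u div 2 ^ l = 2 * i + 1" for x
      unfolding div using xu[of x] by (auto simp: u_def algebra_simps)
    have "block_count f n \<sigma> (2 ^ l) ((2 * int i + 1) * 2 ^ l) z =
        card {x. x \<in> starts f n \<sigma> z \<and> (2 * int i + 1) * 2 ^ l - 2 ^ l \<le> x \<and> x < (2 * int i + 1) * 2 ^ l \<and>
        (2 * int i + 1) * 2 ^ l \<le> bound_of n z \<and> bound_of n z < (2 * int i + 1) * 2 ^ l + 2 ^ l}"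
      using True by (auto simp: block_count_def intro!: arg_cong[where f = card])
    also have "\<dots> = card (starts f n \<sigma> z \<inter> {x. nat x div 2 ^ l = 2 * i \<and> u div 2 ^ l = 2 * i + 1})"
      unfolding eq by (rule arg_cong[where f = card]) auto
    also have "\<dots> = (\<Sum>x\<in>starts f n \<sigma> z. of_bool (nat x div 2 ^ l = 2 * i \<and> u div 2 ^ l = 2 * i + 1))"
      by (subst sum_of_bool_eq) simp_all
    finally show ?thesis .
  qed
  have inner: "(\<Sum>i<(n + 2 ^ l) div (2 * 2 ^ l). of_bool (nat x div 2 ^ l = 2 * i \<and> u div 2 ^ l = 2 * i + 1) :: nat) =
      of_bool (even (nat x div 2 ^ l) \<and> u div 2 ^ l = nat x div 2 ^ l + 1)" for l x
  proof (cases "even (nat x div 2 ^ l) \<and> u div 2 ^ l = nat x div 2 ^ l + 1")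
    case True
    define i where "i = nat x div 2 ^ l div 2"
    have i: "nat x div 2 ^ l = 2 * i" "u div 2 ^ l = 2 * i + 1" using True by (auto simp: i_def)
    \<comment> \<open>The separating odd multiple is at most \<open>u \<le> n\<close>, so the
      enumeration reaches it.\<close>
    have "(2 * i + 1) * 2 ^ l \<le> n" using un div_times_less_eq_dividend[of u "2 ^ l"] unfolding i by linarith
    then have "(i + 1) * (2 * 2 ^ l) \<le> n + 2 ^ l" by (simp add: algebra_simps)
    then have "i + 1 \<le> (n + 2 ^ l) div (2 * 2 ^ l)"
      by (subst less_eq_div_iff_mult_less_eq) simp_all
    then have "{..<(n + 2 ^ l) div (2 * 2 ^ l)} \<inter> {j. 2 * i = 2 * j \<and> 2 * i + 1 = 2 * j + 1} = {i}" by auto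
    then show ?thesis unfolding i by (subst sum_of_bool_eq) simp_all
  next
    case False
    then have "\<not> (nat x div 2 ^ l = 2 * i \<and> u div 2 ^ l = 2 * i + 1)" for i by auto
    with False show ?thesis by (simp only: of_bool_eq sum.neutral_const)
  qed
  have "(\<Sum>l<m. \<Sum>i<(n + 2 ^ l) div (2 * 2 ^ l). block_count f n \<sigma> (2 ^ l) ((2 * int i + 1) * 2 ^ l) z) =
      (\<Sum>l<m. \<Sum>x\<in>starts f n \<sigma> z. of_bool (even (nat x div 2 ^ l) \<and> u div 2 ^ l = nat x div 2 ^ l + 1))"
    unfolding bc inner[symmetric] by (intro sum.cong refl sum.swap)
  also have "\<dots> = (\<Sum>x\<in>starts f n \<sigma> z. \<Sum>l<m. of_bool (even (nat x div 2 ^ l) \<and> u div 2 ^ l = nat x div 2 ^ l + 1))"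
    by (rule sum.swap)
  also have "\<dots> = (\<Sum>x\<in>starts f n \<sigma> z. 1)"
    using xu un m by (intro sum.cong refl unique_level) auto
  finally show ?thesis using True by simp
qed (simp add: block_count_def)

section \<open>Counting by convolutions\<close>

text \<open>Cells outside the string hold 0, and 0 may be the character in question; hence the test
  that A - 1 - k is at least 1. Middle positions need no such test, as they lie between a start and
  an end inside the string.\<close>

definition conv_fill :: com where
  "conv_fill = for_loop ''k'' (Const 0) (Const 4 \<otimes> Var ''L'')
    (Store ''a'' (Var ''k'') ((Var ''k'' \<prec> Var ''L'') \<otimes> (Var ''k'' \<oplus> Const 1 \<prec> Var ''A'') \<otimes>
       (Read ''S'' (Var ''A'' \<ominus> Const 1 \<ominus> Var ''k'') \<doteq> Var ''sigma''));;
     Store ''b'' (Var ''k'') (even_expr (Var ''A'' \<ominus> Var ''L'' \<oplus> Var ''z0'' \<oplus> Var ''k'') \<otimes>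
       (Read ''S'' ((Var ''A'' \<ominus> Var ''L'' \<oplus> Var ''z0'' \<oplus> Var ''k'') \<oslash> Const 2) \<doteq> Var ''sigma'')))"

text \<open>The condition \<open>bound_of n z < A + L\<close> concerns a minimum, so it is a
  disjunction, expressed as a positive sum of two tests. The lower condition is built into the first
  value \<open>z0\<close>, and the test against \<open>n\<close> excludes end positions outside the
  string.\<close>

definition conv_add :: com where
  "conv_add = for_loop ''z'' (Var ''z0'') (Var ''z0'' \<oplus> Const 3 \<otimes> Var ''L'')
    (Store ''cnt'' (Var ''z'') (Read ''cnt'' (Var ''z'') \<oplus>
      (Var ''z'' \<prec> Var ''n'' \<oplus> Const 1) \<otimes> (Read ''S'' (Var ''z'') \<doteq> Var ''sigma'') \<otimes>
      (Const 0 \<prec> (Var ''z'' \<prec> Const 3 \<otimes> (Var ''A'' \<oplus> Var ''L'' \<ominus> Const 1)) \<oplus>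
         (Const 3 \<otimes> Var ''z'' \<prec> Const 2 \<otimes> Var ''n'' \<oplus> Var ''A'' \<oplus> Var ''L'')) \<otimes>
      Read ''r'' (Var ''z'' \<ominus> Var ''z0'' \<oplus> Var ''L'' \<ominus> Const 1)))"

definition conv_tail :: com where
  "conv_tail = (conv_fill;; Convolve ''r'' ''a'' ''b'' (Const 4 \<otimes> Var ''L'');; conv_add)"

text \<open>\<open>z0\<close> becomes the least z with A \<le> \<open>bound_of n z\<close>: the
  larger of 3(A - 1), from z div 3, and the ceiling of (2n + A) / 3, from 3z - 2n - 1. The summand 2
  before the division by 3 produces the ceiling.\<close>

definition conv_block :: com where
  "conv_block =
    (''z0'' ::= Const 3 \<otimes> (Var ''A'' \<ominus> Const 1);;
     Cond (Const 3 \<otimes> Var ''z0'' \<prec> Const 2 \<otimes> Var ''n'' \<oplus> Var ''A'')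
       (''z0'' ::= (Const 2 \<otimes> Var ''n'' \<oplus> Var ''A'' \<oplus> Const 2) \<oslash> Const 3) Skip;;
     conv_tail)"

definition conv_level :: com where
  "conv_level = (''A'' ::= Var ''L'';;
    While (Var ''A'' \<prec> Var ''n'' \<oplus> Const 1)
      (conv_block;; ''A'' ::= Var ''A'' \<oplus> Const 2 \<otimes> Var ''L''))"

definition conv_prog :: com where
  "conv_prog = (''L'' ::= Const 1;;
    While (Var ''L'' \<prec> Var ''n'' \<oplus> Const 1)
      (conv_level;; ''L'' ::= Const 2 \<otimes> Var ''L''))"

lemma zero_less_of_bool_add: "0 < (of_bool P + of_bool Q :: int) \<longleftrightarrow> P \<or> Q"
  by (cases P; cases Q) auto

lemma abs_of_bool_add_le: "2 \<le> W \<Longrightarrow> \<bar>of_bool P + of_bool Q :: int\<bar> \<le> W"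
  by (cases P; cases Q) auto

text \<open>What all counting programs leave unchanged. The factor 32 leaves room for every linear
  expression of the convolution programs: the largest is 3z with z < z0 + 3L \<le> 6n + 3.\<close>

definition fits :: "int \<Rightarrow> (int \<Rightarrow> int) \<Rightarrow> nat \<Rightarrow> int \<Rightarrow> state \<Rightarrow> bool" where
  "fits W f n \<sigma> s \<longleftrightarrow> vars s ''n'' = int n \<and> vars s ''sigma'' = \<sigma> \<and> arrs s ''S'' = f \<and>
     \<bar>\<sigma>\<bar> \<le> W \<and> (\<forall>j. \<bar>f j\<bar> \<le> W) \<and> 32 * (int n + 2) \<le> W"

section \<open>Correctness and time of one block\<close>

lemma wp_conv_fill:
  assumes s: "fits W f n \<sigma> s" "vars s ''L'' = int L" "vars s ''A'' = int A" "vars s ''z0'' = int z0"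
    and n: "1 \<le> L" "L \<le> A" "A \<le> n" "z0 \<le> 3 * n + 3"
  shows "wp T W conv_fill s (\<lambda>t s'. t \<le> 300 * L \<and> (\<forall>k. 0 \<le> k \<and> k < 4 * int L \<longrightarrow>
     arrs s' ''a'' k = of_bool ((k < int L \<and> k + 1 < int A) \<and> f (int A - 1 - k) = \<sigma>) \<and>
     arrs s' ''b'' k = of_bool ((int A - int L + int z0 + k) mod 2 = 0 \<and> f ((int A - int L + int z0 + k) div 2) = \<sigma>)))"
  unfolding conv_fill_def
proof (rule wp_for_loop[where l = 0 and h = "4 * L" and B = "\<lambda>_. 60" and I = "\<lambda>i s'. \<forall>k. 0 \<le> k \<and> k < int i \<longrightarrow>
     arrs s' ''a'' k = of_bool ((k < int L \<and> k + 1 < int A) \<and> f (int A - 1 - k) = \<sigma>) \<and>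
     arrs s' ''b'' k = of_bool ((int A - int L + int z0 + k) mod 2 = 0 \<and> f ((int A - int L + int z0 + k) div 2) = \<sigma>)"], goal_cases)
  case (9 i s')
  have W: "\<bar>\<sigma>\<bar> \<le> W" "\<And>j. \<bar>f j\<bar> \<le> W" "32 * (int n + 2) \<le> W" using s by (auto simp: fits_def)
  have *: "vars s' ''sigma'' = \<sigma>" "arrs s' ''S'' = f" "vars s' ''L'' = int L"
      "vars s' ''A'' = int A" "vars s' ''z0'' = int z0"
    using 9 s by (simp_all add: frame_def fits_def)
  have b: "\<bar>int i\<bar> \<le> W" "\<bar>int L\<bar> \<le> W" "\<bar>int A\<bar> \<le> W" "\<bar>int z0\<bar> \<le> W" "\<bar>int i + 1\<bar> \<le> W" "\<bar>int A - 1\<bar> \<le> W"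
    "\<bar>int A - 1 - int i\<bar> \<le> W" "\<bar>int A - int L\<bar> \<le> W" "\<bar>int A - int L + int z0\<bar> \<le> W"
    "\<bar>int A - int L + int z0 + int i\<bar> \<le> W" "\<bar>(int A - int L + int z0 + int i) div 2\<bar> \<le> W"
    "\<bar>(int A - int L + int z0 + int i) mod 2\<bar> \<le> W" "0 \<le> W" "1 \<le> W" "2 \<le> W"
    using 9(2) n W(3) by auto
  show ?case
    by (simp only: run_simps * 9(5) b W(1,2)) (use 9(3) in auto)
next
  case (10 t s')
  \<comment> \<open>There are 4L rounds of at most 60 + 3 + 7 steps and 8 further steps, together at
    most 288 L.\<close>
  then show ?case using n by auto
qed (use s n in \<open>auto simp: fits_def frame_def\<close>)

text \<open>The tests multiply the value read from \<open>r\<close> instead of guarding the access.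
  So \<open>r\<close> must respect the word bound on the whole range, while its exact value matters
  only where the tests succeed.\<close>

lemma wp_conv_add:
  assumes s: "fits W f n \<sigma> s" "vars s ''L'' = int L" "vars s ''A'' = int A" "vars s ''z0'' = int z0"
    and n: "1 \<le> L" "L \<le> A" "A \<le> n" "z0 \<le> 3 * n + 3"
    and z0: "\<And>z. int A \<le> bound_of n z \<longleftrightarrow> int z0 \<le> z"
    and r: "\<And>z. int z0 \<le> z \<Longrightarrow> z < int z0 + 3 * int L \<Longrightarrow> \<bar>arrs s ''r'' (z - int z0 + int L - 1)\<bar> \<le> W"
      "\<And>z. int z0 \<le> z \<Longrightarrow> z < int z0 + 3 * int L \<Longrightarrow> z \<in> occs f n \<sigma> \<Longrightarrow> bound_of n z < int A + int L \<Longrightarrow>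
        arrs s ''r'' (z - int z0 + int L - 1) = int (block_count f n \<sigma> (int L) (int A) z)"
    and cnt: "\<And>z. \<bar>arrs s ''cnt'' z\<bar> + int n \<le> W"
  shows "wp T W conv_add s (\<lambda>t s'. t \<le> 300 * L \<and>
    (\<forall>z. arrs s' ''cnt'' z = arrs s ''cnt'' z + int (block_count f n \<sigma> (int L) (int A) z)))"
  unfolding conv_add_def
proof (rule wp_for_loop[where l = z0 and h = "z0 + 3 * L" and B = "\<lambda>_. 60" and I = "\<lambda>i s'. \<forall>z. arrs s' ''cnt'' z = arrs s ''cnt'' z +
     (if z < int i then int (block_count f n \<sigma> (int L) (int A) z) else 0)"], goal_cases)
  case 7
  have "block_count f n \<sigma> (int L) (int A) z = 0" if "z < int z0" for z
    using z0[of z] that by (simp add: block_count_def)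
  then show ?case by simp
next
  case (9 i s')
  have W: "\<bar>\<sigma>\<bar> \<le> W" "\<And>j. \<bar>f j\<bar> \<le> W" "32 * (int n + 2) \<le> W" using s by (auto simp: fits_def)
  have *: "vars s' ''sigma'' = \<sigma>" "vars s' ''n'' = int n" "arrs s' ''S'' = f" "vars s' ''L'' = int L"
      "vars s' ''A'' = int A" "vars s' ''z0'' = int z0" "arrs s' ''r'' = arrs s ''r''"
    using 9 s by (simp_all add: frame_def fits_def)
  have ci: "arrs s' ''cnt'' (int i) = arrs s ''cnt'' (int i)" using 9(3) by simp
  have val: "of_bool ((int i < int n + 1 \<and> f (int i) = \<sigma>) \<and> (int i < 3 * (int A + int L - 1) \<or> 3 * int i < 2 * int n + int A + int L)) *
      arrs s ''r'' (int i - int z0 + int L - 1) = int (block_count f n \<sigma> (int L) (int A) (int i))" (is "of_bool ?P * ?r = _")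
  proof -
    have ge: "int A \<le> bound_of n (int i)" using z0[of "int i"] 9(1) by simp
    then have i1: "1 \<le> i" using n by (auto simp: bound_of_def)
    have lt: "bound_of n (int i) < int A + int L \<longleftrightarrow> int i < 3 * (int A + int L - 1) \<or> 3 * int i < 2 * int n + int A + int L"
      unfolding bound_of_def by (auto simp: min_def)
    have "?P \<longleftrightarrow> int i \<in> occs f n \<sigma> \<and> bound_of n (int i) < int A + int L"
      unfolding lt using i1 by (auto simp: occs_def)
    then show ?thesis using r(2)[of "int i"] 9(1,2) by (auto simp: block_count_def)
  qed
  have b: "\<bar>int i\<bar> \<le> W" "\<bar>int L\<bar> \<le> W" "\<bar>int A\<bar> \<le> W" "\<bar>int z0\<bar> \<le> W" "\<bar>int n\<bar> \<le> W" "\<bar>int n + 1\<bar> \<le> W"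
    "\<bar>2 * int n\<bar> \<le> W" "\<bar>2 * int n + int A\<bar> \<le> W" "\<bar>2 * int n + int A + int L\<bar> \<le> W" "\<bar>3 * int i\<bar> \<le> W"
    "\<bar>int A + int L\<bar> \<le> W" "\<bar>int A + int L - 1\<bar> \<le> W" "\<bar>3 * (int A + int L - 1)\<bar> \<le> W"
    "\<bar>int i - int z0\<bar> \<le> W" "\<bar>int i - int z0 + int L\<bar> \<le> W" "\<bar>int i - int z0 + int L - 1\<bar> \<le> W"
     "0 \<le> W" "1 \<le> W" "2 \<le> W" "3 \<le> W"
    "\<bar>arrs s ''cnt'' (int i)\<bar> \<le> W" "\<bar>arrs s ''cnt'' (int i) + int (block_count f n \<sigma> (int L) (int A) (int i))\<bar> \<le> W"
    "\<bar>arrs s ''r'' (int i - int z0 + int L - 1)\<bar> \<le> W" "\<bar>int (block_count f n \<sigma> (int L) (int A) (int i))\<bar> \<le> W"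
    using 9(1,2) n W(3) cnt[of "int i"] block_count_le[of f n \<sigma> "int L" "int A" "int i"] r(1)[of "int i"] by auto
  show ?case
    by (simp only: run_simps * 9(5) ci zero_less_of_bool_add abs_of_bool_add_le val b W(1,2)) (use 9(3) in auto)
next
  case (10 t s')
  \<comment> \<open>Over 3L positions both arguments of the minimum in \<open>bound_of\<close> grow
    by at least L, so the range of the loop covers the whole block.\<close>
  have "block_count f n \<sigma> (int L) (int A) z = 0" if "\<not> z < int z0 + 3 * int L" for z
  proof -
    have "int A \<le> bound_of n (int z0)" using z0[of "int z0"] by simp
    moreover have "int z0 div 3 + int L \<le> z div 3"
      using zdiv_mono1[of "int z0 + 3 * int L" z 3] that by simp
    ultimately have "int A + int L \<le> bound_of n z"
      using that by (auto simp: bound_of_def)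
    then show ?thesis by (simp add: block_count_def)
  qed
  then show ?case using n 10 by auto
qed (use s n in \<open>auto simp: fits_def frame_def\<close>)

lemma wp_conv_block_tail:
  assumes s: "fits W f n \<sigma> s" "vars s ''L'' = int L" "vars s ''A'' = int A" "vars s ''z0'' = int z0"
    and n: "1 \<le> L" "L \<le> A" "A \<le> n" "z0 \<le> 3 * n + 3"
    and z0: "\<And>z. int A \<le> bound_of n z \<longleftrightarrow> int z0 \<le> z"
    and cnt: "\<And>z. \<bar>arrs s ''cnt'' z\<bar> + int n \<le> W"
  shows "wp T W conv_tail s
    (\<lambda>t s'. t \<le> 700 * L + T (4 * L) \<and>
      (\<forall>z. arrs s' ''cnt'' z = arrs s ''cnt'' z + int (block_count f n \<sigma> (int L) (int A) z)))"
proof -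
  have W: "32 * (int n + 2) \<le> W" using s by (simp add: fits_def)
  \<comment> \<open>The arguments are 0/1 sequences, so each convolution value counts indices below
    4L and fits into a word.\<close>
  have bound: "0 \<le> acyclic_conv (4 * int L) (arrs s' ''a'') (arrs s' ''b'') k \<and>
      acyclic_conv (4 * int L) (arrs s' ''a'') (arrs s' ''b'') k \<le> 4 * int L"
    if "\<forall>k. 0 \<le> k \<and> k < 4 * int L \<longrightarrow>
     arrs s' ''a'' k = of_bool ((k < int L \<and> k + 1 < int A) \<and> f (int A - 1 - k) = \<sigma>) \<and>
     arrs s' ''b'' k = of_bool ((int A - int L + int z0 + k) mod 2 = 0 \<and> f ((int A - int L + int z0 + k) div 2) = \<sigma>)"
    for s' :: state and k
  proof -
    have eq: "acyclic_conv (4 * int L) (arrs s' ''a'') (arrs s' ''b'') k =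
      int (card {i. 0 \<le> i \<and> i < 4 * int L \<and> 0 \<le> k - i \<and> k - i < 4 * int L \<and>
        ((i < int L \<and> i + 1 < int A) \<and> f (int A - 1 - i) = \<sigma>) \<and>
        ((int A - int L + int z0 + (k - i)) mod 2 = 0 \<and> f ((int A - int L + int z0 + (k - i)) div 2) = \<sigma>)})"
      using that by (intro acyclic_conv_of_bool) auto
    also have "\<dots> \<le> int (card {0..<4 * int L})" by (intro of_nat_mono card_mono) auto
    also have "\<dots> = 4 * int L" by simp
    finally show ?thesis by (simp add: eq)
  qed
  show ?thesis
    unfolding conv_tail_def wp_Seq
  proof (rule wp_mono[OF wp_conv_fill[OF s n]], rule wp_Convolve[where m = "4 * L"], goal_cases)
    case (4 t s' k)
    then show ?case using W by (auto simp: of_bool_def)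
  next
    case (5 t s' k)
    then show ?case using bound[of s' k] W n by auto
  next
    case (6 t s')
    let ?s = "set_arr ''r'' (\<lambda>k. if k \<in> {0..<2 * int (4 * L) - 1}
      then acyclic_conv (int (4 * L)) (arrs s' ''a'') (arrs s' ''b'') k else arrs s' ''r'' k) s'"
    have fr: "arrs s' ''cnt'' = arrs s ''cnt''" "fits W f n \<sigma> s'" "vars s' ''L'' = int L" "vars s' ''A'' = int A"
      "vars s' ''z0'' = int z0"
      using 6 s by (simp_all add: frame_def conv_fill_def fits_def)
    have read: "arrs ?s ''r'' (z - int z0 + int L - 1) =
        acyclic_conv (4 * int L) (arrs s' ''a'') (arrs s' ''b'') (z - int z0 + int L - 1)"
      if "int z0 \<le> z" "z < int z0 + 3 * int L" for z using that n(1) by simp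
    have "wp T W conv_add ?s (\<lambda>t s'. t \<le> 300 * L \<and>
      (\<forall>z. arrs s' ''cnt'' z = arrs ?s ''cnt'' z + int (block_count f n \<sigma> (int L) (int A) z)))"
    proof (rule wp_conv_add[OF _ _ _ _ n z0])
      fix z assume z: "int z0 \<le> z" "z < int z0 + 3 * int L"
      show "\<bar>arrs ?s ''r'' (z - int z0 + int L - 1)\<bar> \<le> W"
        unfolding read[OF z] using bound[of s' "z - int z0 + int L - 1"] 6 W n by auto
      assume "z \<in> occs f n \<sigma>" "bound_of n z < int A + int L"
      then show "arrs ?s ''r'' (z - int z0 + int L - 1) = int (block_count f n \<sigma> (int L) (int A) z)"
        unfolding read[OF z] using 6 z0[of z] z by (intro acyclic_conv_block) auto
    qed (use fr cnt in \<open>auto simp: fits_def\<close>)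
    then show ?case by (rule wp_mono) (use 6 fr n in auto)
  qed (use s W n in \<open>auto simp: frame_def conv_fill_def\<close>)
qed

lemma wp_conv_block:
  assumes s: "fits W f n \<sigma> s" "vars s ''L'' = int L" "vars s ''A'' = int A"
    and n: "1 \<le> L" "L \<le> A" "A \<le> n"
    and cnt: "\<And>z. \<bar>arrs s ''cnt'' z\<bar> + int n \<le> W"
  shows "wp T W conv_block s (\<lambda>t s'. t \<le> 750 * L + T (4 * L) \<and>
      (\<forall>z. arrs s' ''cnt'' z = arrs s ''cnt'' z + int (block_count f n \<sigma> (int L) (int A) z)))"
proof -
  define c where "c \<longleftrightarrow> 3 * (3 * (int A - 1)) < 2 * int n + int A"
  define z0 where "z0 = (if c then nat ((2 * int n + int A + 2) div 3) else nat (3 * (int A - 1)))"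
  have z0_eq: "int z0 = (if c then (2 * int n + int A + 2) div 3 else 3 * (int A - 1))"
    using n by (auto simp: z0_def)
  have le: "z0 \<le> 3 * n + 3" using n unfolding z0_def by auto
  have z0: "int A \<le> bound_of n z \<longleftrightarrow> int z0 \<le> z" for z
  proof -
    have "int A \<le> bound_of n z \<longleftrightarrow> 3 * (int A - 1) \<le> z \<and> 2 * int n + int A \<le> 3 * z"
      unfolding bound_of_def by (auto simp: min_def)
    also have "\<dots> \<longleftrightarrow> int z0 \<le> z" unfolding z0_eq c_def by auto
    finally show ?thesis .
  qed
  have tail: "wp T W conv_tail s'
    (\<lambda>t s'. t + 50 \<le> 750 * L + T (4 * L) \<and>
      (\<forall>z. arrs s' ''cnt'' z = arrs s ''cnt'' z + int (block_count f n \<sigma> (int L) (int A) z)))"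
    if "fits W f n \<sigma> s'" "vars s' ''L'' = int L" "vars s' ''A'' = int A" "vars s' ''z0'' = int z0"
      "arrs s' ''cnt'' = arrs s ''cnt''" for s'
    by (rule wp_mono[OF wp_conv_block_tail[OF that(1-4) n le z0]]) (use cnt that n in auto)
  have W: "32 * (int n + 2) \<le> W" and v: "vars s ''n'' = int n" using s by (simp_all add: fits_def)
  have b: "\<bar>int A\<bar> \<le> W" "\<bar>int n\<bar> \<le> W" "\<bar>int A - 1\<bar> \<le> W" "\<bar>3 * (int A - 1)\<bar> \<le> W" "\<bar>3 * (3 * (int A - 1))\<bar> \<le> W"
    "\<bar>2 * int n\<bar> \<le> W" "\<bar>2 * int n + int A\<bar> \<le> W" "\<bar>2 * int n + int A + 2\<bar> \<le> W"
    "\<bar>(2 * int n + int A + 2) div 3\<bar> \<le> W" "1 \<le> W" "2 \<le> W" "3 \<le> W"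
    using W n by auto
  show ?thesis
  proof (cases c)
    case True
    show ?thesis
      by (simp only: conv_block_def run_simps s v b c_def[symmetric] True of_bool_eq zero_neq_one one_neq_zero)
        (rule wp_mono[OF tail], use s z0_eq True in \<open>auto simp: fits_def\<close>)
  next
    case False
    show ?thesis
      by (simp only: conv_block_def run_simps s v b c_def[symmetric] False of_bool_eq zero_neq_one one_neq_zero)
        (rule wp_mono[OF tail], use s z0_eq False in \<open>auto simp: fits_def\<close>)
  qed
qed

section \<open>One scale and the sum over all scales\<close>

lemma written_conv [simp]:
  "written_vars conv_block = {''z0'', ''k'', ''z''}" "written_arrs conv_block = {''a'', ''b'', ''r'', ''cnt''}"
  by (auto simp: conv_block_def conv_tail_def conv_fill_def conv_add_def)

text \<open>A block costs O(L) + T(4L) and \<open>N * L \<le> n\<close>, so the linear parts add up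
  to O(n), while the convolutions are kept as \<open>N * T (4 * L)\<close>. The bound on
  \<open>cnt\<close> includes the complete sum, which dominates all partial sums.\<close>

lemma wp_conv_level:
  fixes n L :: nat
  defines "N \<equiv> (n + L) div (2 * L)"
  assumes s: "fits W f n \<sigma> s" "vars s ''L'' = int L"
    and n: "1 \<le> L" "L \<le> n"
    and cnt: "\<And>z. \<bar>arrs s ''cnt'' z\<bar> +
      int (\<Sum>i<N. block_count f n \<sigma> (int L) ((2 * int i + 1) * int L) z) + int n \<le> W"
  shows "wp T W conv_level s (\<lambda>t s'. t \<le> 800 * n + N * T (4 * L) \<and>
      (\<forall>z. arrs s' ''cnt'' z = arrs s ''cnt'' z +
        int (\<Sum>i<N. block_count f n \<sigma> (int L) ((2 * int i + 1) * int L) z)))"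
proof -
  have less_N: "i < N \<longleftrightarrow> (2 * i + 1) * L \<le> n" for i
  proof -
    have "i < N \<longleftrightarrow> Suc i \<le> N" by auto
    also have "\<dots> \<longleftrightarrow> Suc i * (2 * L) \<le> n + L"
      unfolding N_def using n by (subst less_eq_div_iff_mult_less_eq) auto
    finally show ?thesis by (simp add: algebra_simps)
  qed
  \<comment> \<open>Rounding down gives 2NL \<le> n + L \<le> 2n.\<close>
  have NL: "N * L \<le> n"
    using div_times_less_eq_dividend[of "n + L" "2 * L"] n unfolding N_def by linarith
  have W: "32 * (int n + 2) \<le> W" using s by (simp add: fits_def)
  let ?I = "\<lambda>i s'. vars s' ''A'' = int ((2 * i + 1) * L) \<and> (\<forall>z. arrs s' ''cnt'' z = arrs s ''cnt'' z +
        int (\<Sum>i<i. block_count f n \<sigma> (int L) ((2 * int i + 1) * int L) z))"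
  let ?c = "conv_block;; ''A'' ::= Var ''A'' \<oplus> Const 2 \<otimes> Var ''L''"
  have fr: "fits W f n \<sigma> s'" "vars s' ''L'' = int L" "vars s' ''n'' = int n"
    if "frame ?c (set_var ''A'' v s) s'" for v s'
    using that s by (auto simp: frame_def fits_def)
  have "wp T W (While (Var ''A'' \<prec> Var ''n'' \<oplus> Const 1) ?c) (set_var ''A'' (int L) s)
     (\<lambda>t s'. t + 2 \<le> 800 * n + N * T (4 * L) \<and>
      (\<forall>z. arrs s' ''cnt'' z = arrs s ''cnt'' z +
        int (\<Sum>i<N. block_count f n \<sigma> (int L) ((2 * int i + 1) * int L) z)))"
  proof (rule wp_While[where N = N and B = "\<lambda>_. 750 * L + T (4 * L) + 6" and I = ?I], goal_cases)
    case (2 i s')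
    define A where "A = (2 * i + 1) * L"
    have A: "L \<le> A" "A \<le> n" using less_N[of i] 2(1) by (auto simp: A_def)
    note fr = fr[OF 2(3)]
    have cnt': "\<bar>arrs s' ''cnt'' z\<bar> + int n \<le> W" for z
    proof -
      have "(\<Sum>i<i. block_count f n \<sigma> (int L) ((2 * int i + 1) * int L) z) \<le>
          (\<Sum>i<N. block_count f n \<sigma> (int L) ((2 * int i + 1) * int L) z)"
        using 2(1) by (intro sum_mono2) auto
      moreover have "arrs s' ''cnt'' z = arrs s ''cnt'' z +
          int (\<Sum>i<i. block_count f n \<sigma> (int L) ((2 * int i + 1) * int L) z)"
        using 2(2) by blast
      ultimately show ?thesis using cnt[of z] by linarith
    qed
    have b: "\<bar>int A\<bar> \<le> W" "\<bar>int n\<bar> \<le> W" "\<bar>int n + 1\<bar> \<le> W" "\<bar>int L\<bar> \<le> W" "\<bar>2 * int L\<bar> \<le> W"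
       "\<bar>int A + 2 * int L\<bar> \<le> W" "1 \<le> W" "2 \<le> W"
      using W A n by auto
    have A': "vars s' ''A'' = int A" using 2(2) by (simp add: A_def)
    have "wp T W conv_block s' (\<lambda>t s''. t \<le> 750 * L + T (4 * L) \<and>
      (\<forall>z. arrs s'' ''cnt'' z = arrs s' ''cnt'' z + int (block_count f n \<sigma> (int L) (int A) z)))"
      by (rule wp_conv_block[OF fr(1,2) A' n(1) A cnt'])
    then have "wp T W ?c s' (\<lambda>t s''. t \<le> 750 * L + T (4 * L) + 6 \<and> ?I (Suc i) s'')"
      unfolding wp_Seq wp_Assign
    proof (rule wp_mono, goal_cases)
      case (1 t s'')
      have v: "vars s'' ''A'' = int A" "vars s'' ''L'' = int L" using 1(2) A' fr by (auto simp: frame_def)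
      have int_A: "int A = (2 * int i + 1) * int L" by (simp add: A_def algebra_simps)
      show ?case
      proof (intro conjI)
        show "safe W s'' (Var ''A'' \<oplus> Const 2 \<otimes> Var ''L'')" by (simp only: run_simps v b)
        show "vars (set_var ''A'' (val s'' (Var ''A'' \<oplus> Const 2 \<otimes> Var ''L'')) s'') ''A'' = int ((2 * Suc i + 1) * L)"
          by (simp add: v) (simp add: A_def algebra_simps)
      qed (use 1(1) 2(2) in \<open>auto simp: int_A\<close>)
    qed
    moreover have "val s' (Var ''A'' \<prec> Var ''n'' \<oplus> Const 1) \<noteq> 0" "safe W s' (Var ''A'' \<prec> Var ''n'' \<oplus> Const 1)"
      using A W by (simp_all add: A' fr safe_ops)
    ultimately show ?case by blast
  next
    case (3 s')
    note fr = fr[OF 3(2)]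
    define A where "A = (2 * N + 1) * L"
    have A: "n < A" "A \<le> 3 * n" using less_N[of N] NL n by (auto simp: A_def algebra_simps)
    have A': "vars s' ''A'' = int A" using 3(1) by (simp add: A_def)
    show ?case using A W by (simp add: A' fr safe_ops)
  next
    case (4 t s')
    have "t \<le> N * (750 * L + T (4 * L) + 12) + 6" using 4(3) by (simp add: algebra_simps)
    also have "\<dots> = 750 * (N * L) + 12 * N + 6 + N * T (4 * L)" by (simp add: algebra_simps)
    finally have "t \<le> 750 * (N * L) + 12 * N + 6 + N * T (4 * L)" .
    moreover have "N \<le> N * L" using n by simp
    ultimately have "t + 2 \<le> 800 * n + N * T (4 * L)" using NL n by linarith
    then show ?case using 4(1) by simp
  qed (use s in auto)
  then show ?thesis
    using W n by (simp add: conv_level_def wp_Seq wp_Assign s fits_def)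
qed

text \<open>\<open>m\<close> is the number of scales 1, 2, 4, ... up to \<open>n\<close>.
  Convolution lengths are four times a scale, so a bound on \<open>T\<close> at powers of two
  suffices. The summand 1 in the time covers \<open>n = 0\<close>.\<close>

lemma wp_conv_prog:
  assumes s: "fits W f n \<sigma> s"
    and m: "n < 2 ^ m" "\<And>p. p < m \<Longrightarrow> 2 ^ p \<le> n"
    and T: "\<And>p. 1 \<le> p \<Longrightarrow> T (2 ^ p) \<le> D * (2 ^ p * p)"
    and cnt: "\<And>z. \<bar>arrs s ''cnt'' z\<bar> + 2 * int n \<le> W"
  shows "wp T W conv_prog s (\<lambda>t s'. t \<le> (900 + 8 * D) * (n * (m * m) + 1) \<and>
      (\<forall>z. arrs s' ''cnt'' z = arrs s ''cnt'' z +
        (if z \<in> occs f n \<sigma> then int (card (starts f n \<sigma> z)) else 0)))"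
proof -
  define g where "g l z = (\<Sum>i<(n + 2 ^ l) div (2 * 2 ^ l). block_count f n \<sigma> (2 ^ l) ((2 * int i + 1) * 2 ^ l) z)" for l z
  have g_sum: "(\<Sum>l<m. g l z) = (if z \<in> occs f n \<sigma> then card (starts f n \<sigma> z) else 0)" for z
    unfolding g_def by (rule sum_block_count[OF m(1)])
  \<comment> \<open>The sum over all scales is a number of starts, so no partial sum exceeds
    \<open>n\<close> and the counters stay within words.\<close>
  have g_le: "(\<Sum>l<i. g l z) \<le> n" if "i \<le> m" for i z
  proof -
    have "(\<Sum>l<i. g l z) \<le> (\<Sum>l<m. g l z)" using that by (intro sum_mono2) auto
    then show ?thesis using card_starts[of f n \<sigma> z] by (simp add: g_sum split: if_splits)
  qed
  have W: "32 * (int n + 2) \<le> W" using s by (simp add: fits_def)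
  let ?I = "\<lambda>l s'. vars s' ''L'' = int (2 ^ l) \<and> (\<forall>z. arrs s' ''cnt'' z = arrs s ''cnt'' z + int (\<Sum>l<l. g l z))"
  let ?c = "conv_level;; ''L'' ::= Const 2 \<otimes> Var ''L''"
  have fr: "fits W f n \<sigma> s'" "vars s' ''n'' = int n"
    if "frame ?c (set_var ''L'' v s) s'" for v s'
    using that s by (auto simp: frame_def fits_def conv_level_def)
  have "wp T W (While (Var ''L'' \<prec> Var ''n'' \<oplus> Const 1) ?c) (set_var ''L'' 1 s)
     (\<lambda>t s'. t + 2 \<le> (900 + 8 * D) * (n * (m * m) + 1) \<and>
      (\<forall>z. arrs s' ''cnt'' z = arrs s ''cnt'' z + int (\<Sum>l<m. g l z)))"
  proof (rule wp_While[where N = m and B = "\<lambda>l. 805 * n + 4 * D * n * (l + 2)" and I = ?I], goal_cases)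
    case (2 l s')
    define L :: nat where "L = 2 ^ l"
    have L: "1 \<le> L" "L \<le> n" using m(2)[OF 2(1)] by (auto simp: L_def)
    note fr = fr[OF 2(3)]
    have L': "vars s' ''L'' = int L" using 2(2) by (simp add: L_def)
    have gL: "(\<Sum>i<(n + L) div (2 * L). block_count f n \<sigma> (int L) ((2 * int i + 1) * int L) z) = g l z" for z
      by (simp add: g_def L_def)
    have cnt': "\<bar>arrs s' ''cnt'' z\<bar> + int (g l z) + int n \<le> W" for z
    proof -
      have "(\<Sum>l<l. g l z) + g l z \<le> n" using g_le[of "Suc l" z] 2(1) by simp
      moreover have "arrs s' ''cnt'' z = arrs s ''cnt'' z + int (\<Sum>l<l. g l z)" using 2(2) by blast
      ultimately show ?thesis using cnt[of z] by linarith
    qed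
    have b: "\<bar>int n\<bar> \<le> W" "\<bar>int n + 1\<bar> \<le> W" "\<bar>int L\<bar> \<le> W" "\<bar>2 * int L\<bar> \<le> W" "1 \<le> W" "2 \<le> W"
      using W L by auto
    \<comment> \<open>At most (n + L) / (2L) blocks, each with T(4L) \<le> 4 D L (l + 2), because 4L
      is the power of two with exponent l + 2: the scale L cancels.\<close>
    have time: "800 * n + (n + L) div (2 * L) * T (4 * L) + 4 \<le> 805 * n + 4 * D * n * (l + 2)"
    proof -
      have "(n + L) div (2 * L) * (2 * L) \<le> n + L" by (rule div_times_less_eq_dividend)
      then have NL: "(n + L) div (2 * L) * L \<le> n" using L by linarith
      have "T (4 * L) \<le> D * (4 * L * (l + 2))" using T[of "l + 2"] by (simp add: L_def power_add algebra_simps)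
      then have "(n + L) div (2 * L) * T (4 * L) \<le> (n + L) div (2 * L) * (D * (4 * L * (l + 2)))" by (rule mult_le_mono2)
      also have "\<dots> = (n + L) div (2 * L) * L * (4 * D * (l + 2))" by (simp only: ac_simps)
      also have "\<dots> \<le> n * (4 * D * (l + 2))" using NL by (rule mult_le_mono1)
      finally show ?thesis using L by (simp add: algebra_simps)
    qed
    have "wp T W conv_level s' (\<lambda>t s''. t \<le> 800 * n + (n + L) div (2 * L) * T (4 * L) \<and>
      (\<forall>z. arrs s'' ''cnt'' z = arrs s' ''cnt'' z + int (g l z)))"
      unfolding gL[symmetric] by (rule wp_conv_level[OF fr(1) L' L cnt'[folded gL]])
    then have "wp T W ?c s' (\<lambda>t s''. t \<le> 805 * n + 4 * D * n * (l + 2) \<and> ?I (Suc l) s'')"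
      unfolding wp_Seq wp_Assign
    proof (rule wp_mono, goal_cases)
      case (1 t s'')
      have v: "vars s'' ''L'' = int L" using 1(2) L' by (auto simp: frame_def conv_level_def)
      show ?case
      proof (intro conjI)
        show "safe W s'' (Const 2 \<otimes> Var ''L'')" by (simp only: run_simps v b)
        show "vars (set_var ''L'' (val s'' (Const 2 \<otimes> Var ''L'')) s'') ''L'' = int (2 ^ Suc l)"
          by (simp add: v) (simp add: L_def)
      qed (use 1(1) 2(2) time in auto)
    qed
    moreover have "val s' (Var ''L'' \<prec> Var ''n'' \<oplus> Const 1) \<noteq> 0" "safe W s' (Var ''L'' \<prec> Var ''n'' \<oplus> Const 1)"
      using L W by (simp_all add: L' fr safe_ops)
    ultimately show ?case by blast
  next
    case (3 s')
    note fr = fr[OF 3(2)]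
    define L :: nat where "L = 2 ^ m"
    have L: "n < L" "L \<le> 2 * n + 1" using m(1) m(2)[of "m - 1"] by (cases m; auto simp: L_def)+
    have L': "vars s' ''L'' = int L" using 3(1) by (simp add: L_def)
    show ?case using L W by (simp add: L' fr safe_ops)
  next
    case (4 t s')
    have "(\<Sum>l<m. 805 * n + 4 * D * n * (l + 2) + cost (Var ''L'' \<prec> Var ''n'' \<oplus> Const 1) + 1) \<le>
        (\<Sum>l<m. 805 * n + 4 * D * n * (m + 1) + 6)"
    proof (rule sum_mono)
      fix l assume "l \<in> {..<m}"
      then have "4 * D * n * (l + 2) \<le> 4 * D * n * (m + 1)" by (intro mult_le_mono2) auto
      then show "805 * n + 4 * D * n * (l + 2) + cost (Var ''L'' \<prec> Var ''n'' \<oplus> Const 1) + 1 \<le>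
          805 * n + 4 * D * n * (m + 1) + 6" unfolding cost.simps by linarith
    qed
    then have "t \<le> m * (805 * n + 4 * D * n * (m + 1) + 6) + 6" using 4(3) by simp
    also have "\<dots> + 2 \<le> (900 + 8 * D) * (n * (m * m) + 1)"
    proof (cases "m = 0")
      case False
      then have "1 \<le> m" "1 \<le> n" using m(2)[of 0] by auto
      then have "n * m \<le> n * (m * m)" "m \<le> n * m" by simp_all
      moreover have "D * (n * m) \<le> D * (n * (m * m))" using \<open>n * m \<le> n * (m * m)\<close> by (rule mult_le_mono2)
      moreover have "m * (805 * n + 4 * D * n * (m + 1) + 6) + 6 + 2 =
        805 * (n * m) + 4 * (D * (n * (m * m))) + 4 * (D * (n * m)) + 6 * m + 8" by (simp add: algebra_simps)
      moreover have "(900 + 8 * D) * (n * (m * m) + 1) = 900 * (n * (m * m)) + 8 * (D * (n * (m * m))) + 900 + 8 * D"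
        by (simp add: algebra_simps)
      ultimately show ?thesis by linarith
    qed simp
    finally have "t + 2 \<le> (900 + 8 * D) * (n * (m * m) + 1)" by simp
    then show ?case using 4(1) by blast
  qed (use s in auto)
  then have "wp T W conv_prog s (\<lambda>t s'. t \<le> (900 + 8 * D) * (n * (m * m) + 1) \<and>
      (\<forall>z. arrs s' ''cnt'' z = arrs s ''cnt'' z + int (\<Sum>l<m. g l z)))"
    using W by (simp add: conv_prog_def wp_Seq wp_Assign)
  then show ?thesis by (rule wp_mono) (auto simp: g_sum)
qed

section \<open>Programs and the cadences of a string\<close>

lemma array_of_char_at: "1 \<le> j \<Longrightarrow> j \<le> length S \<Longrightarrow> array_of S (int j) = char_at S j"
  by (simp add: array_of_def char_at_def nat_diff_distrib)

lemma occs_array_of: "occs (array_of S) (length S) \<sigma> = int ` occurrences \<sigma> S"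
proof -
  have "x \<in> int ` occurrences \<sigma> S" if "x \<in> occs (array_of S) (length S) \<sigma>" for x
    using that array_of_char_at[of "nat x" S]
    by (intro image_eqI[of _ _ "nat x"]) (auto simp: occs_def occurrences_def)
  then show ?thesis by (auto simp: occs_def occurrences_def array_of_char_at)
qed

lemma card_ending_at_with:
  assumes z: "1 \<le> z" "z \<le> length S"
  shows "card (ending_at z (cadences3_with \<sigma> S)) =
    (if int z \<in> occs (array_of S) (length S) \<sigma> then card (starts (array_of S) (length S) \<sigma> (int z)) else 0)"
proof (cases "char_at S z = \<sigma>")
  case True
  let ?n = "length S" and ?f = "array_of S"
  have "bij_betw (\<lambda>(i, d). int i) (ending_at z (cadences3_with \<sigma> S)) (starts ?f ?n \<sigma> (int z))"
  proof (rule bij_betw_byWitness[where f' = "\<lambda>x. (nat x, nat ((int z - x) div 2))"], goal_cases)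
    case 1
    then show ?case by (auto simp: ending_at_def)
  next
    case 2
    then show ?case by (auto simp: starts_def)
  next
    case 3
    show ?case
    proof safe
      fix i d assume "(i, d) \<in> ending_at z (cadences3_with \<sigma> S)"
      then have d: "0 < i" "0 < d" "i \<le> d" "i + 2 * d = z" "?n < i + 3 * d" "char_at S i = \<sigma>" "char_at S (i + d) = \<sigma>"
        by (auto simp: ending_at_def cadences3_def cadences3_with_def)
      have mid: "(int i + int z) div 2 = int (i + d)" using d by auto
      have "?f ((int i + int z) div 2) = \<sigma>" unfolding mid using d z by (subst array_of_char_at) auto
      moreover have "?f (int i) = \<sigma>" using d z by (subst array_of_char_at) auto
      ultimately show "int i \<in> starts ?f ?n \<sigma> (int z)"
        using d z by (auto simp: starts_def cadence_pair_def)
    qed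
  next
    case 4
    show ?case
    proof safe
      fix x assume "x \<in> starts ?f ?n \<sigma> (int z)"
      then have x: "1 \<le> x" "?f x = \<sigma>" "3 * x \<le> int z" "2 * int ?n < 3 * int z - x"
        "(x + int z) mod 2 = 0" "?f ((x + int z) div 2) = \<sigma>" by (auto simp: starts_def cadence_pair_def)
      define i d where "i = nat x" and "d = nat ((int z - x) div 2)"
      \<comment> \<open>Parity makes the halving exact, so start and distance reproduce
        \<open>z\<close>.\<close>
      have e: "2 * ((int z - x) div 2) = int z - x" using x(5) by presburger
      have i: "int i = x" using x by (simp add: i_def)
      have d: "int d = (int z - x) div 2" using x by (simp add: d_def)
      have id: "int i = x" "i + 2 * d = z" "1 \<le> i" "i \<le> d" "?n < i + 3 * d" "(x + int z) div 2 = int (i + d)"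
        using i d x e by linarith+
      have "char_at S i = \<sigma>" using x(2) id z by (subst (asm) id(1)[symmetric], subst (asm) array_of_char_at) auto
      moreover have "char_at S (i + d) = \<sigma>" using x(6) id z unfolding id(6) by (subst (asm) array_of_char_at) auto
      ultimately have "(i, d) \<in> ending_at z (cadences3_with \<sigma> S)"
        using id True z by (auto simp: ending_at_def cadences3_def cadences3_with_def)
      then show "(nat x, nat ((int z - x) div 2)) \<in> ending_at z (cadences3_with \<sigma> S)" by (simp add: i_def d_def)
    qed
  qed
  then have "card (ending_at z (cadences3_with \<sigma> S)) = card (starts ?f ?n \<sigma> (int z))" by (rule bij_betw_same_card)
  moreover have "int z \<in> occs ?f ?n \<sigma>" using True z by (auto simp: occs_def array_of_char_at)
  ultimately show ?thesis by simp
next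
  case False
  then have "ending_at z (cadences3_with \<sigma> S) = {}"
    by (auto simp: ending_at_def cadences3_def cadences3_with_def)
  moreover have "int z \<notin> occs (array_of S) (length S) \<sigma>" using False z by (auto simp: occs_def array_of_char_at)
  ultimately show ?thesis by simp
qed

lemma card_eq_sum_ending_at:
  assumes "K \<subseteq> cadences3 S"
  shows "card K = (\<Sum>z=1..length S. card (ending_at z K))"
proof -
  have "finite K" using assms finite_cadences3 by (rule finite_subset)
  moreover have "(\<lambda>(i, d). i + 2 * d) ` K \<subseteq> {1..length S}" using assms by (auto simp: cadences3_def)
  ultimately have "(\<Sum>z=1..length S. \<Sum>k\<in>{k \<in> K. (case k of (i, d) \<Rightarrow> i + 2 * d) = z}. 1) = (\<Sum>k\<in>K. 1 :: nat)"
    by (intro sum.group) auto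
  moreover have "{k \<in> K. (case k of (i, d) \<Rightarrow> i + 2 * d) = z} = ending_at z K" for z
    by (auto simp: ending_at_def)
  ultimately show ?thesis by simp
qed

lemma cadences3_with_subset: "cadences3_with \<sigma> S \<subseteq> cadences3 S"
  by (auto simp: cadences3_with_def)

text \<open>The character of a cadence is the one at its last position. Hence the counts for
  different characters go to disjoint cells, and one array \<open>cnt\<close> serves all of
  them.\<close>

lemma ending_at_cadences3:
  "ending_at z (cadences3 S) = ending_at z (cadences3_with (char_at S z) S)"
  by (auto simp: ending_at_def cadences3_def cadences3_with_def)

section \<open>Binary length and its comparison with the logarithm\<close>

definition bit_length :: "nat \<Rightarrow> nat" where
  "bit_length n = (LEAST m. n < 2 ^ m)"

lemma less_bit_length: "n < 2 ^ bit_length n"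
  unfolding bit_length_def by (rule LeastI[of _ n]) simp

lemma bit_length_le: "p < bit_length n \<Longrightarrow> 2 ^ p \<le> n"
  unfolding bit_length_def using not_less_Least by fastforce

text \<open>The leading binary digit bounds the length minus 1 by log n, and n \<ge> 2 makes log n
  \<ge> 1, which absorbs the remaining 1 into the factor 2.\<close>

lemma bit_length_log:
  assumes "2 \<le> n"
  shows "real (bit_length n) \<le> 2 * log 2 (real n)"
proof -
  have "1 \<le> bit_length n" using less_bit_length[of n] assms by (cases "bit_length n") auto
  then have "2 ^ (bit_length n - 1) \<le> n" by (intro bit_length_le) simp
  then have "2 ^ (bit_length n - 1) \<le> real n"
    by (metis numeral_power_le_of_nat_cancel_iff)
  then have "real (bit_length n - 1) \<le> log 2 (real n)"
    using assms by (simp add: le_log_iff powr_realpow)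
  moreover have "1 \<le> log 2 (real n)" using assms by (subst le_log_iff) auto
  ultimately show ?thesis using \<open>1 \<le> bit_length n\<close> by simp
qed

lemma bit_length_small: "n \<le> 1 \<Longrightarrow> bit_length n \<le> 1"
  unfolding bit_length_def by (rule Least_le) auto

text \<open>6 = 4 + 1 + 1: the 4 is the square of the factor in \<open>bit_length_log\<close>, and n
  and 1 are each at most the bound when n \<ge> 2. For n \<le> 1 the left side is at most 3.\<close>

lemma conv_time_bound:
  "real (n * (bit_length n * bit_length n) + n + 1) \<le> 6 * max 1 (real n * (log 2 (real n))\<^sup>2)"
proof (cases "n \<le> 1")
  case True
  then have "n * (bit_length n * bit_length n) \<le> 1 * (1 * 1)"
    using bit_length_small by (intro mult_le_mono) auto
  then have "real (n * (bit_length n * bit_length n) + n + 1) \<le> 3" using True by linarith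
  then show ?thesis by linarith
next
  case False
  define l where "l = log 2 (real n)"
  have l: "1 \<le> l" "real (bit_length n) \<le> 2 * l" using False bit_length_log[of n]
    by (auto simp: l_def intro!: iffD2[OF le_log_iff])
  have "real n * (real (bit_length n) * real (bit_length n)) \<le> real n * ((2 * l) * (2 * l))"
    using l by (intro mult_mono) auto
  also have "\<dots> = 4 * (real n * l\<^sup>2)" by (simp add: power2_eq_square)
  finally have "real n * (real (bit_length n) * real (bit_length n)) \<le> 4 * (real n * l\<^sup>2)" .
  moreover have "real n * 1 \<le> real n * l\<^sup>2" using l by (intro mult_left_mono) auto
  moreover have "1 \<le> real n" using False by simp
  ultimately have "real (n * (bit_length n * bit_length n) + n + 1) \<le> 6 * (real n * l\<^sup>2)"
    unfolding of_nat_add of_nat_mult of_nat_1 by linarith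
  then show ?thesis unfolding l_def by linarith
qed

section \<open>Totals, word sizes and the two algorithms for one character\<close>

lemma computesI:
  "wp T ((int (length S) + 2) ^ k) P I (\<lambda>t s'. R s' \<and> real t \<le> C * max 1 b) \<Longrightarrow> computes T k C P S I b R"
  unfolding computes_def wp_def by blast

text \<open>The index expression \<open>e\<close> allows summation over all positions or over the
  occurrences only. The latter keeps the time independent of n, as the quadratic bound in the number
  of occurrences requires.\<close>

definition sum_loop :: "name \<Rightarrow> expr \<Rightarrow> expr \<Rightarrow> com" where
  "sum_loop x hi e = for_loop x (Const 1) hi (''total'' ::= Var ''total'' \<oplus> Read ''cnt'' e)"

lemma wp_sum_loop:
  assumes total: "vars s ''total'' = 0" and x: "x \<noteq> ''total''"
    and hi: "\<And>i s'. frame (sum_loop x hi e) s s' \<Longrightarrow> vars s' x = int i \<Longrightarrow> 1 \<le> i \<Longrightarrow>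
      safe W s' hi \<and> val s' hi = int (Suc m)"
    and e: "\<And>i s'. frame (sum_loop x hi e) s s' \<Longrightarrow> vars s' x = int i \<Longrightarrow> 1 \<le> i \<Longrightarrow> i \<le> m \<Longrightarrow>
      safe W s' e \<and> val s' e = j i"
    and g: "\<And>i. 1 \<le> i \<Longrightarrow> i \<le> m \<Longrightarrow> arrs s ''cnt'' (j i) = int (g i)"
    and W: "(\<Sum>i=1..m. g i) \<le> M" "int M \<le> W" "int m + 1 \<le> W"
  shows "wp T W (sum_loop x hi e) s (\<lambda>t s'. t \<le> m * (cost e + cost hi + 12) + cost hi + 5 \<and>
     vars s' ''total'' = int (\<Sum>i=1..m. g i) \<and> arrs s' = arrs s)"
  unfolding sum_loop_def
proof (rule wp_for_loop[where l = 1 and h = "Suc m" and B = "\<lambda>_. cost e + 4" and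
    I = "\<lambda>i s'. vars s' ''total'' = int (\<Sum>i=1..<i. g i)"], goal_cases)
  case (9 i s')
  then have i: "1 \<le> i" "i \<le> m" by auto
  have fr: "frame (sum_loop x hi e) s s'" using 9 by (simp add: sum_loop_def)
  have le: "(\<Sum>i=1..<k. g i) \<le> M" if "k \<le> Suc m" for k
  proof -
    have "(\<Sum>i=1..<k. g i) \<le> (\<Sum>i=1..m. g i)" using that by (intro sum_mono2) auto
    then show ?thesis using W by simp
  qed
  have gi: "int (\<Sum>i=1..<i. g i) + int (g i) = int (\<Sum>i=1..<Suc i. g i)" using i by simp
  have gW: "g i \<le> M" using le[of "Suc i"] i by simp
  have b: "\<bar>int (\<Sum>i=1..<i. g i)\<bar> \<le> W" "\<bar>int (\<Sum>i=1..<Suc i. g i)\<bar> \<le> W" "\<bar>int (g i)\<bar> \<le> W"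
    using le[of i] le[of "Suc i"] gW i W by linarith+
  have c: "arrs s' ''cnt'' (val s' e) = int (g i)" "safe W s' e"
    using fr e[OF fr 9(5) i] g[OF i] by (simp_all add: frame_def sum_loop_def)
  show ?case by (simp only: run_simps 9(3) b c gi) (simp add: x[symmetric])
next
  case (10 t s')
  then show ?case by (auto simp: frame_def atLeastLessThanSuc_atLeastAtMost algebra_simps)
qed (use assms in \<open>auto simp: sum_loop_def frame_def\<close>)

definition sum_prog :: com where
  "sum_prog = (''total'' ::= Const 0;; sum_loop ''z'' (Var ''n'' \<oplus> Const 1) (Var ''z''))"

lemma wp_sum_prog:
  assumes n: "vars s ''n'' = int n"
    and g: "\<And>z. 1 \<le> z \<Longrightarrow> z \<le> n \<Longrightarrow> arrs s ''cnt'' (int z) = int (g z)" "\<And>z. g z \<le> n"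
    and W: "int n * int n \<le> W" "int n + 2 \<le> W"
  shows "wp T W sum_prog s (\<lambda>t s'. t \<le> 16 * n + 20 \<and>
     vars s' ''total'' = int (\<Sum>i=1..n. g i) \<and> arrs s' = arrs s)"
proof -
  let ?s = "set_var ''total'' 0 s"
  have "wp T W (sum_loop ''z'' (Var ''n'' \<oplus> Const 1) (Var ''z'')) ?s (\<lambda>t s'.
     t \<le> n * (cost (Var ''z'') + cost (Var ''n'' \<oplus> Const 1) + 12) + cost (Var ''n'' \<oplus> Const 1) + 5 \<and>
     vars s' ''total'' = int (\<Sum>i=1..n. g i) \<and> arrs s' = arrs ?s)"
  proof (rule wp_sum_loop[where j = int and M = "n * n"])
    have "(\<Sum>i=1..n. g i) \<le> (\<Sum>i=1..n. n)" by (intro sum_mono g)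
    then show "(\<Sum>i=1..n. g i) \<le> n * n" by simp
  qed (use n g W in \<open>auto simp: frame_def sum_loop_def\<close>)
  then have "wp T W (sum_loop ''z'' (Var ''n'' \<oplus> Const 1) (Var ''z'')) ?s (\<lambda>t s'.
     2 + t \<le> 16 * n + 20 \<and> vars s' ''total'' = int (\<Sum>i=1..n. g i) \<and> arrs s' = arrs s)"
    by (rule wp_mono) auto
  then show ?thesis using W by (simp add: sum_prog_def wp_Seq wp_Assign)
qed

text \<open>The exponent \<open>a + 10\<close>: as n + 2 \<ge> 2, seven powers exceed 64 and pay for
  constant factors, and three more cover cubic products such as n lg lg. The power
  \<open>a + 3\<close> covers the addresses of buckets.\<close>

lemma word_bounds:
  fixes n a :: nat
  defines "N \<equiv> int n + 2" and "W \<equiv> (int n + 2) ^ (a + 10)"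
  shows "N ^ (a + 3) \<le> W" "64 * N ^ 3 \<le> W" "64 * N ^ 2 \<le> W" "64 * N \<le> W" "N ^ a \<le> W" "int n * int n \<le> W"
proof -
  have N: "2 \<le> N" by (simp add: N_def)
  show "N ^ (a + 3) \<le> W" "N ^ a \<le> W"
    using N unfolding W_def N_def[symmetric] by (auto intro!: power_increasing)
  have "2 ^ 7 \<le> N ^ 7" using N by (rule power_mono) simp
  then have "64 \<le> N ^ 7" by simp
  then have "64 * N ^ 3 \<le> N ^ 7 * N ^ 3" using N by (intro mult_right_mono) auto
  also have "\<dots> = N ^ 10" by (simp flip: power_add)
  also have "\<dots> \<le> W" using N unfolding W_def N_def[symmetric] by (intro power_increasing) auto
  finally show *: "64 * N ^ 3 \<le> W" .
  have "N ^ 2 \<le> N ^ 3" "N ^ 1 \<le> N ^ 3" using N by (intro power_increasing; simp)+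
  with * show **: "64 * N ^ 2 \<le> W" "64 * N \<le> W" by auto
  have "int n * int n \<le> N ^ 2" unfolding power2_eq_square N_def by (intro mult_mono) auto
  then show "int n * int n \<le> W" using **(1) zero_le_power2[of N] by linarith
qed

lemma string_over_bounds:
  assumes "string_over a \<Sigma> S"
  shows "\<bar>array_of S j\<bar> \<le> (int (length S) + 2) ^ a" "\<sigma> \<in> \<Sigma> \<Longrightarrow> \<bar>\<sigma>\<bar> \<le> (int (length S) + 2) ^ a"
proof -
  show *: "\<sigma> \<in> \<Sigma> \<Longrightarrow> \<bar>\<sigma>\<bar> \<le> (int (length S) + 2) ^ a" for \<sigma> using assms by (simp add: string_over_def)
  have "array_of S j = 0 \<or> array_of S j \<in> set S"
    by (auto simp: array_of_def)
  then have "array_of S j = 0 \<or> array_of S j \<in> \<Sigma>" using assms by (auto simp: string_over_def)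
  then show "\<bar>array_of S j\<bar> \<le> (int (length S) + 2) ^ a" using *[of "array_of S j"] by auto
qed

lemma count_with_correct:
  assumes D: "\<And>p. 1 \<le> p \<Longrightarrow> T (2 ^ p) \<le> D * (2 ^ p * p)"
    and S: "string_over a \<Sigma> S" "\<sigma> \<in> \<Sigma>"
  shows "computes T (a + 10) (6 * (950 + 8 * real D)) (conv_prog;; sum_prog) S
          (input [(''n'', int (length S)), (''sigma'', \<sigma>)] [(''S'', S)])
          (real (length S) * (log 2 (real (length S)))\<^sup>2)
          (counted (length S) (cadences3_with \<sigma> S))"
proof (rule computesI)
  let ?n = "length S" and ?W = "(int (length S) + 2) ^ (a + 10)"
  let ?s = "input [(''n'', int (length S)), (''sigma'', \<sigma>)] [(''S'', S)]"
  let ?m = "bit_length ?n"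
  note Wb = word_bounds[where n = ?n and a = a]
  have fits: "fits ?W (array_of S) ?n \<sigma> ?s"
    using string_over_bounds[OF S(1)] S(2) Wb(4,5) by (force simp: fits_def input_def lookup0_def intro: order_trans)
  have cnt: "arrs ?s ''cnt'' z = 0" for z by (simp add: input_def)
  let ?g = "\<lambda>z. card (ending_at z (cadences3_with \<sigma> S))"
  \<comment> \<open>Cut off outside the string, so that the formula by \<open>starts\<close> and the
    bound by the length hold for every \<open>z\<close>.\<close>
  define g where "g z = (if z \<in> {1..?n} then ?g z else 0)" for z
  have g_eq: "g z = (if int z \<in> occs (array_of S) ?n \<sigma> then card (starts (array_of S) ?n \<sigma> (int z)) else 0)" for z
    by (auto simp: g_def card_ending_at_with) (auto simp: occs_def)
  have le: "g z \<le> ?n" for z unfolding g_eq by (simp add: card_starts)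
  have total: "card (cadences3_with \<sigma> S) = (\<Sum>i=1..?n. g i)"
    unfolding card_eq_sum_ending_at[OF cadences3_with_subset] by (rule sum.cong) (auto simp: g_def)
  have W2: "int ?n * int ?n \<le> ?W" "int ?n + 2 \<le> ?W"
    using Wb(4,6) by auto
  show "wp T ?W (conv_prog;; sum_prog) ?s (\<lambda>t s'. counted ?n (cadences3_with \<sigma> S) s' \<and>
      real t \<le> 6 * (950 + 8 * real D) * max 1 (real ?n * (log 2 (real ?n))\<^sup>2))"
    unfolding wp_Seq
  proof (rule wp_mono[OF wp_conv_prog[OF fits less_bit_length bit_length_le D]], goal_cases)
    case (3 z)
    then show ?case using Wb(4) by (simp add: cnt)
  next
    case (4 t s')
    have n': "vars s' ''n'' = int ?n" using 4(2)
      by (simp add: frame_def conv_prog_def conv_level_def input_def lookup0_def)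
    have cg: "arrs s' ''cnt'' (int z) = int (g z)" for z using 4(1) by (simp add: cnt g_eq)
    show ?case
    proof (rule wp_mono[OF wp_sum_prog[OF n' cg le W2]], goal_cases)
      case (1 t' s'')
      have "t + t' \<le> (900 + 8 * D) * (?n * (?m * ?m) + 1) + (16 * ?n + 20)" using 4(1) 1(1) by linarith
      also have "\<dots> \<le> (950 + 8 * D) * (?n * (?m * ?m) + ?n + 1)" by (simp add: algebra_simps)
      finally have "real (t + t') \<le> (950 + 8 * real D) * real (?n * (?m * ?m) + ?n + 1)"
        by (metis (mono_tags, opaque_lifting) of_nat_add of_nat_le_iff of_nat_mult of_nat_numeral)
      also have "\<dots> \<le> (950 + 8 * real D) * (6 * max 1 (real ?n * (log 2 (real ?n))\<^sup>2))"
        by (intro mult_left_mono conv_time_bound) simp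
      finally show ?case using 1(1) cg by (auto simp: counted_def total g_def algebra_simps)
    qed
  qed auto
qed

definition count_quad_prog :: com where
  "count_quad_prog = (quad_prog;;
     sum_loop ''q'' (Var ''nsigma'' \<oplus> Const 1) (Read ''occ'' (Var ''q'')))"

lemma count_quad_correct:
  assumes S: "string_over a \<Sigma> S" "\<sigma> \<in> \<Sigma>" and occ: "distinct occ" "set occ = occurrences \<sigma> S"
  shows "computes T (a + 10) 1000 count_quad_prog S
          (input [(''n'', int (length S)), (''sigma'', \<sigma>), (''nsigma'', int (length occ))]
                 [(''S'', S), (''occ'', map int occ)])
          ((real (card (occurrences \<sigma> S)))\<^sup>2)
          (counted (length S) (cadences3_with \<sigma> S))"
proof (rule computesI)
  let ?n = "length S" and ?W = "(int (length S) + 2) ^ (a + 10)" and ?f = "array_of S"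
  let ?s = "input [(''n'', int (length S)), (''sigma'', \<sigma>), (''nsigma'', int (length occ))]
                 [(''S'', S), (''occ'', map int occ)]"
  let ?m = "length occ"
  define h where "h i = occ ! (i - 1)" for i
  have h: "bij_betw h {1..?m} (occurrences \<sigma> S)"
    unfolding occ(2)[symmetric] h_def
  proof (rule bij_betw_trans[OF _ bij_betw_nth[OF occ(1) refl refl], unfolded comp_def])
    show "bij_betw (\<lambda>i. i - 1) {1..?m} {..<?m}"
      by (rule bij_betw_byWitness[where f' = Suc]) auto
  qed
  have occ_arr: "arrs ?s ''occ'' (int i) = int (h i)" if "1 \<le> i" "i \<le> ?m" for i
    using that by (simp add: input_def array_of_def h_def nat_diff_distrib)
  note Wb = word_bounds[where n = ?n and a = a]
  have fb: "\<bar>?f j\<bar> \<le> ?W" "\<bar>\<sigma>\<bar> \<le> ?W" for j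
    using string_over_bounds[OF S(1)] S(2) Wb(5) by (blast intro: order_trans)+
  have cnt: "arrs ?s ''cnt'' z = 0" for z by (simp add: input_def)
  \<comment> \<open>\<open>base\<close> is not among the inputs and therefore starts as 0, the
    offset of the given list.\<close>
  have bij: "bij_betw (\<lambda>p. arrs ?s ''occ'' (0 + int p)) {1..?m} (occs ?f ?n \<sigma>)"
  proof -
    have "bij_betw (\<lambda>p. int (h p)) {1..?m} (occs ?f ?n \<sigma>)"
      unfolding occs_array_of by (rule bij_betw_trans[OF h, unfolded comp_def]) (simp add: bij_betw_def)
    then show ?thesis by (rule bij_betw_cong[THEN iffD1, rotated]) (simp add: occ_arr)
  qed
  have mn: "?m \<le> ?n"
  proof -
    have "?m = card (occurrences \<sigma> S)" using bij_betw_same_card[OF h] by simp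
    also have "\<dots> \<le> card {1..?n}" by (rule card_mono) (auto simp: occurrences_def)
    finally show ?thesis by simp
  qed
  let ?g = "\<lambda>z. card (ending_at z (cadences3_with \<sigma> S))"
  have h_in: "h i \<in> occurrences \<sigma> S" "1 \<le> h i" "h i \<le> ?n" if "1 \<le> i" "i \<le> ?m" for i
    using bij_betwE[OF h] that by (auto simp: occurrences_def)
  have h_occs: "int (h i) \<in> occs ?f ?n \<sigma>" if "1 \<le> i" "i \<le> ?m" for i
    unfolding occs_array_of using h_in(1)[OF that] by blast
  have total: "card (cadences3_with \<sigma> S) = (\<Sum>i=1..?m. ?g (h i))"
  proof -
    have "card (cadences3_with \<sigma> S) = (\<Sum>z=1..?n. ?g z)" by (rule card_eq_sum_ending_at[OF cadences3_with_subset])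
    \<comment> \<open>Only occurrences can be end positions, so the total needs no pass over the
      whole string.\<close>
    also have "\<dots> = (\<Sum>z\<in>occurrences \<sigma> S. ?g z)"
      by (rule sum.mono_neutral_right)
        (auto simp: occurrences_def card_ending_at_with occs_def array_of_char_at split: if_splits)
    also have "\<dots> = (\<Sum>i=1..?m. ?g (h i))" by (rule sum.reindex_bij_betw[OF h, symmetric])
    finally show ?thesis .
  qed
  show "wp T ?W count_quad_prog ?s (\<lambda>t s'. counted ?n (cadences3_with \<sigma> S) s' \<and>
      real t \<le> 1000 * max 1 ((real (card (occurrences \<sigma> S)))\<^sup>2))"
    unfolding count_quad_prog_def wp_Seq
  proof (rule wp_mono[OF wp_quad_prog[where m = ?m and n = ?n and f = ?f and \<sigma> = \<sigma> and B = 0]], goal_cases)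
    case (12 t s')
    have fr: "vars s' ''nsigma'' = int ?m" "arrs s' ''occ'' = arrs ?s ''occ''" "vars s' ''total'' = 0" "vars s' ''n'' = int ?n"
      using 12(2) by (simp_all add: frame_def quad_prog_def input_def lookup0_def)
    have cg: "arrs s' ''cnt'' (int z) = int (?g z)" if "1 \<le> z" "z \<le> ?n" for z
      using 12(1) that by (simp add: cnt card_ending_at_with)
    let ?l = "sum_loop ''q'' (Var ''nsigma'' \<oplus> Const 1) (Read ''occ'' (Var ''q''))"
    have "wp T ?W ?l s' (\<lambda>t s''. t \<le> ?m * (cost (Read ''occ'' (Var ''q'')) + cost (Var ''nsigma'' \<oplus> Const 1) + 12) +
        cost (Var ''nsigma'' \<oplus> Const 1) + 5 \<and>
     vars s'' ''total'' = int (\<Sum>i=1..?m. ?g (h i)) \<and> arrs s'' = arrs s')"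
    proof (rule wp_sum_loop[where j = "\<lambda>i. int (h i)" and M = "?n * ?n"], goal_cases)
      case (3 i s'')
      then show ?case using fr mn Wb(4) by (auto simp: frame_def sum_loop_def)
    next
      case (4 i s'')
      then show ?case using fr mn Wb(4) h_in(3)[of i] by (auto simp: frame_def sum_loop_def occ_arr)
    next
      case (6)
      have "?g (h i) \<le> ?n" if "1 \<le> i" "i \<le> ?m" for i
        using h_in[OF that] by (simp add: card_ending_at_with card_starts)
      then have "(\<Sum>i=1..?m. ?g (h i)) \<le> (\<Sum>i=1..?m. ?n)" by (intro sum_mono) auto
      also have "\<dots> \<le> ?n * ?n" using mn by simp
      finally show ?case .
    next
      case 7
      then show ?case using Wb(6) by simp
    qed (use fr cg h_in mn Wb(4) in auto)
    then show ?case
    proof (rule wp_mono, goal_cases)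
      case (1 t' s'')
      have "t + t' \<le> 200 * (?m * ?m + 1) + (?m * 17 + 8)" using 12(1) 1(1) by simp
      also have "\<dots> \<le> 500 * (?m * ?m + 1)" by (cases ?m) simp_all
      finally have "real (t + t') \<le> real (500 * (?m * ?m + 1))" by (rule of_nat_mono)
      also have "\<dots> \<le> 1000 * max 1 ((real (card (occurrences \<sigma> S)))\<^sup>2)"
        using bij_betw_same_card[OF h] by (simp add: power2_eq_square)
      finally show ?case using 1(1) cg by (auto simp: counted_def total)
    qed
  qed (use bij fb mn cnt Wb(4) in \<open>auto simp: input_def lookup0_def\<close>)
qed

section \<open>Counting the cadences with all characters\<close>

text \<open>
  Characters are small enough to be addresses: cell \<open>c * (n + 1) + p\<close> of \<open>occ\<close> holds the \<open>p\<close>-th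
  occurrence of \<open>c\<close>, so that no sorting is needed.
\<close>

definition bucket_prog :: com where
  "bucket_prog = for_loop ''j'' (Const 1) (Var ''n'' \<oplus> Const 1)
    (''c'' ::= Read ''S'' (Var ''j'');;
     Store ''num'' (Var ''c'') (Read ''num'' (Var ''c'') \<oplus> Const 1);;
     Store ''occ'' (Var ''c'' \<otimes> (Var ''n'' \<oplus> Const 1) \<oplus> Read ''num'' (Var ''c'')) (Var ''j''))"

lemma wp_bucket_prog:
  assumes s: "vars s ''n'' = int n" "arrs s ''S'' = f" "\<And>c. arrs s ''num'' c = 0"
    and f: "\<And>j. \<bar>f j\<bar> \<le> (int n + 2) ^ a"
    and W: "(int n + 2) ^ (a + 3) \<le> W"
  shows "wp T W bucket_prog s (\<lambda>t s'. t \<le> 40 * n + 10 \<and> (\<forall>c. arrs s' ''num'' c = int (card (occs f n c)) \<and>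
     bij_betw (\<lambda>p. arrs s' ''occ'' (c * (int n + 1) + int p)) {1..card (occs f n c)} (occs f n c)))"
proof -
  define N where "N = int n + 2"
  define P where "P i c = {x. 1 \<le> x \<and> x < int i \<and> f x = c}" for i c
  have finP: "finite (P i c)" for i c by (rule finite_subset[of _ "{1..int i}"]) (auto simp: P_def)
  have P1: "P (Suc 0) c = {}" for c by (auto simp: P_def)
  have Pn: "P (Suc n) c = occs f n c" for c by (auto simp: P_def occs_def)
  have cardP: "card (P i c) \<le> i - 1" for i c
  proof -
    have "card (P i c) \<le> card {1..int i - 1}" by (rule card_mono) (auto simp: P_def)
    then show ?thesis by simp
  qed
  have N: "2 \<le> N" "int n + 1 \<le> N" by (simp_all add: N_def)
  have Na: "1 \<le> N ^ a" using N by simp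
  have Wb: "N ^ a * (8 * 1) \<le> W" "N ^ a * (N * N) \<le> W" "N * 2 \<le> W"
  proof -
    have *: "N ^ a * (N * (N * N)) \<le> W" using W by (simp add: N_def[symmetric] power_add power3_eq_cube)
    have NN: "2 * 2 \<le> N * N" "2 * N \<le> N * N" using N by (intro mult_mono; simp)+
    have NNN: "2 * (2 * 2) \<le> N * (N * N)" "1 * (N * N) \<le> N * (N * N)" using N NN by (intro mult_mono; simp)+
    have "N ^ a * (8 * 1) \<le> N ^ a * (N * (N * N))" "N ^ a * (N * N) \<le> N ^ a * (N * (N * N))"
      using mult_left_mono[OF NNN(1), of "N ^ a"] mult_left_mono[OF NNN(2), of "N ^ a"] Na by simp_all
    with * show "N ^ a * (8 * 1) \<le> W" "N ^ a * (N * N) \<le> W" by linarith+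
    have "1 * (N * N) \<le> N ^ a * (N * N)" using Na by (intro mult_right_mono) simp_all
    with \<open>N ^ a * (N * N) \<le> W\<close> NN show "N * 2 \<le> W" by linarith
  qed
  have fW: "\<bar>f x\<bar> \<le> W" for x using f[of x] Wb(1) Na unfolding N_def by linarith
  have addr: "\<bar>f x * (int n + 1)\<bar> \<le> N ^ a * (int n + 1)" for x
    unfolding abs_mult using f[of x] unfolding N_def by (intro mult_mono) auto
  have addr_le: "N ^ a * (int n + 1) + (int n + 1) \<le> W"
  proof -
    have "N ^ a * (int n + 1) + 1 * (int n + 1) \<le> N ^ a * (int n + 1) + N ^ a * (int n + 1)"
      using Na by (intro add_mono mult_right_mono) auto
    also have "\<dots> = N ^ a * (2 * (int n + 1))" by simp
    also have "\<dots> \<le> N ^ a * (N * N)" using N by (intro mult_left_mono mult_mono) auto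
    finally show ?thesis using Wb(2) by simp
  qed
  \<comment> \<open>Division by n + 1 recovers the character, also a negative one, because 0 \<le> p
    \<le> n. Hence the buckets do not overlap, and an insertion leaves all other buckets
    intact.\<close>
  have addr_inj: "c = c' \<and> p = p'" if "c * (int n + 1) + int p = c' * (int n + 1) + int p'" "p \<le> n" "p' \<le> n" for c c' p p'
  proof -
    have "(c * (int n + 1) + int p) div (int n + 1) = c" "(c' * (int n + 1) + int p') div (int n + 1) = c'"
      using that(2,3) by simp_all
    with that(1) have "c = c'" by metis
    with that(1) show ?thesis by simp
  qed
  show ?thesis
    unfolding bucket_prog_def
  proof (rule wp_for_loop[where l = 1 and h = "Suc n" and B = "\<lambda>_. 24" and I = "\<lambda>i s'. \<forall>c. arrs s' ''num'' c = int (card (P i c)) \<and>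
     bij_betw (\<lambda>p. arrs s' ''occ'' (c * (int n + 1) + int p)) {1..card (P i c)} (P i c)"], goal_cases)
    case (9 i s')
    define c where "c = f (int i)"
    define k where "k = card (P i c)"
    have i: "1 \<le> i" "i \<le> n" using 9 by auto
    have * : "vars s' ''n'' = int n" "arrs s' ''S'' = f" "arrs s' ''num'' c = int k" "f (int i) = c"
      using s 9 by (simp_all add: frame_def c_def k_def)
    have k: "k + 1 \<le> i" using cardP[of i c] i by (simp add: k_def)
    have b: "\<bar>int i\<bar> \<le> W" "\<bar>c\<bar> \<le> W" "\<bar>int n\<bar> \<le> W" "\<bar>int n + 1\<bar> \<le> W" "\<bar>int k\<bar> \<le> W" "\<bar>int k + 1\<bar> \<le> W"
      "\<bar>c * (int n + 1)\<bar> \<le> W" "\<bar>c * (int n + 1) + (int k + 1)\<bar> \<le> W" "1 \<le> W"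
      using fW[of "int i"] addr[of "int i"] addr_le i k Wb(3) N unfolding c_def by linarith+
    have Pc: "P (Suc i) c = insert (int i) (P i c)" using i by (auto simp: P_def c_def)
    have Pd: "P (Suc i) d = P i d" if "d \<noteq> c" for d
    proof -
      have "x < int (Suc i) \<longleftrightarrow> x < int i \<or> x = int i" for x by auto
      then show ?thesis using that by (auto simp only: P_def c_def)
    qed
    have notin: "int i \<notin> P i c" by (simp add: P_def)
    have card_c: "card (P (Suc i) c) = k + 1" using notin finP by (simp add: Pc k_def)
    have inv: "(if d = c then int k + 1 else arrs s' ''num'' d) = int (card (P (Suc i) d)) \<and>
       bij_betw (\<lambda>p. if d * (int n + 1) + int p = c * (int n + 1) + (int k + 1) then int i
         else arrs s' ''occ'' (d * (int n + 1) + int p)) {1..card (P (Suc i) d)} (P (Suc i) d)" for d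
    proof (cases "d = c")
      case True
      have old: "bij_betw (\<lambda>p. arrs s' ''occ'' (c * (int n + 1) + int p)) {1..k} (P i c)"
        using 9(3) by (simp add: k_def)
      have "bij_betw (\<lambda>p. if c * (int n + 1) + int p = c * (int n + 1) + (int k + 1) then int i
         else arrs s' ''occ'' (c * (int n + 1) + int p)) {1..k} (P i c)"
        by (rule bij_betw_cong[THEN iffD1, OF _ old]) auto
      then have "bij_betw (\<lambda>p. if c * (int n + 1) + int p = c * (int n + 1) + (int k + 1) then int i
         else arrs s' ''occ'' (c * (int n + 1) + int p)) ({1..k} \<union> {k + 1}) (P i c \<union> {int i})"
        using notIn_Un_bij_betw[of "k + 1" "{1..k}" "\<lambda>p. if c * (int n + 1) + int p = c * (int n + 1) + (int k + 1) then int i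
         else arrs s' ''occ'' (c * (int n + 1) + int p)" "P i c"] notin by simp
      moreover have "{1..k} \<union> {k + 1} = {1..k + 1}" by auto
      ultimately show ?thesis unfolding True using card_c Pc by simp
    next
      case False
      have old: "bij_betw (\<lambda>p. arrs s' ''occ'' (d * (int n + 1) + int p)) {1..card (P i d)} (P i d)"
        using 9(3) by simp
      have "d * (int n + 1) + int p \<noteq> c * (int n + 1) + (int k + 1)" if "p \<in> {1..card (P i d)}" for p
      proof -
        have "p \<le> i - 1" using that cardP[of i d] by (auto intro: le_trans)
        then have "p \<le> n" using i by linarith
        then show ?thesis using addr_inj[of d p c "k + 1"] False i k by auto
      qed
      then have "bij_betw (\<lambda>p. if d * (int n + 1) + int p = c * (int n + 1) + (int k + 1) then int i
         else arrs s' ''occ'' (d * (int n + 1) + int p)) {1..card (P i d)} (P i d)"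
        by (intro bij_betw_cong[THEN iffD1, OF _ old]) auto
      then show ?thesis using False Pd 9(3) by simp
    qed
    show ?case
      by (simp only: run_simps * 9(5) b) (use inv in simp)
  next
    case (10 t s')
    then show ?case by (simp add: Pn)
  qed (use s Wb N in \<open>auto simp: frame_def P1 bij_betw_def\<close>)
qed

section \<open>Choosing the cheaper method for each character\<close>

definition log_prog :: com where
  "log_prog = (''L'' ::= Const 1;; ''lg'' ::= Const 0;;
     While (Var ''L'' \<prec> Var ''n'' \<oplus> Const 1) (''L'' ::= Const 2 \<otimes> Var ''L'';; ''lg'' ::= Var ''lg'' \<oplus> Const 1))"

lemma less_two_power_bit_length: "2 ^ bit_length n \<le> 2 * n + 1"
  using bit_length_le[of "bit_length n - 1" n] by (cases "bit_length n") auto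

lemma bit_length_le_self: "bit_length n \<le> n"
  unfolding bit_length_def by (rule Least_le) simp

lemma wp_log_prog:
  assumes s: "vars s ''n'' = int n" and W: "32 * (int n + 2) \<le> W"
  shows "wp T W log_prog s (\<lambda>t s'. t \<le> 20 * n + 20 \<and> vars s' ''lg'' = int (bit_length n))"
proof -
  let ?c = "''L'' ::= Const 2 \<otimes> Var ''L'';; ''lg'' ::= Var ''lg'' \<oplus> Const 1"
  let ?s = "set_var ''lg'' 0 (set_var ''L'' 1 s)"
  have "wp T W (While (Var ''L'' \<prec> Var ''n'' \<oplus> Const 1) ?c) ?s
     (\<lambda>t s'. t + 4 \<le> 20 * n + 20 \<and> vars s' ''lg'' = int (bit_length n))"
  proof (rule wp_While[where N = "bit_length n" and B = "\<lambda>_. 8" and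
      I = "\<lambda>i s'. vars s' ''L'' = int (2 ^ i) \<and> vars s' ''lg'' = int i"], goal_cases)
    case (2 i s')
    define L :: nat where "L = 2 ^ i"
    have L: "L \<le> n" "1 \<le> L" using bit_length_le[OF 2(1)] by (simp_all add: L_def)
    have i: "i < n" using 2(1) bit_length_le_self[of n] by simp
    have v: "vars s' ''L'' = int L" "vars s' ''lg'' = int i" "vars s' ''n'' = int n"
      using 2 s by (auto simp: L_def frame_def)
    have b: "\<bar>int i\<bar> \<le> W" "\<bar>int i + 1\<bar> \<le> W" "\<bar>int L\<bar> \<le> W" "\<bar>2 * int L\<bar> \<le> W" "\<bar>int n\<bar> \<le> W" "\<bar>int n + 1\<bar> \<le> W" "1 \<le> W" "2 \<le> W"
      using W L i by auto
    show ?case using L by (simp only: run_simps v b) (simp add: L_def)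
  next
    case (3 s')
    define L :: nat where "L = 2 ^ bit_length n"
    have L: "L \<le> 2 * n + 1" "n < L" using less_two_power_bit_length less_bit_length by (simp_all add: L_def)
    have v: "vars s' ''L'' = int L" "vars s' ''n'' = int n"
      using 3 s by (auto simp: L_def frame_def)
    show ?case using L W by (simp add: v safe_ops)
  next
    case (4 t s')
    then show ?case using bit_length_le_self[of n] by simp
  qed simp_all
  then show ?thesis using W by (simp add: log_prog_def wp_simps)
qed

definition choose_prog :: com where
  "choose_prog = Cond (Var ''nsigma'' \<otimes> Var ''nsigma'' \<prec> Var ''n'' \<otimes> Var ''lg'' \<otimes> Var ''lg'') quad_prog conv_prog"

text \<open>The loop runs over positions because the alphabet is not part of the input;
  \<open>done\<close> restricts the counting to the first occurrence of each character.\<close>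

definition chars_prog :: com where
  "chars_prog = for_loop ''j'' (Const 1) (Var ''n'' \<oplus> Const 1)
    (''sigma'' ::= Read ''S'' (Var ''j'');;
     Cond (Read ''done'' (Var ''sigma'')) Skip
      (Store ''done'' (Var ''sigma'') (Const 1);;
       ''nsigma'' ::= Read ''num'' (Var ''sigma'');;
       ''base'' ::= Var ''sigma'' \<otimes> (Var ''n'' \<oplus> Const 1);;
       choose_prog))"

lemma written_quad_conv [simp]:
  "written_vars quad_prog = {''q'', ''z'', ''p'', ''x''}" "written_arrs quad_prog = {''cnt''}"
  "written_vars conv_prog = {''L'', ''A'', ''z0'', ''k'', ''z''}" "written_arrs conv_prog = {''a'', ''b'', ''r'', ''cnt''}"
  by (auto simp: quad_prog_def conv_prog_def conv_level_def)

definition choice_cost :: "nat \<Rightarrow> nat \<Rightarrow> nat" where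
  "choice_cost n m = min (m * m) (n * (bit_length n * bit_length n))"

text \<open>The character occurs, so both candidate costs are at least 1 and doubling the constants
  absorbs their summand 1. The 10 is the price of the comparison.\<close>

lemma wp_choose_prog:
  assumes s: "fits W f n \<sigma> s" "vars s ''nsigma'' = int m" "vars s ''base'' = B" "vars s ''lg'' = int (bit_length n)"
    and occ: "bij_betw (\<lambda>p. arrs s ''occ'' (B + int p)) {1..m} (occs f n \<sigma>)"
    and m: "1 \<le> m" "m \<le> n"
    and D: "\<And>p. 1 \<le> p \<Longrightarrow> T (2 ^ p) \<le> D * (2 ^ p * p)"
    and W: "\<bar>B\<bar> + int n + 2 \<le> W" "int n ^ 3 \<le> W" "\<And>z. \<bar>arrs s ''cnt'' z\<bar> + 2 * int n \<le> W"
  shows "wp T W choose_prog s (\<lambda>t s'. t \<le> (1800 + 16 * D) * choice_cost n m + 10 \<and>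
    (\<forall>z. arrs s' ''cnt'' z = arrs s ''cnt'' z + (if z \<in> occs f n \<sigma> then int (card (starts f n \<sigma> z)) else 0)))"
proof -
  define l where "l = bit_length n"
  have l: "1 \<le> l" "l \<le> n" using m less_bit_length[of n] bit_length_le_self[of n]
    unfolding l_def by (cases "bit_length n"; simp)+
  have fW: "\<bar>\<sigma>\<bar> \<le> W" "\<And>j. \<bar>f j\<bar> \<le> W" "32 * (int n + 2) \<le> W" and v: "vars s ''n'' = int n" "vars s ''sigma'' = \<sigma>" "arrs s ''S'' = f"
    using s(1) by (auto simp: fits_def)
  have mono: "int x * int y \<le> int n * int n" "int n * int x * int y \<le> int n ^ 3" "int n * int x \<le> int n * int n"
    "int n * int n \<le> int n ^ 3"
    if "x \<le> n" "y \<le> n" for x y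
  proof -
    have "x * y \<le> n * n" "n * x * y \<le> n * n * n" "n * x \<le> n * n" "n * n * 1 \<le> n * n * n"
      using that m by (intro mult_le_mono; simp)+
    then have "int (x * y) \<le> int (n * n)" "int (n * x * y) \<le> int (n * n * n)" "int (n * x) \<le> int (n * n)"
      "int (n * n) \<le> int (n * n * n)" by (simp_all only: of_nat_le_iff)
    then show "int x * int y \<le> int n * int n" "int n * int x * int y \<le> int n ^ 3" "int n * int x \<le> int n * int n"
      "int n * int n \<le> int n ^ 3" by (simp_all add: power3_eq_cube)
  qed
  have nl: "int n * int l \<le> W" using mono(3,4)[OF l(2) l(2)] W(2) by linarith
  have b: "\<bar>int m\<bar> \<le> W" "\<bar>int n\<bar> \<le> W" "\<bar>int l\<bar> \<le> W" "\<bar>int m * int m\<bar> \<le> W" "\<bar>int n * int l\<bar> \<le> W"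
    "\<bar>int n * int l * int l\<bar> \<le> W" "1 \<le> W"
    using mono[OF m(2) m(2)] mono[OF l(2) l(2)] nl m l fW W(2) by auto
  have c: "val s (Var ''nsigma'' \<otimes> Var ''nsigma'' \<prec> Var ''n'' \<otimes> Var ''lg'' \<otimes> Var ''lg'') =
      of_bool (m * m < n * l * l)"
    by (simp add: s v l_def flip: of_nat_mult)
  have sf: "safe W s (Var ''nsigma'' \<otimes> Var ''nsigma'' \<prec> Var ''n'' \<otimes> Var ''lg'' \<otimes> Var ''lg'')"
    by (simp only: run_simps s v b l_def[symmetric])
  show ?thesis
  proof (cases "m * m < n * l * l")
    case True
    have "wp T W quad_prog s (\<lambda>t s'. t \<le> 200 * (m * m + 1) \<and>
    (\<forall>z. arrs s' ''cnt'' z = arrs s ''cnt'' z + (if z \<in> occs f n \<sigma> then int (card (starts f n \<sigma> z)) else 0)))"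
    proof (rule wp_quad_prog[OF v(1,2) s(2,3) v(3) occ fW(1,2) W(1)])
      show "\<bar>arrs s ''cnt'' z\<bar> + int n \<le> W" for z using W(3)[of z] by simp
    qed (use fW in simp)
    then have "wp T W quad_prog s (\<lambda>t s'. 10 + t \<le> (1800 + 16 * D) * choice_cost n m + 10 \<and>
    (\<forall>z. arrs s' ''cnt'' z = arrs s ''cnt'' z + (if z \<in> occs f n \<sigma> then int (card (starts f n \<sigma> z)) else 0)))"
    proof (rule wp_mono, goal_cases)
      case (1 t s')
      have cc: "choice_cost n m = m * m" using True by (simp add: choice_cost_def l_def ac_simps)
      have "t \<le> 200 * (m * m + 1)" using 1(1) by blast
      also have "\<dots> \<le> 400 * (m * m)" using m by simp
      also have "\<dots> \<le> (1800 + 16 * D) * (m * m)" by (intro mult_le_mono1) simp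
      finally have "10 + t \<le> (1800 + 16 * D) * choice_cost n m + 10" unfolding cc by simp
      then show ?case using 1(1) by blast
    qed
    then show ?thesis unfolding choose_prog_def wp_Cond c using True sf by (simp add: wp_mono)
  next
    case False
    have "wp T W conv_prog s (\<lambda>t s'. t \<le> (900 + 8 * D) * (n * (l * l) + 1) \<and>
    (\<forall>z. arrs s' ''cnt'' z = arrs s ''cnt'' z + (if z \<in> occs f n \<sigma> then int (card (starts f n \<sigma> z)) else 0)))"
      unfolding l_def by (rule wp_conv_prog[OF s(1) less_bit_length bit_length_le D W(3)])
    then have "wp T W conv_prog s (\<lambda>t s'. 10 + t \<le> (1800 + 16 * D) * choice_cost n m + 10 \<and>
    (\<forall>z. arrs s' ''cnt'' z = arrs s ''cnt'' z + (if z \<in> occs f n \<sigma> then int (card (starts f n \<sigma> z)) else 0)))"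
    proof (rule wp_mono, goal_cases)
      case (1 t s')
      have cc: "choice_cost n m = n * (l * l)" using False by (simp add: choice_cost_def l_def ac_simps)
      have "1 \<le> n * (l * l)" using m l by simp
      then have le: "n * (l * l) + 1 \<le> 2 * (n * (l * l))" by simp
      have "t \<le> (900 + 8 * D) * (n * (l * l) + 1)" using 1(1) by blast
      also have "\<dots> \<le> (900 + 8 * D) * (2 * (n * (l * l)))"
        using le by (rule mult_le_mono2)
      also have "\<dots> = (1800 + 16 * D) * choice_cost n m" unfolding cc by (simp add: algebra_simps)
      finally have "10 + t \<le> (1800 + 16 * D) * choice_cost n m + 10" by simp
      then show ?case using 1(1) by blast
    qed
    then show ?thesis unfolding choose_prog_def wp_Cond c using False sf by (simp add: wp_mono)
  qed
qed

text \<open>The counts for a character become complete all at once, when its first occurrence has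
  been processed; until then its cells are 0.\<close>

definition partial_count :: "(int \<Rightarrow> int) \<Rightarrow> nat \<Rightarrow> nat \<Rightarrow> int \<Rightarrow> nat" where
  "partial_count f n i z =
    (if 1 \<le> z \<and> z \<le> int n \<and> f z \<in> f ` {1..<int i} then card (starts f n (f z) z) else 0)"

lemma wp_chars_prog:
  fixes n :: nat
  assumes s: "vars s ''n'' = int n" "arrs s ''S'' = f" "vars s ''lg'' = int (bit_length n)"
      "\<And>c. arrs s ''num'' c = int (card (occs f n c))"
      "\<And>z. arrs s ''cnt'' z = 0" "\<And>c. arrs s ''done'' c = 0"
    and occ: "\<And>c. bij_betw (\<lambda>p. arrs s ''occ'' (c * (int n + 1) + int p)) {1..card (occs f n c)} (occs f n c)"
    and D: "\<And>p. 1 \<le> p \<Longrightarrow> T (2 ^ p) \<le> D * (2 ^ p * p)"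
    and W: "32 * (int n + 2) \<le> W" "int n ^ 3 \<le> W" "\<And>x. \<bar>f x\<bar> \<le> W" "\<And>x. \<bar>f x * (int n + 1)\<bar> + int n + 2 \<le> W"
  shows "wp T W chars_prog s (\<lambda>t s'.
    t \<le> 60 * n + 10 + (1800 + 16 * D) * (\<Sum>c\<in>f ` {1..int n}. choice_cost n (card (occs f n c))) \<and>
    (\<forall>z. arrs s' ''cnt'' z = int (partial_count f n (Suc n) z)))"
  unfolding chars_prog_def
proof (rule wp_for_loop[where l = 1 and h = "Suc n" and
   B = "\<lambda>i. 45 + (if f (int i) \<in> f ` {1..<int i} then 0 else (1800 + 16 * D) * choice_cost n (card (occs f n (f (int i)))))" and
   I = "\<lambda>i s'. (\<forall>z. arrs s' ''cnt'' z = int (partial_count f n i z)) \<and> (\<forall>c. arrs s' ''done'' c = of_bool (c \<in> f ` {1..<int i}))"], goal_cases)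
  case (9 i s')
  define c where "c = f (int i)"
  define m where "m = card (occs f n c)"
  have i: "1 \<le> i" "i \<le> n" using 9 by auto
  have v: "vars s' ''n'' = int n" "arrs s' ''S'' = f" "vars s' ''lg'' = int (bit_length n)"
    "arrs s' ''num'' c = int m" "f (int i) = c" "arrs s' ''occ'' = arrs s ''occ''"
    using 9 s by (simp_all add: frame_def choose_prog_def m_def c_def)
  have "finite (occs f n c)" by (rule finite_subset[of _ "{1..int n}"]) (auto simp: occs_def)
  moreover have "int i \<in> occs f n c" using i by (simp add: occs_def c_def)
  ultimately have m1: "1 \<le> m" unfolding m_def by (metis One_nat_def Suc_leI card_gt_0_iff empty_iff)
  have mn: "m \<le> n"
  proof -
    have "m \<le> card {1..int n}" unfolding m_def by (rule card_mono) (auto simp: occs_def)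
    then show ?thesis by simp
  qed
  have b: "\<bar>int i\<bar> \<le> W" "\<bar>c\<bar> \<le> W" "\<bar>int n\<bar> \<le> W" "\<bar>int n + 1\<bar> \<le> W" "\<bar>int m\<bar> \<le> W" "\<bar>c * (int n + 1)\<bar> \<le> W" "0 \<le> W" "1 \<le> W"
    "\<bar>of_bool d :: int\<bar> \<le> W" for d
    using i mn W(1,3) W(4)[of "int i"] by (auto simp: c_def)
  have img: "f ` {1..<int (Suc i)} = insert c (f ` {1..<int i})"
  proof -
    have "{1..<int (Suc i)} = insert (int i) {1..<int i}" using i by auto
    then show ?thesis by (simp add: c_def)
  qed
  show ?case
  proof (cases "c \<in> f ` {1..<int i}")
    case True
    then have "f ` {1..<int (Suc i)} = f ` {1..<int i}" by (simp only: img insert_absorb)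
    moreover have "arrs s' ''done'' c = 1" using 9(3) True by simp
    ultimately show ?thesis using 9(3)
      by (simp only: run_simps v 9(5) b c_def[symmetric] partial_count_def zero_neq_one one_neq_zero)
  next
    case False
    have d: "arrs s' ''done'' c = 0" using 9(3) False by simp
    let ?s = "set_var ''base'' (c * (int n + 1)) (set_var ''nsigma'' (int m) (set_arr ''done'' ((arrs s' ''done'')(c := 1)) (set_var ''sigma'' c s')))"
    \<comment> \<open>The character is new, so its end positions had count 0 and this one call
      supplies their full counts.\<close>
    have pc: "int (partial_count f n (Suc i) z) = int (partial_count f n i z) +
        (if z \<in> occs f n c then int (card (starts f n c z)) else 0)" for z
      unfolding partial_count_def img using False by (auto simp: occs_def)
    have pc_le: "partial_count f n i z \<le> n" for z by (simp add: partial_count_def card_starts)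
    have "wp T W choose_prog ?s (\<lambda>t s''. t \<le> (1800 + 16 * D) * choice_cost n m + 10 \<and>
      (\<forall>z. arrs s'' ''cnt'' z = arrs ?s ''cnt'' z + (if z \<in> occs f n c then int (card (starts f n c z)) else 0)))"
    proof (rule wp_choose_prog[OF _ _ _ _ _ m1 mn D, where B = "c * (int n + 1)"])
      show "\<bar>arrs ?s ''cnt'' z\<bar> + 2 * int n \<le> W" for z
      proof -
        have eq: "arrs ?s ''cnt'' z = int (partial_count f n i z)" using 9(3) by simp
        show ?thesis unfolding eq using pc_le[of z] W(1) by simp
      qed
    qed (use v occ[of c] W W(4)[of "int i"] b in \<open>auto simp: fits_def m_def\<close>)
    then have "wp T W choose_prog ?s (\<lambda>t s''. t + 35 \<le> 45 + (1800 + 16 * D) * choice_cost n m \<and>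
       (\<forall>z. arrs s'' ''cnt'' z = int (partial_count f n (Suc i) z)) \<and>
       (\<forall>d. arrs s'' ''done'' d = of_bool (d \<in> f ` {1..<int (Suc i)})))"
    proof (rule wp_mono, goal_cases)
      case (1 t s'')
      have "arrs s'' ''done'' = (arrs s' ''done'')(c := 1)" using 1(2) by (simp add: frame_def choose_prog_def)
      then show ?case using 1(1) 9(3) unfolding pc img by auto
    qed
    then show ?thesis using False
      by (simp only: run_simps v 9(5) b d of_bool_eq) (erule wp_mono, simp add: m_def)
  qed
next
  case (10 t s')
  \<comment> \<open>Only first occurrences pay for counting, so the sum over positions collapses to
    a sum over distinct characters.\<close>
  have "(\<Sum>i=1..<Suc k. if f (int i) \<in> f ` {1..<int i} then 0 else F (f (int i))) = (\<Sum>c\<in>f ` {1..int k}. F c)" for k and F :: "int \<Rightarrow> nat"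
  proof (induction k)
    case (Suc k)
    have "{1..int (Suc k)} = insert (int (Suc k)) {1..int k}" "{1..<int (Suc k)} = {1..int k}" by auto
    then show ?case using Suc by (auto simp: insert_absorb)
  qed simp
  from this[of "\<lambda>c. (1800 + 16 * D) * choice_cost n (card (occs f n c))" n] 10(1,4)
  show ?case by (simp add: sum.distrib sum_distrib_left algebra_simps)
qed (use s W in \<open>auto simp: frame_def partial_count_def choose_prog_def\<close>)

definition count_all_prog :: com where
  "count_all_prog = (bucket_prog;; log_prog;; chars_prog;; sum_prog)"

section \<open>The running time summed over the characters\<close>

lemma sum_card_occs:
  "(\<Sum>c\<in>f ` {1..int n}. card (occs f n c)) = n"
proof -
  have "(\<Sum>c\<in>f ` {1..int n}. \<Sum>x | x \<in> {1..int n} \<and> f x = c. 1 :: nat) = (\<Sum>x\<in>{1..int n}. 1)"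
    by (rule sum.group) auto
  moreover have "{x. x \<in> {1..int n} \<and> f x = c} = occs f n c" for c by (auto simp: occs_def)
  ultimately show ?thesis by simp
qed

text \<open>Each minimum is estimated twice: by the convolution cost, summed over at most
  \<open>k\<close> characters, and by the geometric mean of both costs, where the numbers of
  occurrences add up to n. The 6 is 4 + 1 + 1, as n and 1 are below either bound once n \<ge>
  2.\<close>

lemma choice_cost_sum_bound:
  assumes card: "card (f ` {1..int n}) \<le> k"
  shows "real (n + 1 + (\<Sum>c\<in>f ` {1..int n}. choice_cost n (card (occs f n c)))) \<le>
    6 * max 1 (min (real k * real n * (log 2 (real n))\<^sup>2) (real n powr (3 / 2) * log 2 (real n)))"
    (is "real (n + 1 + ?sum) \<le> 6 * max 1 (min ?b1 ?b2)")
proof (cases "n \<le> 1")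
  case True
  have "?sum \<le> (\<Sum>c\<in>f ` {1..int n}. 1)"
  proof (rule sum_mono)
    have "n * (bit_length n * bit_length n) \<le> 1 * (1 * 1)"
      using True bit_length_small by (intro mult_le_mono) auto
    then show "choice_cost n (card (occs f n c)) \<le> 1" for c by (simp add: choice_cost_def)
  qed
  also have "\<dots> \<le> card {1..int n}" using card_image_le[of "{1..int n}" f] by simp
  also have "\<dots> \<le> 1" using True by simp
  finally have "n + 1 + ?sum \<le> 3" using True by linarith
  then have "real (n + 1 + ?sum) \<le> real 3" by (rule of_nat_mono)
  then show ?thesis by simp
next
  case False
  define l where "l = log 2 (real n)"
  define b where "b = real (bit_length n)"
  have l: "1 \<le> l" "b \<le> 2 * l" using False bit_length_log[of n]
    by (auto simp: l_def b_def intro!: iffD2[OF le_log_iff])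
  have n: "1 \<le> real n" using False by simp
  have b0: "0 \<le> b" by (simp add: b_def)
  \<comment> \<open>A nonempty string has a character, so \<open>k\<close> is positive; this lets n
    be absorbed into the first bound.\<close>
  have k: "1 \<le> real k"
  proof -
    have "f ` {1..int n} \<noteq> {}" using False by simp
    then have "0 < card (f ` {1..int n})" by (simp add: card_gt_0_iff)
    then show ?thesis using card by simp
  qed
  have cost1: "real (choice_cost n m) \<le> 4 * (real n * l\<^sup>2)" for m
  proof -
    have "real (choice_cost n m) \<le> real (n * (bit_length n * bit_length n))" by (simp only: of_nat_le_iff choice_cost_def min.cobounded2)
    also have "\<dots> = real n * (b * b)" by (simp add: b_def)
    also have "\<dots> \<le> real n * ((2 * l) * (2 * l))" using l b0 by (intro mult_mono) auto
    finally show ?thesis by (simp add: power2_eq_square)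
  qed
  have cost2: "real (choice_cost n m) \<le> real m * (sqrt (real n) * (2 * l))" for m
  proof -
    \<comment> \<open>The square of a minimum is at most the product of its arguments.\<close>
    have "(real (choice_cost n m))\<^sup>2 \<le> real (m * m) * real (n * (bit_length n * bit_length n))"
      unfolding power2_eq_square by (intro mult_mono) (auto simp: choice_cost_def simp del: of_nat_mult)
    also have "\<dots> = (real m * (sqrt (real n) * b))\<^sup>2"
      by (simp add: b_def power2_eq_square algebra_simps)
    finally have "real (choice_cost n m) \<le> real m * (sqrt (real n) * b)"
      by (rule power2_le_imp_le) (simp add: b0)
    also have "\<dots> \<le> real m * (sqrt (real n) * (2 * l))" using l by (intro mult_left_mono) auto
    finally show ?thesis .
  qed
  have "real ?sum \<le> (\<Sum>c\<in>f ` {1..int n}. 4 * (real n * l\<^sup>2))"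
    unfolding of_nat_sum by (intro sum_mono cost1)
  also have "\<dots> = real (card (f ` {1..int n})) * (4 * (real n * l\<^sup>2))" by simp
  also have "\<dots> \<le> real k * (4 * (real n * l\<^sup>2))" using card by (intro mult_right_mono) auto
  finally have s1: "real ?sum \<le> 4 * (real k * real n * l\<^sup>2)" by simp
  have "real ?sum \<le> (\<Sum>c\<in>f ` {1..int n}. real (card (occs f n c)) * (sqrt (real n) * (2 * l)))"
    unfolding of_nat_sum by (intro sum_mono cost2)
  also have "\<dots> = real (\<Sum>c\<in>f ` {1..int n}. card (occs f n c)) * (sqrt (real n) * (2 * l))"
    by (simp only: of_nat_sum sum_distrib_right)
  also have "\<dots> = 2 * (real n powr (3 / 2) * l)"
  proof -
    have "real n powr (3 / 2) = real n powr (1 + 1 / 2)" by simp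
    also have "\<dots> = real n * sqrt (real n)" using n by (simp only: powr_add powr_one powr_half_sqrt of_nat_0_le_iff)
    finally show ?thesis by (simp add: sum_card_occs)
  qed
  finally have s2: "real ?sum \<le> 2 * (real n powr (3 / 2) * l)" .
  have "real n * 1 \<le> real n * l\<^sup>2" using l by (intro mult_left_mono) auto
  moreover have "1 * (real n * l\<^sup>2) \<le> real k * (real n * l\<^sup>2)" using k by (intro mult_right_mono) auto
  ultimately have n1: "real n \<le> real k * real n * l\<^sup>2" by (simp add: ac_simps)
  have "real n powr 1 * 1 \<le> real n powr (3 / 2) * l" using n l by (intro mult_mono powr_mono) auto
  then have n2: "real n \<le> real n powr (3 / 2) * l" using n by simp
  have "real (n + 1 + ?sum) \<le> 6 * (real k * real n * l\<^sup>2)" "real (n + 1 + ?sum) \<le> 6 * (real n powr (3 / 2) * l)"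
    unfolding of_nat_add of_nat_1 using s1 s2 n1 n2 n by linarith+
  then show ?thesis unfolding l_def by simp
qed

lemma count_all_correct:
  assumes D: "\<And>p. 1 \<le> p \<Longrightarrow> T (2 ^ p) \<le> D * (2 ^ p * p)"
    and S: "string_over a \<Sigma> S"
  shows "computes T (a + 10) (6 * (2000 + 16 * real D)) count_all_prog S
          (input [(''n'', int (length S))] [(''S'', S)])
          (min (real (card \<Sigma>) * real (length S) * (log 2 (real (length S)))\<^sup>2)
               (real (length S) powr (3 / 2) * log 2 (real (length S))))
          (counted (length S) (cadences3 S))"
proof (rule computesI)
  let ?n = "length S" and ?W = "(int (length S) + 2) ^ (a + 10)" and ?f = "array_of S"
  let ?s = "input [(''n'', int ?n)] [(''S'', S)]"
  let ?sum = "\<Sum>c\<in>?f ` {1..int ?n}. choice_cost ?n (card (occs ?f ?n c))"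
  note Wb = word_bounds[where n = ?n and a = a]
  note fa = string_over_bounds(1)[OF S]
  have fW: "\<bar>?f x\<bar> \<le> ?W" for x using fa Wb(5) by (rule order_trans)
  have fW2: "\<bar>?f x * (int ?n + 1)\<bar> + int ?n + 2 \<le> ?W" for x
  proof -
    \<comment> \<open>The quantity is at most 2 N^(a + 1), which N^(a + 3) dominates because N \<ge>
      2.\<close>
    define N where "N = int ?n + 2"
    have N: "2 \<le> N" by (simp add: N_def)
    then have Na: "1 \<le> N ^ a" by simp
    have "\<bar>?f x * (int ?n + 1)\<bar> \<le> N ^ a * N"
      unfolding abs_mult using fa[of x] unfolding N_def by (intro mult_mono) auto
    moreover have "1 * N \<le> N ^ a * N" using Na N by (intro mult_right_mono) auto
    moreover have "N ^ a * N * 2 \<le> N ^ a * N * (N * N)"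
    proof (rule mult_left_mono)
      have "2 * 1 \<le> N * N" using N by (intro mult_mono) auto
      then show "2 \<le> N * N" by simp
    qed (use Na N in simp)
    moreover have "N ^ a * N * (N * N) = N ^ (a + 3)" by (simp add: power_add power3_eq_cube)
    moreover have "N ^ (a + 3) \<le> ?W" using Wb(1) by (simp only: N_def)
    ultimately have "\<bar>?f x * (int ?n + 1)\<bar> + N \<le> ?W" by linarith
    then show ?thesis by (simp add: N_def)
  qed
  have n3: "int ?n ^ 3 \<le> ?W"
  proof -
    have "int ?n ^ 3 \<le> (int ?n + 2) ^ 3" by (rule power_mono) auto
    moreover have "0 \<le> (int ?n + 2) ^ 3" by simp
    ultimately show ?thesis using Wb(2) by linarith
  qed
  let ?g = "\<lambda>z. partial_count ?f ?n (Suc ?n) (int z)"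
  have g: "?g z = card (ending_at z (cadences3 S))" if "1 \<le> z" "z \<le> ?n" for z
  proof -
    have "?f (int z) \<in> ?f ` {1..<int (Suc ?n)}" using that by (intro imageI) auto
    then show ?thesis
      using that unfolding ending_at_cadences3
      by (simp add: card_ending_at_with partial_count_def array_of_char_at occs_def)
  qed
  have total: "card (cadences3 S) = (\<Sum>z=1..?n. ?g z)"
    unfolding card_eq_sum_ending_at[OF order_refl] by (rule sum.cong) (auto simp: g)
  have card: "card (?f ` {1..int ?n}) \<le> card \<Sigma>"
  proof (rule card_mono)
    show "?f ` {1..int ?n} \<subseteq> \<Sigma>" using S by (auto simp: array_of_def string_over_def subset_iff)
  qed (use S in \<open>simp add: string_over_def\<close>)
  show "wp T ?W count_all_prog ?s (\<lambda>t s'. counted ?n (cadences3 S) s' \<and>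
      real t \<le> 6 * (2000 + 16 * real D) * max 1 (min (real (card \<Sigma>) * real ?n * (log 2 (real ?n))\<^sup>2)
               (real ?n powr (3 / 2) * log 2 (real ?n))))"
    unfolding count_all_prog_def wp_Seq
  proof (rule wp_mono[OF wp_bucket_prog[where s = ?s and n = ?n and f = ?f, OF _ _ _ fa Wb(1)]], goal_cases)
    case (4 t1 s1)
    have v1: "vars s1 ''n'' = int ?n" "arrs s1 ''S'' = ?f" "arrs s1 ''cnt'' z = 0" "arrs s1 ''done'' z = 0" for z
      using 4(2) by (simp_all add: frame_def bucket_prog_def input_def lookup0_def)
    show ?case
    proof (rule wp_mono[OF wp_log_prog[OF v1(1)]], goal_cases)
      case (2 t2 s2)
      have v2: "vars s2 ''n'' = int ?n" "arrs s2 = arrs s1" "vars s2 ''lg'' = int (bit_length ?n)"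
        using 2 v1 by (simp_all add: frame_def log_prog_def fun_eq_iff)
      show ?case
      proof (rule wp_mono[OF wp_chars_prog[where f = ?f, OF v2(1) _ v2(3) _ _ _ _ D _ n3 fW fW2]], goal_cases)
        case (8 t3 s3)
        have v3: "vars s3 ''n'' = int ?n"
          using 8(2) v2 by (simp add: frame_def chars_prog_def choose_prog_def)
        show ?case
        proof (rule wp_mono[OF wp_sum_prog[OF v3, where g = ?g]], goal_cases)
          case (5 t4 s4)
          have "t1 + (t2 + (t3 + t4)) \<le> (40 * ?n + 10) + (20 * ?n + 20) + (60 * ?n + 10 + (1800 + 16 * D) * ?sum) + (16 * ?n + 20)"
            using 4(1) 2(1) 8(1) 5(1) by linarith
          also have "\<dots> \<le> (2000 + 16 * D) * (?n + 1 + ?sum)" by (simp add: algebra_simps)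
          finally have "real (t1 + (t2 + (t3 + t4))) \<le> real ((2000 + 16 * D) * (?n + 1 + ?sum))" by (rule of_nat_mono)
          also have "\<dots> = (2000 + 16 * real D) * real (?n + 1 + ?sum)"
            by (simp only: of_nat_mult of_nat_add of_nat_numeral)
          also have "\<dots> \<le> (2000 + 16 * real D) * (6 * max 1 (min (real (card \<Sigma>) * real ?n * (log 2 (real ?n))\<^sup>2)
               (real ?n powr (3 / 2) * log 2 (real ?n))))"
            by (intro mult_left_mono choice_cost_sum_bound card) simp
          finally show ?case using 5(1) 8(1) g by (auto simp: counted_def total algebra_simps)
        qed (use 8(1) Wb(4,6) in \<open>auto simp: partial_count_def card_starts\<close>)
      qed (use v1 v2 4(1) Wb(4) in auto)
    qed (use Wb(4) in simp)
  qed (auto simp: input_def lookup0_def)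
qed

section \<open>Listing cadences\<close>

text \<open>The comparison of \<open>out\<close> with \<open>o\<close> is part of the product of
  tests, so a scan runs on after the last required output but writes nothing more.\<close>

definition scan_prog :: com where
  "scan_prog = for_loop ''x'' (Const 1) (Var ''n'' \<oplus> Const 1)
    (Cond ((Var ''out'' \<prec> Var ''o'') \<otimes>
           (Const 3 \<otimes> Var ''x'' \<prec> Var ''z'' \<oplus> Const 1) \<otimes>
           (Const 2 \<otimes> Var ''n'' \<prec> Const 3 \<otimes> Var ''z'' \<ominus> Var ''x'') \<otimes>
           even_expr (Var ''x'' \<oplus> Var ''z'') \<otimes>
           (Read ''S'' ((Var ''x'' \<oplus> Var ''z'') \<oslash> Const 2) \<doteq> Read ''S'' (Var ''z'')) \<otimes>
           (Read ''S'' (Var ''x'') \<doteq> Read ''S'' (Var ''z'')))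
      (''out'' ::= Var ''out'' \<oplus> Const 1;;
       Store ''outI'' (Var ''out'') (Var ''x'');;
       Store ''outD'' (Var ''out'') ((Var ''z'' \<ominus> Var ''x'') \<oslash> Const 2))
      Skip)"

definition list_prog :: com where
  "list_prog = for_loop ''z'' (Const 1) (Var ''n'' \<oplus> Const 1)
    (Cond ((Const 0 \<prec> Read ''cnt'' (Var ''z'')) \<otimes> (Var ''out'' \<prec> Var ''o'')) scan_prog Skip)"

text \<open>The cadences that the loops have visited when their counters are \<open>z\<close> and
  \<open>x\<close>: ordered by end position, then by start. Measuring progress by this set makes the
  distinctness of the outputs a consequence of the order of visits.\<close>

definition cadences_before :: "int list \<Rightarrow> nat \<Rightarrow> nat \<Rightarrow> (nat \<times> nat) set" where
  "cadences_before S z x = {(i, d) \<in> cadences3 S. i + 2 * d < z \<or> i + 2 * d = z \<and> i < x}"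

lemma finite_cadences_before [simp]: "finite (cadences_before S z x)"
  by (rule finite_subset[OF _ finite_cadences3[of S]]) (auto simp: cadences_before_def)

lemma cadences_before_start: "cadences_before S 1 1 = {}"
  by (auto simp: cadences_before_def cadences3_def)

lemma cadences_before_end: "cadences_before S (Suc (length S)) 1 = cadences3 S"
  by (auto simp: cadences_before_def cadences3_def)

text \<open>No start exceeds the length, so the end of one inner loop is the beginning of the
  next.\<close>

lemma cadences_before_next: "cadences_before S (Suc z) 1 = cadences_before S z (Suc (length S))"
  by (auto simp: cadences_before_def cadences3_def)

lemma cadences_before_split:
  "cadences_before S (Suc z) 1 = cadences_before S z 1 \<union> ending_at z (cadences3 S)"
  by (auto simp: cadences_before_def cadences3_def ending_at_def)

lemma card_cadences_before_split:
  "card (cadences_before S (Suc z) 1) = card (cadences_before S z 1) + card (ending_at z (cadences3 S))"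
  unfolding cadences_before_split
proof (rule card_Un_disjoint[OF finite_cadences_before])
  show "finite (ending_at z (cadences3 S))"
    by (rule finite_subset[OF _ finite_cadences3[of S]]) (auto simp: ending_at_def)
qed (auto simp: cadences_before_def cadences3_def ending_at_def)

text \<open>Both ends determine the distance, so advancing the start by one adds at most one
  cadence.\<close>

lemma cadences_before_Suc:
  assumes "1 \<le> z" "z \<le> length S" "1 \<le> x" "x \<le> length S"
  shows "cadences_before S z (Suc x) =
    (if cadence_pair (array_of S) (length S) (array_of S (int z)) (int x) (int z) \<and> array_of S (int x) = array_of S (int z)
     then insert (x, (z - x) div 2) (cadences_before S z x) else cadences_before S z x)"
    (is "_ = (if ?P then _ else _)")
proof -
  have "(i, d) \<in> cadences3 S \<and> i + 2 * d = z \<and> i = x \<longleftrightarrow> ?P \<and> i = x \<and> d = (z - x) div 2" for i d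
  proof
    assume *: "(i, d) \<in> cadences3 S \<and> i + 2 * d = z \<and> i = x"
    then have z: "int z = int x + 2 * int d" "z = x + 2 * d" by auto
    have c: "0 < x" "x \<le> d" "length S < x + 3 * d" "char_at S x = char_at S (x + d)" "char_at S (x + d) = char_at S z"
      using * unfolding z(2) by (auto simp: cadences3_def)
    have mid: "(int x + int z) div 2 = int (x + d)" "(int x + int z) mod 2 = 0" using z by auto
    have "array_of S (int x) = char_at S x" "array_of S (int z) = char_at S z" "array_of S (int (x + d)) = char_at S (x + d)"
      using assms z(2) by (intro array_of_char_at; linarith)+
    then have ?P unfolding cadence_pair_def mid using c z by simp
    then show "?P \<and> i = x \<and> d = (z - x) div 2" using * z(2) by auto
  next
    assume *: "?P \<and> i = x \<and> d = (z - x) div 2"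
    then have p: "3 * int x < int z + 1" "2 * int (length S) < 3 * int z - int x" "(int x + int z) mod 2 = 0"
      "array_of S ((int x + int z) div 2) = array_of S (int z)" "array_of S (int x) = array_of S (int z)"
      by (auto simp: cadence_pair_def)
    have "x \<le> z" using p(1) by linarith
    moreover have "even (int x + int z)" using p(3) by presburger
    ultimately have "even (z - x)" by simp
    moreover have "d = (z - x) div 2" using * by blast
    ultimately have d: "z = x + 2 * d" using \<open>x \<le> z\<close> by auto
    then have mid: "(int x + int z) div 2 = int (x + d)" by auto
    have "array_of S (int x) = char_at S x" "array_of S (int z) = char_at S z" "array_of S (int (x + d)) = char_at S (x + d)"
      using assms d by (intro array_of_char_at; linarith)+
    then have "char_at S (x + d) = char_at S z" "char_at S x = char_at S z"
      using p(4,5) unfolding mid by simp_all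
    moreover have "x \<le> d" "length S < x + 3 * d" using p(1,2) d by linarith+
    ultimately have "(x, d) \<in> cadences3 S" using assms unfolding d cadences3_def by simp
    moreover have "i = x" using * by blast
    ultimately show "(i, d) \<in> cadences3 S \<and> i + 2 * d = z \<and> i = x" using d by blast
  qed
  then have iff: "(i, d) \<in> cadences_before S z (Suc x) \<longleftrightarrow>
      (i, d) \<in> cadences_before S z x \<or> ?P \<and> (i, d) = (x, (z - x) div 2)" for i d
    unfolding cadences_before_def mem_Collect_eq prod.case less_Suc_eq prod.inject by metis
  show ?thesis
  proof (rule set_eqI)
    fix p
    show "p \<in> cadences_before S z (Suc x) \<longleftrightarrow>
      p \<in> (if ?P then insert (x, (z - x) div 2) (cadences_before S z x) else cadences_before S z x)"
      using iff[of "fst p" "snd p"] unfolding prod.collapse by (auto split: if_split)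
  qed
qed

section \<open>Maintaining the output arrays\<close>

lemma lists_cadences_insert:
  assumes "lists_cadences k K s" "(i, d) \<notin> K"
    and "arrs s' ''outI'' = (arrs s ''outI'')(int (Suc k) := int i)"
    and "arrs s' ''outD'' = (arrs s ''outD'')(int (Suc k) := int d)"
  shows "lists_cadences (Suc k) (insert (i, d) K) s'"
proof -
  obtain f where f: "inj_on f {1..k}" "f ` {1..k} \<subseteq> K"
    "\<forall>j\<in>{1..k}. arrs s ''outI'' (int j) = int (fst (f j)) \<and> arrs s ''outD'' (int j) = int (snd (f j))"
    using assms(1) by (auto simp: lists_cadences_def)
  let ?f = "f(Suc k := (i, d))"
  have set: "{1..Suc k} = insert (Suc k) {1..k}" by auto
  have img: "?f ` {1..k} = f ` {1..k}" by (auto simp: image_iff)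
  have "inj_on ?f {1..Suc k}"
    unfolding set inj_on_insert
  proof
    have "(i, d) \<notin> f ` {1..k}" using f(2) assms(2) by blast
    then show "inj_on ?f {1..k}" by (rule inj_on_fun_updI[OF f(1)])
    show "?f (Suc k) \<notin> ?f ` ({1..k} - {Suc k})"
      using \<open>(i, d) \<notin> f ` {1..k}\<close> img by auto
  qed
  moreover have "?f ` {1..Suc k} \<subseteq> insert (i, d) K" unfolding set using f(2) img by auto
  moreover have "\<forall>j\<in>{1..Suc k}. arrs s' ''outI'' (int j) = int (fst (?f j)) \<and> arrs s' ''outD'' (int j) = int (snd (?f j))"
    unfolding set assms(3,4) using f(3) by auto
  ultimately show ?thesis unfolding lists_cadences_def by blast
qed

lemma lists_cadences_mono:
  "lists_cadences k K s \<Longrightarrow> K \<subseteq> K' \<Longrightarrow> arrs s' ''outI'' = arrs s ''outI'' \<Longrightarrow> arrs s' ''outD'' = arrs s ''outD'' \<Longrightarrow>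
    lists_cadences k K' s'"
  unfolding lists_cadences_def by (elim exE, rule exI) auto

text \<open>The number of outputs saturates at \<open>l\<close>. From then on the visited set may
  still grow, which is harmless because \<open>lists_cadences\<close> asks for inclusion
  only.\<close>

definition listed :: "int list \<Rightarrow> nat \<Rightarrow> nat \<Rightarrow> nat \<Rightarrow> state \<Rightarrow> bool" where
  "listed S l z x s \<longleftrightarrow> vars s ''out'' = int (min l (card (cadences_before S z x))) \<and>
     lists_cadences (min l (card (cadences_before S z x))) (cadences_before S z x) s"

lemma wp_scan_prog:
  assumes s: "vars s ''n'' = int (length S)" "vars s ''o'' = int l" "arrs s ''S'' = array_of S" "vars s ''z'' = int z"
    and z: "1 \<le> z" "z \<le> length S" and listed: "listed S l z 1 s"
    and W: "\<And>j. \<bar>array_of S j\<bar> \<le> W" "32 * (int (length S) + 2) \<le> W" "int l \<le> W"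
  shows "wp T W scan_prog s (\<lambda>t s'. t \<le> 90 * length S + 10 \<and> listed S l (Suc z) 1 s')"
  unfolding scan_prog_def
proof (rule wp_for_loop[where l = 1 and h = "Suc (length S)" and B = "\<lambda>_. 80" and I = "\<lambda>i s'. listed S l z i s'"], goal_cases)
  case (9 i s')
  let ?f = "array_of S" and ?n = "length S"
  define k where "k = min l (card (cadences_before S z i))"
  define P where "P \<longleftrightarrow> cadence_pair ?f ?n (?f (int z)) (int i) (int z) \<and> ?f (int i) = ?f (int z)"
  have i: "1 \<le> i" "i \<le> ?n" using 9 by auto
  have v: "vars s' ''n'' = int ?n" "vars s' ''o'' = int l" "arrs s' ''S'' = ?f" "vars s' ''z'' = int z" "vars s' ''out'' = int k"
    using 9 s by (simp_all add: frame_def listed_def k_def)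
  have k: "k \<le> l" by (simp add: k_def)
  have lk: "lists_cadences k (cadences_before S z i) s'" using 9(3) by (simp add: listed_def k_def)
  have b: "\<bar>int i\<bar> \<le> W" "\<bar>int z\<bar> \<le> W" "\<bar>int l\<bar> \<le> W" "\<bar>int k\<bar> \<le> W" "\<bar>int ?n\<bar> \<le> W" "\<bar>3 * int i\<bar> \<le> W" "\<bar>int z + 1\<bar> \<le> W"
    "\<bar>2 * int ?n\<bar> \<le> W" "\<bar>3 * int z\<bar> \<le> W" "\<bar>3 * int z - int i\<bar> \<le> W" "\<bar>int i + int z\<bar> \<le> W"
    "\<bar>(int i + int z) div 2\<bar> \<le> W" "\<bar>(int i + int z) mod 2\<bar> \<le> W" "\<bar>int z - int i\<bar> \<le> W" "\<bar>(int z - int i) div 2\<bar> \<le> W"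
    "0 \<le> W" "1 \<le> W" "2 \<le> W" "3 \<le> W"
    using W(2,3) i z k by auto
  note before = cadences_before_Suc[OF z i, folded P_def]
  have c: "(((((int k < int l \<and> 3 * int i < int z + 1) \<and> 2 * int ?n < 3 * int z - int i) \<and>
      (int i + int z) mod 2 = 0) \<and> ?f ((int i + int z) div 2) = ?f (int z)) \<and> ?f (int i) = ?f (int z)) \<longleftrightarrow> k < l \<and> P"
    by (auto simp: P_def cadence_pair_def)
  show ?case
  proof (cases "k < l \<and> P")
    case True
    then have kc: "k = card (cadences_before S z i)" by (auto simp: k_def)
    have notin: "(i, (z - i) div 2) \<notin> cadences_before S z i"
    proof -
      have "even (z - i)" "i \<le> z" using True by (auto simp: P_def cadence_pair_def)
      then show ?thesis by (auto simp: cadences_before_def)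
    qed
    have b': "\<bar>int k + 1\<bar> \<le> W" using True W(3) by auto
    have "min l (card (cadences_before S z (Suc i))) = Suc k"
      using True notin by (simp add: before kc)
    moreover have "lists_cadences (Suc k) (cadences_before S z (Suc i)) s''"
      if "arrs s'' ''outI'' = (arrs s' ''outI'')(int k + 1 := int i)"
        "arrs s'' ''outD'' = (arrs s' ''outD'')(int k + 1 := (int z - int i) div 2)" for s''
    proof -
      have "i \<le> z" using True by (auto simp: P_def cadence_pair_def)
      then have "(int z - int i) div 2 = int ((z - i) div 2)" by (simp add: of_nat_diff zdiv_int)
      then show ?thesis using lists_cadences_insert[OF lk notin, of s''] that True before by (simp add: add.commute)
    qed
    ultimately show ?thesis using True
      by (simp only: run_simps v 9(5) b b' W(1) c listed_def of_bool_eq) simp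
  next
    case False
    have "min l (card (cadences_before S z (Suc i))) = k"
      using False card_insert_le[of "cadences_before S z i" "(i, (z - i) div 2)"]
      by (auto simp: before k_def min_def)
    moreover have "lists_cadences k (cadences_before S z (Suc i)) (set_var ''x'' (int (Suc i)) s')"
      by (rule lists_cadences_mono[OF lk]) (auto simp: before)
    ultimately show ?thesis using False
      by (simp only: run_simps v 9(5) b W(1) c listed_def of_bool_eq)
  qed
next
  case (10 t s')
  then show ?case unfolding listed_def cadences_before_next by simp
qed (use s W listed in \<open>auto simp: frame_def listed_def intro: lists_cadences_mono\<close>)

text \<open>The number of outputs serves as a potential: a scanned end position has a cadence and is
  reached before saturation, so it raises the potential by at least 1. Hence at most
  \<open>l\<close> scans take place.\<close>

lemma sum_scanned_le:
  "(\<Sum>i=1..<k. of_bool (0 < card (ending_at i (cadences3 S)) \<and> card (cadences_before S i 1) < l)) \<le>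
    min l (card (cadences_before S k 1))"
proof (induction k)
  case (Suc k)
  have step: "min l b + of_bool (0 < c \<and> b < l) \<le> min l (b + c)" for b c :: nat by auto
  show ?case
  proof (cases "k = 0")
    case False
    define h :: "nat \<Rightarrow> nat" where
      "h i = of_bool (0 < card (ending_at i (cadences3 S)) \<and> card (cadences_before S i 1) < l)" for i
    have "(\<Sum>i=1..<Suc k. h i) = (\<Sum>i=1..<k. h i) + h k" using False by simp
    also have "\<dots> \<le> min l (card (cadences_before S k 1)) + h k" using Suc unfolding h_def by (rule add_right_mono)
    also have "\<dots> \<le> min l (card (cadences_before S (Suc k) 1))"
      unfolding h_def card_cadences_before_split by (rule step)
    finally show ?thesis unfolding h_def .
  qed simp
qed simp

lemma wp_list_prog:
  assumes s: "vars s ''n'' = int (length S)" "vars s ''o'' = int l" "arrs s ''S'' = array_of S" "vars s ''out'' = 0"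
    and cnt: "\<And>z. 1 \<le> z \<Longrightarrow> z \<le> length S \<Longrightarrow> arrs s ''cnt'' (int z) = int (card (ending_at z (cadences3 S)))"
    and W: "\<And>j. \<bar>array_of S j\<bar> \<le> W" "32 * (int (length S) + 2) \<le> W" "int l \<le> W"
      "\<And>z. \<bar>arrs s ''cnt'' z\<bar> \<le> W"
    and l: "1 \<le> l" "l \<le> card (cadences3 S)"
  shows "wp T W list_prog s (\<lambda>t s'. t \<le> 200 * (l * length S) \<and> lists_cadences l (cadences3 S) s')"
  unfolding list_prog_def
proof (rule wp_for_loop[where l = 1 and h = "Suc (length S)" and I = "\<lambda>i s'. listed S l i 1 s'" and
    B = "\<lambda>i. 20 + of_bool (0 < card (ending_at i (cadences3 S)) \<and> card (cadences_before S i 1) < l) * (90 * length S + 10)"], goal_cases)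
  case (9 i s')
  let ?n = "length S"
  define k where "k = min l (card (cadences_before S i 1))"
  define c where "c = card (ending_at i (cadences3 S))"
  have i: "1 \<le> i" "i \<le> ?n" using 9 by auto
  have v: "vars s' ''n'' = int ?n" "vars s' ''o'' = int l" "arrs s' ''S'' = array_of S" "vars s' ''out'' = int k"
    "arrs s' ''cnt'' (int i) = int c"
    using 9 s cnt[OF i] by (simp_all add: frame_def listed_def k_def scan_prog_def c_def)
  have b: "\<bar>int i\<bar> \<le> W" "\<bar>int l\<bar> \<le> W" "\<bar>int k\<bar> \<le> W" "\<bar>int c\<bar> \<le> W" "0 \<le> W" "1 \<le> W"
    using W(2,3) W(4)[of "int i"] cnt[OF i] i by (auto simp: k_def c_def)
  have kl: "k < l \<longleftrightarrow> card (cadences_before S i 1) < l" by (auto simp: k_def)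
  have test: "0 < int c \<and> int k < int l \<longleftrightarrow> 0 < c \<and> k < l" by auto
  show ?case
  proof (cases "0 < c \<and> k < l")
    case True
    have "wp T W scan_prog s' (\<lambda>t s''. t \<le> 90 * ?n + 10 \<and> listed S l (Suc i) 1 s'')"
      by (rule wp_scan_prog[OF v(1-3) 9(5) i 9(3) W(1-3)])
    then have "wp T W scan_prog s' (\<lambda>t s''. t + 15 \<le> 30 + 90 * ?n \<and> listed S l (Suc i) 1 (set_var ''z'' (int (Suc i)) s''))"
      by (rule wp_mono) (auto simp: listed_def intro: lists_cadences_mono)
    then show ?thesis using True
      by (simp only: run_simps v 9(5) b W(1) test of_bool_eq c_def[symmetric] kl[symmetric] zero_neq_one one_neq_zero) (erule wp_mono, simp)
  next
    case False
    \<comment> \<open>A failed test means that nothing ends here or that the output is complete;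
      either way the number of outputs does not change.\<close>
    have "ending_at i (cadences3 S) = {} \<or> l \<le> card (cadences_before S i 1)"
    proof -
      have "finite (ending_at i (cadences3 S))"
        by (rule finite_subset[OF _ finite_cadences3[of S]]) (auto simp: ending_at_def)
      then show ?thesis using False unfolding c_def kl by auto
    qed
    then have "min l (card (cadences_before S (Suc i) 1)) = k"
      using card_cadences_before_split[of S i] by (auto simp: k_def)
    moreover have "lists_cadences k (cadences_before S (Suc i) 1) (set_var ''z'' (int (Suc i)) s')"
    proof (rule lists_cadences_mono)
      show "lists_cadences k (cadences_before S i 1) s'" using 9(3) by (simp only: listed_def k_def)
      show "cadences_before S i 1 \<subseteq> cadences_before S (Suc i) 1" unfolding cadences_before_split by blast
    qed simp_all
    ultimately show ?thesis using False
      by (simp only: run_simps v 9(5) b W(1) test of_bool_eq c_def[symmetric] kl[symmetric] listed_def)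
  qed
next
  case (10 t s')
  \<comment> \<open>A cadence exists, so the string is nonempty; then the additive costs n, l and 1
    are all at most l n.\<close>
  have pos: "1 \<le> length S"
  proof (rule ccontr)
    assume "\<not> 1 \<le> length S"
    then have "cadences3 S = {}" by (auto simp: cadences3_def)
    with l show False by simp
  qed
  define h :: "nat \<Rightarrow> nat" where
    "h i = of_bool (0 < card (ending_at i (cadences3 S)) \<and> card (cadences_before S i 1) < l)" for i
  define M where "M = 90 * length S + 10"
  have "(\<Sum>i=1..<Suc (length S). h i) \<le> l"
    unfolding h_def using sum_scanned_le[of S l "Suc (length S)"] by (rule order_trans) simp
  then have hM: "(\<Sum>i=1..<Suc (length S). h i) * M \<le> l * M" by (rule mult_le_mono1)
  have "t \<le> (\<Sum>i=1..<Suc (length S). 20 + h i * M + cost (Var ''n'' \<oplus> Const 1) + 7) + 8"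
    using 10(4) by (simp only: h_def[symmetric] M_def[symmetric]) simp
  also have "\<dots> = 30 * length S + (\<Sum>i=1..<Suc (length S). h i) * M + 8"
    by (simp only: sum.distrib sum_distrib_right) simp
  also have "\<dots> \<le> 30 * length S + l * (90 * length S + 10) + 8" using hM unfolding M_def by simp
  also have "\<dots> \<le> 200 * (l * length S)"
  proof -
    have "1 * length S \<le> l * length S" "l * 1 \<le> l * length S" "1 * 1 \<le> l * length S"
      using l pos by (intro mult_le_mono; simp)+
    moreover have "30 * length S + l * (90 * length S + 10) + 8 =
      30 * (1 * length S) + 90 * (l * length S) + 10 * (l * 1) + 8 * (1 * 1)" by (simp add: algebra_simps)
    ultimately show ?thesis by linarith
  qed
  finally show ?case using 10(1) l unfolding listed_def cadences_before_end by simp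
qed (use s W in \<open>auto simp: frame_def listed_def scan_prog_def cadences_before_start[unfolded One_nat_def] lists_cadences_def\<close>)

lemma list_correct:
  assumes S: "string_over a \<Sigma> S" and l: "1 \<le> l" "l \<le> card (cadences3 S)"
  shows "computes T (a + 10) 200 list_prog S
          (input [(''n'', int (length S)), (''o'', int l)] [(''S'', S), (''cnt'', end_counts S)])
          (real l * real (length S))
          (lists_cadences l (cadences3 S))"
proof (rule computesI)
  let ?n = "length S" and ?W = "(int (length S) + 2) ^ (a + 10)"
  let ?s = "input [(''n'', int ?n), (''o'', int l)] [(''S'', S), (''cnt'', end_counts S)]"
  note Wb = word_bounds[where n = ?n and a = a]
  have le: "card (ending_at z (cadences3 S)) \<le> ?n" if "1 \<le> z" "z \<le> ?n" for z
    using that unfolding ending_at_cadences3 by (simp add: card_ending_at_with card_starts)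
  \<comment> \<open>At most n cadences share an end position, so there are at most n^2 in all and
    the requested number fits into a word.\<close>
  have "card (cadences3 S) \<le> (\<Sum>z=1..?n. ?n)"
    unfolding card_eq_sum_ending_at[OF order_refl] by (intro sum_mono le) auto
  then have "l \<le> ?n * ?n" using l by simp
  then have "int l \<le> int (?n * ?n)" by (simp only: of_nat_le_iff)
  then have lW: "int l \<le> ?W" using Wb(6) by simp
  have cnt: "arrs ?s ''cnt'' (int z) = int (card (ending_at z (cadences3 S)))" if "1 \<le> z" "z \<le> ?n" for z
  proof -
    have "[1..<?n + 1] ! (z - 1) = z" using that by (subst nth_upt) auto
    then show ?thesis
      using that by (simp add: input_def end_counts_def array_of_def nat_diff_distrib del: upt_Suc)
  qed
  have cntW: "\<bar>arrs ?s ''cnt'' z\<bar> \<le> ?W" for z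
  proof (cases "1 \<le> z \<and> z \<le> int ?n")
    case True
    then have "arrs ?s ''cnt'' z = int (card (ending_at (nat z) (cadences3 S)))" using cnt[of "nat z"] by (simp add: Suc_le_eq nat_le_iff)
    then show ?thesis using le[of "nat z"] True Wb(4) by (simp add: Suc_le_eq nat_le_iff)
  next
    case False
    then have "arrs ?s ''cnt'' z = 0" by (auto simp: input_def end_counts_def array_of_def)
    then show ?thesis using Wb(4) by simp
  qed
  have "wp T ?W list_prog ?s (\<lambda>t s'. t \<le> 200 * (l * ?n) \<and> lists_cadences l (cadences3 S) s')"
  proof (rule wp_list_prog[OF _ _ _ _ cnt _ _ lW cntW l])
    show "\<bar>array_of S j\<bar> \<le> ?W" for j
      using string_over_bounds(1)[OF S] Wb(5) by (rule order_trans)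
  qed (use Wb(4) in \<open>auto simp: input_def lookup0_def\<close>)
  then show "wp T ?W list_prog ?s (\<lambda>t s'. lists_cadences l (cadences3 S) s' \<and>
      real t \<le> 200 * max 1 (real l * real ?n))"
  proof (rule wp_mono, goal_cases)
    case (1 t s')
    then have "real t \<le> real (200 * (l * ?n))" by (intro of_nat_mono) simp
    then show ?case using 1(1) by simp
  qed
qed

section \<open>The theorem\<close>

text \<open>The asymptotic bound says nothing below some threshold \<open>N\<close>; the finitely
  many values there are absorbed into \<open>D\<close> by adding their sum. At \<open>p = 0\<close>
  the logarithm vanishes, hence \<open>1 \<le> p\<close>.\<close>

lemma power_of_two_bound:
  fixes T :: "nat \<Rightarrow> nat"
  assumes "(\<lambda>m. real (T m)) \<in> O(\<lambda>m. real m * log 2 (real m))"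
  obtains D where "\<And>p. 1 \<le> p \<Longrightarrow> T (2 ^ p) \<le> D * (2 ^ p * p)"
proof -
  obtain c where c: "0 < c" "eventually (\<lambda>m. norm (real (T m)) \<le> c * norm (real m * log 2 (real m))) at_top"
    using assms by (rule landau_o.bigE)
  then obtain N where N: "\<And>m. N \<le> m \<Longrightarrow> norm (real (T m)) \<le> c * norm (real m * log 2 (real m))"
    by (auto simp: eventually_at_top_linorder)
  define D where "D = nat \<lceil>c\<rceil> + (\<Sum>m<N. T m)"
  have "T (2 ^ p) \<le> D * (2 ^ p * p)" if p: "1 \<le> p" for p
  proof (cases "N \<le> 2 ^ p")
    case True
    have "real (T (2 ^ p)) \<le> c * (2 ^ p * real p)"
      using N[OF True] by (simp add: log_nat_power)
    also have "\<dots> \<le> real (nat \<lceil>c\<rceil>) * (2 ^ p * real p)"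
      by (intro mult_right_mono) (simp_all add: real_nat_ceiling_ge)
    also have "\<dots> = real (nat \<lceil>c\<rceil> * (2 ^ p * p))" by simp
    finally have "T (2 ^ p) \<le> nat \<lceil>c\<rceil> * (2 ^ p * p)" by (simp only: of_nat_le_iff)
    also have "\<dots> \<le> D * (2 ^ p * p)" by (intro mult_le_mono1) (simp add: D_def)
    finally show ?thesis .
  next
    case False
    then have "T (2 ^ p) \<le> (\<Sum>m<N. T m)" by (intro member_le_sum) auto
    also have "\<dots> \<le> D * 1" by (simp add: D_def)
    also have "\<dots> \<le> D * (2 ^ p * p)" using p by (intro mult_le_mono2) simp
    finally show ?thesis .
  qed
  then show thesis by (rule that)
qed

theorem corollary1:
  fixes T :: "nat \<Rightarrow> nat"
  assumes convolution: "(\<lambda>m. real (T m)) \<in> O(\<lambda>m. real m * log 2 (real m))"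
  shows
    "(\<exists>P C. \<forall>a. \<exists>k. \<forall>\<Sigma> S. string_over a \<Sigma> S \<longrightarrow> (\<forall>\<sigma>\<in>\<Sigma>.
        computes T k C P S
          (input [(''n'', int (length S)), (''sigma'', \<sigma>)] [(''S'', S)])
          (real (length S) * (log 2 (real (length S)))\<^sup>2)
          (counted (length S) (cadences3_with \<sigma> S))))
   \<and> (\<exists>P C. \<forall>a. \<exists>k. \<forall>\<Sigma> S. string_over a \<Sigma> S \<longrightarrow> (\<forall>\<sigma>\<in>\<Sigma>. \<forall>occ.
        distinct occ \<and> set occ = occurrences \<sigma> S \<longrightarrow>
        computes T k C P S
          (input [(''n'', int (length S)), (''sigma'', \<sigma>), (''nsigma'', int (length occ))]
                 [(''S'', S), (''occ'', map int occ)])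
          ((real (card (occurrences \<sigma> S)))\<^sup>2)
          (counted (length S) (cadences3_with \<sigma> S))))
   \<and> (\<exists>P C. \<forall>a. \<exists>k. \<forall>\<Sigma> S. string_over a \<Sigma> S \<longrightarrow>
        computes T k C P S
          (input [(''n'', int (length S))] [(''S'', S)])
          (min (real (card \<Sigma>) * real (length S) * (log 2 (real (length S)))\<^sup>2)
               (real (length S) powr (3 / 2) * log 2 (real (length S))))
          (counted (length S) (cadences3 S)))
   \<and> (\<exists>P C. \<forall>a. \<exists>k. \<forall>\<Sigma> S. string_over a \<Sigma> S \<longrightarrow> (\<forall>l\<ge>1. l \<le> card (cadences3 S) \<longrightarrow>
        computes T k C P S
          (input [(''n'', int (length S)), (''o'', int l)] [(''S'', S), (''cnt'', end_counts S)])
          (real l * real (length S))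
          (lists_cadences l (cadences3 S))))"
proof -
  \<comment> \<open>\<open>D\<close> carries all that the time bounds know of the convolution
    algorithm. The programs do not depend on \<open>T\<close>, the constants \<open>C\<close> do not
    depend on \<open>a\<close>, and \<open>k\<close> is \<open>a + 10\<close> in all four
    parts.\<close>
  obtain D where D: "\<And>p. 1 \<le> p \<Longrightarrow> T (2 ^ p) \<le> D * (2 ^ p * p)"
    using convolution by (rule power_of_two_bound) blast
  show ?thesis
  proof (intro conjI)
    show "\<exists>P C. \<forall>a. \<exists>k. \<forall>\<Sigma> S. string_over a \<Sigma> S \<longrightarrow> (\<forall>\<sigma>\<in>\<Sigma>.
        computes T k C P S
          (input [(''n'', int (length S)), (''sigma'', \<sigma>)] [(''S'', S)])
          (real (length S) * (log 2 (real (length S)))\<^sup>2)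
          (counted (length S) (cadences3_with \<sigma> S)))"
      using count_with_correct[of T D, OF D] by blast
    show "\<exists>P C. \<forall>a. \<exists>k. \<forall>\<Sigma> S. string_over a \<Sigma> S \<longrightarrow> (\<forall>\<sigma>\<in>\<Sigma>. \<forall>occ.
        distinct occ \<and> set occ = occurrences \<sigma> S \<longrightarrow>
        computes T k C P S
          (input [(''n'', int (length S)), (''sigma'', \<sigma>), (''nsigma'', int (length occ))]
                 [(''S'', S), (''occ'', map int occ)])
          ((real (card (occurrences \<sigma> S)))\<^sup>2)
          (counted (length S) (cadences3_with \<sigma> S)))"
      using count_quad_correct[where T = T] by blast
    show "\<exists>P C. \<forall>a. \<exists>k. \<forall>\<Sigma> S. string_over a \<Sigma> S \<longrightarrow>
        computes T k C P S
          (input [(''n'', int (length S))] [(''S'', S)])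
          (min (real (card \<Sigma>) * real (length S) * (log 2 (real (length S)))\<^sup>2)
               (real (length S) powr (3 / 2) * log 2 (real (length S))))
          (counted (length S) (cadences3 S))"
      using count_all_correct[of T D, OF D] by blast
    show "\<exists>P C. \<forall>a. \<exists>k. \<forall>\<Sigma> S. string_over a \<Sigma> S \<longrightarrow> (\<forall>l\<ge>1. l \<le> card (cadences3 S) \<longrightarrow>
        computes T k C P S
          (input [(''n'', int (length S)), (''o'', int l)] [(''S'', S), (''cnt'', end_counts S)])
          (real l * real (length S))
          (lists_cadences l (cadences3 S)))"
      using list_correct[where T = T] by blast
  qed
qed

end
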